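(* Let $K$ be a field, $q\in K$ a primitive $n$'th root of unity with $n\ge2$, and $\mathcal{A}=K[h][x^{\pm1};\sigma]$ with $\sigma(h)=qh$. Then $Z(\mathcal{A})=K[s,t^{\pm1}]$ where $s=h^n$ and $t=x^n$, and: 1. $\mathrm{Spec}(\mathcal{A})=\{\{0\},(h)\}\sqcup\mathbb{M}'\sqcup\mathbb{H}'\sqcup\mathcal{N}'$, where $\mathbb{M}'=\{\mathcal{A}\mathfrak{m}\mid\mathfrak{m}\in\mathrm{Max}(Z(\mathcal{A})),\ s\notin\mathfrak{m}\}$, $\mathbb{H}'=\{(h,\mathfrak{q}')\mid\mathfrak{q}'\in\mathrm{Spec}\,K[x^{\pm1}]\setminus\{0\}\}$, $\mathcal{N}'=\{\mathcal{A}\mathfrak{n}\mid\mathfrak{n}\in\mathrm{Spec}\,Z(\mathcal{A}),\ \mathrm{ht}(\mathfrak{n})=1,\ \mathfrak{n}\neq(s)\}$. The strict inclusions between prime ideals are as follows: $\{0\}$ is contained in every prime; $(h)$ is contained in every element of $\mathbb{H}'$; and all remaining strict inclusions are inclusions of an element of $\mathcal{N}'$ in an element of $\mathbb{M}'\cup\mathbb{H}'$. 2. Every nonzero ideal of the algebra $\mathcal{A}$ meets the centre $Z(\mathcal{A})$ nontrivially. 3. $\mathrm{Max}(\mathcal{A})=\mathbb{M}'\sqcup\mathbb{H}'$.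
   Context: $\mathcal{A}$ is the skew Laurent polynomial algebra: the $K$-algebra generated by $h,x,x^{-1}$ with $xx^{-1}=x^{-1}x=1$ and $xh=qhx$. $\mathrm{Spec}$ and $\mathrm{Max}$ denote the sets of prime and maximal (two-sided) ideals, $Z(\cdot)$ the centre, $\mathrm{ht}$ the height of a prime ideal, and $(\ldots)$ the two-sided ideal generated by the listed elements/sets. *)

theory Defs
  imports
    "HOL-Algebra.QuotRing"
    "HOL-Algebra.Ideal_Product"
    "HOL-Computational_Algebra.Polynomial"
    "HOL-Library.Poly_Mapping"
    "HOL-Library.Extended_Nat"
begin

section \<open>Prime spectrum, maximal spectrum, height and centre of a ring\<close>

text \<open>
  The rings here need not be commutative; all ideals are two-sided. Primeness is the usual
  noncommutative notion, in terms of products of ideals; the library predicate \<open>primeideal\<close>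
  is restricted to commutative rings.
\<close>

definition Spec :: "('a, 'm) ring_scheme \<Rightarrow> 'a set set" where
  "Spec R = {P. ideal P R \<and> P \<noteq> carrier R \<and>
     (\<forall>I J. ideal I R \<and> ideal J R \<and> ideal_prod R I J \<subseteq> P \<longrightarrow> I \<subseteq> P \<or> J \<subseteq> P)}"

definition Max_Spec :: "('a, 'm) ring_scheme \<Rightarrow> 'a set set" where
  "Max_Spec R = {M. maximalideal M R}"

definition ht :: "('a, 'm) ring_scheme \<Rightarrow> 'a set \<Rightarrow> enat" where
  "ht R P = Sup {enat k | k. \<exists>C :: nat \<Rightarrow> 'a set.
     (\<forall>i\<le>k. C i \<in> Spec R) \<and> (\<forall>i<k. C i \<subset> C (Suc i)) \<and> C k = P}"

definition centre :: "('a, 'm) ring_scheme \<Rightarrow> 'a set" where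
  "centre R = {z \<in> carrier R. \<forall>a \<in> carrier R. z \<otimes>\<^bsub>R\<^esub> a = a \<otimes>\<^bsub>R\<^esub> z}"

abbreviation centre_ring :: "('a, 'm) ring_scheme \<Rightarrow> ('a, 'm) ring_scheme" where
  "centre_ring R \<equiv> R\<lparr>carrier := centre R\<rparr>"


section \<open>Skew Laurent polynomial rings\<close>

definition int_iterate :: "('a \<Rightarrow> 'a) \<Rightarrow> int \<Rightarrow> 'a \<Rightarrow> 'a" where
  "int_iterate \<sigma> i = (if 0 \<le> i then \<sigma> ^^ nat i else inv_into UNIV \<sigma> ^^ nat (- i))"

text \<open>
  \<open>skew_laurent \<sigma>\<close> is $D[x^{\pm 1};\sigma]$ for an automorphism \<open>\<sigma>\<close> of the coefficient ring $D$ (a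
  type): the finitely supported map \<open>f\<close> stands for $\sum_i f_i x^i$ with coefficients on the left,
  and $(a x^i)(b x^j) = a\,\sigma^i(b)\,x^{i+j}$; in particular $x b = \sigma(b) x$.
\<close>

definition skew_mult ::
    "('a::ring_1 \<Rightarrow> 'a) \<Rightarrow> (int \<Rightarrow>\<^sub>0 'a) \<Rightarrow> (int \<Rightarrow>\<^sub>0 'a) \<Rightarrow> (int \<Rightarrow>\<^sub>0 'a)" where
  "skew_mult \<sigma> f g =
     (\<Sum>i\<in>Poly_Mapping.keys f. \<Sum>j\<in>Poly_Mapping.keys g.
        Poly_Mapping.single (i + j)
          (Poly_Mapping.lookup f i * int_iterate \<sigma> i (Poly_Mapping.lookup g j)))"

definition skew_laurent :: "('a::ring_1 \<Rightarrow> 'a) \<Rightarrow> (int \<Rightarrow>\<^sub>0 'a) ring" where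
  "skew_laurent \<sigma> = \<lparr>carrier = UNIV, monoid.mult = skew_mult \<sigma>, one = Poly_Mapping.single 0 1,
                      zero = 0, add = (+)\<rparr>"

text \<open>
  Elements of $K[y][z^{\pm 1};\sigma]$: the scalars, and the generators $y$, $z$.
\<close>

definition scalar :: "'k::field \<Rightarrow> (int \<Rightarrow>\<^sub>0 'k poly)" where
  "scalar c = Poly_Mapping.single 0 [:c:]"

definition gen_y :: "int \<Rightarrow>\<^sub>0 'k::field poly" where
  "gen_y = Poly_Mapping.single 0 [:0, 1:]"

definition gen_z :: "int \<Rightarrow>\<^sub>0 'k::field poly" where
  "gen_z = Poly_Mapping.single 1 1"

text \<open>
  The commutative algebra $K[y, z^{\pm 1}]$, as $K[y][z^{\pm 1}; \mathrm{id}]$; it has the same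
  underlying type as the algebra \<open>Alg q\<close> below, but a different multiplication.
\<close>

definition laurent_alg :: "(int \<Rightarrow>\<^sub>0 'k::field poly) ring" where
  "laurent_alg = skew_laurent id"


section \<open>The algebra $\mathcal{A} = K[h][x^{\pm 1};\sigma]$ with $\sigma(h) = qh$\<close>

definition primitive_root_of_unity :: "nat \<Rightarrow> 'k::field \<Rightarrow> bool" where
  "primitive_root_of_unity n q \<longleftrightarrow> n > 0 \<and> q ^ n = 1 \<and> (\<forall>m. 0 < m \<and> m < n \<longrightarrow> q ^ m \<noteq> 1)"

text \<open>\<open>pcompose p [:0, q:]\<close> is $p(qh)$.\<close>

definition sigma :: "'k::field \<Rightarrow> 'k poly \<Rightarrow> 'k poly" where
  "sigma q p = pcompose p [:0, q:]"

definition Alg :: "'k::field \<Rightarrow> (int \<Rightarrow>\<^sub>0 'k poly) ring" where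
  "Alg q = skew_laurent (sigma q)"

abbreviation (input) h_elem :: "int \<Rightarrow>\<^sub>0 'k::field poly" where "h_elem \<equiv> gen_y"
abbreviation (input) x_elem :: "int \<Rightarrow>\<^sub>0 'k::field poly" where "x_elem \<equiv> gen_z"

definition s_elem :: "nat \<Rightarrow> 'k::field \<Rightarrow> (int \<Rightarrow>\<^sub>0 'k poly)" where
  "s_elem n q = h_elem [^]\<^bsub>Alg q\<^esub> n"

definition t_elem :: "nat \<Rightarrow> 'k::field \<Rightarrow> (int \<Rightarrow>\<^sub>0 'k poly)" where
  "t_elem n q = x_elem [^]\<^bsub>Alg q\<^esub> n"

abbreviation Z_Alg :: "'k::field \<Rightarrow> (int \<Rightarrow>\<^sub>0 'k poly) ring" where
  "Z_Alg q \<equiv> centre_ring (Alg q)"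

text \<open>The subalgebra $K[x^{\pm 1}]$ of $\mathcal{A}$: all coefficients lie in $K \subseteq K[h]$.\<close>

definition K_x :: "'k::field \<Rightarrow> (int \<Rightarrow>\<^sub>0 'k poly) ring" where
  "K_x q = (Alg q)\<lparr>carrier := {f. \<forall>i. \<exists>c. Poly_Mapping.lookup f i = [:c:]}\<rparr>"

text \<open>For a subset \<open>m\<close> of the algebra, the set $\mathcal{A}m$ of finite sums of products $am$.\<close>

abbreviation A_times :: "'k::field \<Rightarrow> (int \<Rightarrow>\<^sub>0 'k poly) set \<Rightarrow> (int \<Rightarrow>\<^sub>0 'k poly) set" where
  "A_times q m \<equiv> ideal_prod (Alg q) (carrier (Alg q)) m"

definition h_ideal :: "'k::field \<Rightarrow> (int \<Rightarrow>\<^sub>0 'k poly) set" where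
  "h_ideal q = genideal (Alg q) {h_elem}"

definition MM :: "nat \<Rightarrow> 'k::field \<Rightarrow> (int \<Rightarrow>\<^sub>0 'k poly) set set" where
  "MM n q = {A_times q m | m. m \<in> Max_Spec (Z_Alg q) \<and> s_elem n q \<notin> m}"

definition HH :: "'k::field \<Rightarrow> (int \<Rightarrow>\<^sub>0 'k poly) set set" where
  "HH q = {genideal (Alg q) ({h_elem} \<union> Q) | Q. Q \<in> Spec (K_x q) - {{\<zero>\<^bsub>K_x q\<^esub>}}}"

definition NN :: "nat \<Rightarrow> 'k::field \<Rightarrow> (int \<Rightarrow>\<^sub>0 'k poly) set set" where
  "NN n q = {A_times q N | N. N \<in> Spec (Z_Alg q) \<and> ht (Z_Alg q) N = 1 \<and>
                               N \<noteq> genideal (Z_Alg q) {s_elem n q}}"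

end

theory Submission
  imports Defs
begin

text \<open>
  Write $L = K[s, t^{\pm 1}]$; the centre of the algebra is the image of $L$ under
  $s \mapsto h^n$, $t \mapsto x^n$, and the algebra is free over it on the $h^i x^j$ with
  $0 \le i, j < n$. Commuting with $x$ and with $h$ multiplies $h^i x^j$ by $q^i$ and by $q^j$, so
  splitting into eigenvectors shows that an ideal contains, up to a power of the central element
  $h^n$, the central coordinates of each of its elements. Hence a prime not containing $h$ is
  generated by its intersection with the centre, while $h$ is normal and the primes containing it
  are those of the commutative quotient $K[x^{\pm 1}]$.

  What remains is that $L$ has dimension two and that none of its maximal ideals has height one.
  For the first, two primes of a polynomial ring $E[t]$, one strictly inside the other, with the
  same contraction $e$ to $E$ force the smaller one to be $e E[t]$; here $E = K[s]$ has dimension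
  one. No unique factorisation in $L$ is used.
\<close>

text \<open>Two obstacles shape the proof. First, x is invertible but h is not: conjugation by x
  preserves an ideal, whereas comparing v h with h v only yields h times the twisted element. Hence
  the splitting takes place in the saturation by powers of h, and a power of h is paid on the way
  back. This is also why (s) has to be left out: its extension to the algebra contains h^n but not
  h, and since h is normal it is not prime; (h) takes its place.

  Second, primes of height one in L are not described by generators. They are treated as the minimal
  nonzero primes, and the inclusions follow from two facts: a nonzero prime that is not minimal is
  maximal, and a nonzero prime inside (s) contains s.

  L and the skew algebra share one type and differ in the product, \<open>*\<close> against
  \<open>\<star>\<close>. The commutative part therefore works with type-class arithmetic and plain
  sets, and \<open>comm_image\<close> carries the results over to rings with carriers.\<close>

definition cideal :: "'a::comm_ring_1 set \<Rightarrow> bool" where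
  "cideal I \<longleftrightarrow> 0 \<in> I \<and> (\<forall>a\<in>I. \<forall>b\<in>I. a + b \<in> I)
      \<and> (\<forall>a\<in>I. \<forall>r. r * a \<in> I)"

definition cprime :: "'a::comm_ring_1 set \<Rightarrow> bool" where
  "cprime P \<longleftrightarrow> cideal P \<and> 1 \<notin> P \<and> (\<forall>a b. a * b \<in> P
      \<longrightarrow> a \<in> P \<or> b \<in> P)"

definition cmaximal :: "'a::comm_ring_1 set \<Rightarrow> bool" where
  "cmaximal M \<longleftrightarrow> cideal M \<and> 1 \<notin> M \<and> (\<forall>J. cideal J
      \<and> M \<subset> J \<longrightarrow> 1 \<in> J)"

lemma cideal_zero: "cideal I \<Longrightarrow> 0 \<in> I"
  and cideal_add: "cideal I \<Longrightarrow> a \<in> I \<Longrightarrow> b \<in> I \<Longrightarrow> a + b \<in> I"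
  and cideal_mult: "cideal I \<Longrightarrow> a \<in> I \<Longrightarrow> r * a \<in> I"
  by (auto simp: cideal_def)

lemma cideal_mult2: "cideal I \<Longrightarrow> a \<in> I \<Longrightarrow> a * r \<in> I"
  using cideal_mult[of I a r] by (simp add: mult.commute)

lemma cideal_uminus: "cideal I \<Longrightarrow> a \<in> I \<Longrightarrow> - a \<in> I"
  using cideal_mult[of I a "-1"] by simp

lemma cideal_diff: "cideal I \<Longrightarrow> a \<in> I \<Longrightarrow> b \<in> I \<Longrightarrow> a - b \<in> I"
  using cideal_add[of I a "-b"] cideal_uminus by auto

lemma cideal_sum:
  assumes "cideal I" "\<And>x. x \<in> A \<Longrightarrow> f x \<in> I"
  shows "sum f A \<in> I"
  using assms(2)
  by (induction A rule: infinite_finite_induct) (auto intro: cideal_add cideal_zero assms(1))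

lemma cprime_cideal: "cprime P \<Longrightarrow> cideal P"
  and cprime_one: "cprime P \<Longrightarrow> 1 \<notin> P"
  and cprime_mult: "cprime P \<Longrightarrow> a * b \<in> P \<Longrightarrow> a \<in> P \<or> b \<in> P"
  by (auto simp: cprime_def)

lemma cprime_power: "cprime P \<Longrightarrow> a ^ k \<in> P \<Longrightarrow> a \<in> P"
  by (induction k) (auto dest: cprime_one cprime_mult)

lemma cideal_UNIV: "cideal I \<Longrightarrow> 1 \<in> I \<Longrightarrow> I = UNIV"
  using cideal_mult[of I 1] by auto

lemma cideal_add_principal:
  assumes "cideal I"
  shows "cideal {a + r * b |a r. a \<in> I}"
  unfolding cideal_def
proof (intro conjI ballI allI)
  show "0 \<in> {a + r * b |a r. a \<in> I}"
    using cideal_zero[OF assms] by (auto intro!: exI[of _ 0])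
next
  fix u v assume "u \<in> {a + r * b |a r. a \<in> I}" "v \<in> {a + r * b |a r. a \<in> I}"
  then obtain a r a' r' where "u = a + r * b" "v = a' + r' * b" "a \<in> I" "a' \<in> I" by auto
  then have "u + v = (a + a') + (r + r') * b" "a + a' \<in> I"
    by (auto simp: algebra_simps cideal_add assms)
  then show "u + v \<in> {a + r * b |a r. a \<in> I}" by blast
next
  fix u s assume "u \<in> {a + r * b |a r. a \<in> I}"
  then obtain a r where "u = a + r * b" "a \<in> I" by auto
  then have "s * u = s * a + (s * r) * b" "s * a \<in> I"
    using cideal_mult[OF assms, of a s] by (auto simp: algebra_simps)
  then show "s * u \<in> {a + r * b |a r. a \<in> I}" by blast
qed

lemma cmaximal_comaximal:
  assumes "cmaximal M" "b \<notin> M"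
  obtains a r where "a \<in> M" "1 = a + r * b"
proof -
  let ?J = "{a + r * b |a r. a \<in> M}"
  have M: "cideal M" using assms by (simp add: cmaximal_def)
  have "M \<subseteq> ?J"
  proof
    fix x assume "x \<in> M"
    then have "x = x + 0 * b" by simp
    with \<open>x \<in> M\<close> show "x \<in> ?J" by blast
  qed
  moreover have "b = 0 + 1 * b" by simp
  then have "b \<in> ?J" using cideal_zero[OF M] by blast
  ultimately have "M \<subset> ?J" using assms(2) by blast
  then have "1 \<in> ?J"
    using assms(1) cideal_add_principal[OF M, of b] unfolding cmaximal_def by blast
  then show ?thesis using that by auto
qed

lemma cmaximal_cprime: "cmaximal M \<Longrightarrow> cprime M"
  unfolding cprime_def
proof (intro conjI allI impI)
  assume M: "cmaximal M"
  then show I: "cideal M" and "1 \<notin> M" by (auto simp: cmaximal_def)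
  fix a b assume "a * b \<in> M"
  show "a \<in> M \<or> b \<in> M"
  proof (rule disjCI)
    assume "b \<notin> M"
    then obtain c r where "c \<in> M" "1 = c + r * b" using cmaximal_comaximal[OF M] by metis
    then have "a = a * (c + r * b)" by simp
    then have "a = a * c + r * (a * b)" by (simp add: algebra_simps)
    moreover have "a * c + r * (a * b) \<in> M"
      using cideal_mult[OF I \<open>a * b \<in> M\<close>] cideal_mult[OF I \<open>c \<in> M\<close>]
          by (intro cideal_add I)
    ultimately show "a \<in> M" by simp
  qed
qed

lemma exists_cmaximal:
  assumes "cideal I" "1 \<notin> I"
  obtains M where "cmaximal M" "I \<subseteq> M"
proof -
  let ?S = "{J. cideal J \<and> 1 \<notin> J \<and> I \<subseteq> J}"
  have "\<exists>M\<in>?S. \<forall>X\<in>?S. M \<subseteq> X \<longrightarrow> X = M"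
  proof (rule subset_Zorn_nonempty)
    show "?S \<noteq> {}" using assms by auto
  next
    fix C assume C: "C \<noteq> {}" "subset.chain ?S C"
    then have sub: "C \<subseteq> ?S" and chain:
        "\<And>X Y. X \<in> C \<Longrightarrow> Y \<in> C \<Longrightarrow> X \<subseteq> Y \<or> Y \<subseteq> X"
      by (auto simp: subset_chain_def)
    have "cideal (\<Union>C)"
      unfolding cideal_def
    proof (intro conjI ballI allI)
      show "0 \<in> \<Union>C" using C(1) sub cideal_zero by blast
    next
      fix a b assume "a \<in> \<Union>C" "b \<in> \<Union>C"
      then obtain X where "X \<in> C" "a \<in> X" "b \<in> X" using chain by blast
      then show "a + b \<in> \<Union>C" using sub cideal_add by blast
    next
      fix a r assume "a \<in> \<Union>C"
      then show "r * a \<in> \<Union>C" using sub cideal_mult by blast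
    qed
    then show "\<Union>C \<in> ?S" using C(1) sub by blast
  qed
  then obtain M where M: "M \<in> ?S" "\<forall>X\<in>?S. M \<subseteq> X \<longrightarrow> X = M" by (elim bexE)
  have "cmaximal M"
    unfolding cmaximal_def
  proof (intro conjI allI impI)
    fix J assume J: "cideal J \<and> M \<subset> J"
    show "1 \<in> J"
    proof (rule ccontr)
      assume "1 \<notin> J"
      then have "J \<in> ?S" using J M(1) by auto
      then show False using M(2) J by blast
    qed
  qed (use M in auto)
  then show ?thesis using that M by blast
qed

lemma cprime_zero: "cprime {0::'a::idom}"
  by (auto simp: cprime_def cideal_def)

section \<open>Primes of $K[s]$\<close>

lemma cideal_poly_principal:
  fixes I :: "'k::field poly set"
  assumes "cideal I"
  obtains g where "I = {f. g dvd f}"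
proof (cases "I = {0}")
  case True
  then show ?thesis using that[of 0] by auto
next
  case False
  then obtain f0 where f0: "f0 \<in> I" "f0 \<noteq> 0" using cideal_zero[OF assms] by blast
  define g where "g = arg_min Polynomial.degree (\<lambda>f. f \<in> I \<and> f \<noteq> 0)"
  have g: "g \<in> I" "g \<noteq> 0" and min:
      "\<And>f. f \<in> I \<Longrightarrow> f \<noteq> 0
          \<Longrightarrow> Polynomial.degree g \<le> Polynomial.degree f"
    using arg_min_nat_lemma[of "\<lambda>f. f \<in> I \<and> f \<noteq> 0" f0 Polynomial.degree] f0
        by (auto simp: g_def)
  have "I = {f. g dvd f}"
  proof safe
    fix f assume "f \<in> I"
    then have "f mod g \<in> I"
      using g assms by (simp add: minus_div_mult_eq_mod[symmetric] cideal_diff cideal_mult)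
    then have "f mod g = 0"
      using min[of "f mod g"] degree_mod_less[OF g(2), of f] by (cases "f mod g = 0") auto
    then show "g dvd f" by (simp add: mod_eq_0_iff_dvd)
  next
    fix f assume "g dvd f"
    then show "f \<in> I" using g assms by (auto elim!: dvdE simp: cideal_mult2)
  qed
  then show ?thesis using that by blast
qed

text \<open>The generator \<open>d\<close> of the ideal spanned by \<open>e\<close> and
  \<open>b\<close> divides the generator \<open>g\<close> of \<open>e\<close>. As \<open>d\<close>
  is not in \<open>e\<close>, primeness puts the cofactor \<open>d'\<close> there, so
  \<open>g\<close> divides \<open>d'\<close> and \<open>d\<close> is a unit.\<close>

lemma cprime_poly_comaximal:
  fixes e :: "'k::field poly set"
  assumes "cprime e" "e \<noteq> {0}" "b \<notin> e"
  obtains u v where "u \<in> e" "1 = u + v * b"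
proof -
  have I: "cideal e" using assms by (simp add: cprime_cideal)
  obtain g where g: "e = {f. g dvd f}" using cideal_poly_principal[OF I] .
  then have "g \<noteq> 0" using assms by auto
  obtain d where d: "{a + r * b |a r. a \<in> e} = {f. d dvd f}"
    using cideal_poly_principal[OF cideal_add_principal[OF I, of b]] .
  have "g \<in> {a + r * b |a r. a \<in> e}"
    using g by (intro CollectI exI[of _ g] exI[of _ 0]) auto
  then have "d dvd g" using d by auto
  then obtain d' where d': "g = d * d'" by auto
  have "b \<in> {a + r * b |a r. a \<in> e}"
    using cideal_zero[OF I] by (intro CollectI exI[of _ 0] exI[of _ 1]) auto
  then have "d dvd b" using d by auto
  have "d * d' \<in> e" using d' g by auto
  then have "d \<in> e \<or> d' \<in> e" using cprime_mult[OF assms(1)] by blast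
  moreover have "d \<notin> e" using \<open>d dvd b\<close> assms(3) g by (auto dest: dvd_trans)
  ultimately have "g dvd d'" using g by auto
  then have "d * d' dvd 1 * d'" using d' by simp
  then have "d dvd 1" using d' \<open>g \<noteq> 0\<close> by (simp only: dvd_mult_cancel_right) auto
  then have "1 \<in> {a + r * b |a r. a \<in> e}" using d by auto
  then show ?thesis using that by auto
qed

lemma cprime_poly_inclusion:
  fixes e :: "'k::field poly set"
  assumes "cprime e" "e \<noteq> {0}" "e \<subseteq> e'" "cprime e'"
  shows "e = e'"
proof (rule ccontr)
  assume "e \<noteq> e'"
  then obtain b where "b \<in> e'" "b \<notin> e" using assms by auto
  with cprime_poly_comaximal[OF assms(1,2)] obtain u v where "u \<in> e" "1 = u + v * b" by metis
  then have "1 \<in> e'" using assms \<open>b \<in> e'\<close> by (metis cideal_add cideal_mult cprime_cideal subsetD)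
  then show False using assms by (simp add: cprime_one)
qed

section \<open>Primes of a polynomial ring over a domain\<close>

definition poly_ext :: "'a::comm_ring_1 set \<Rightarrow> 'a poly set" where
  "poly_ext e = {f. \<forall>i. coeff f i \<in> e}"

definition poly_contr :: "'a::comm_ring_1 poly set \<Rightarrow> 'a set" where
  "poly_contr p = {a. [:a:] \<in> p}"

lemma cideal_poly_ext: "cideal e \<Longrightarrow> cideal (poly_ext e)"
  unfolding cideal_def[of "poly_ext e"]
  by (auto simp: poly_ext_def coeff_mult intro!: cideal_sum cideal_zero cideal_add cideal_mult)

text \<open>Modulo \<open>e\<close> the lowest surviving coefficients of \<open>f\<close> and
  \<open>g\<close> multiply to the lowest coefficient of the product: every other term at index
  \<open>i + j\<close> has a factor of smaller index, hence in \<open>e\<close>.\<close>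

lemma cprime_poly_ext:
  assumes "cprime e"
  shows "cprime (poly_ext e)"
  unfolding cprime_def
proof (intro conjI allI impI)
  note I = cprime_cideal[OF assms]
  show "cideal (poly_ext e)" using I by (rule cideal_poly_ext)
  show "1 \<notin> poly_ext e" using cprime_one[OF assms] unfolding poly_ext_def by (auto intro: exI[of _ 0])
  fix f g assume fg: "f * g \<in> poly_ext e"
  show "f \<in> poly_ext e \<or> g \<in> poly_ext e"
  proof (rule ccontr)
    assume "\<not> (f \<in> poly_ext e \<or> g \<in> poly_ext e)"
    then have ex: "\<exists>i. coeff f i \<notin> e" "\<exists>j. coeff g j \<notin> e" by (auto simp: poly_ext_def)
    define i where "i = (LEAST i. coeff f i \<notin> e)"
    define j where "j = (LEAST j. coeff g j \<notin> e)"
    have i: "coeff f i \<notin> e" "\<And>k. k < i \<Longrightarrow> coeff f k \<in> e"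
      using LeastI_ex[OF ex(1)] not_less_Least unfolding i_def by blast+
    have j: "coeff g j \<notin> e" "\<And>k. k < j \<Longrightarrow> coeff g k \<in> e"
      using LeastI_ex[OF ex(2)] not_less_Least unfolding j_def by blast+
    have "coeff (f * g) (i + j)
        = coeff f i * coeff g j + (\<Sum>k\<in>{..i+j} - {i}. coeff f k * coeff g (i + j - k))"
      unfolding coeff_mult by (subst sum.remove[of _ i]) auto
    moreover have "(\<Sum>k\<in>{..i+j} - {i}. coeff f k * coeff g (i + j - k)) \<in> e"
    proof (rule cideal_sum[OF I])
      fix k assume k: "k \<in> {..i+j} - {i}"
      show "coeff f k * coeff g (i + j - k) \<in> e"
      proof (cases "k < i")
        case True then show ?thesis using i(2) I cideal_mult2 by blast
      next
        case False then have "i + j - k < j" using k by auto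
        then show ?thesis using j(2) I cideal_mult by blast
      qed
    qed
    moreover have "coeff (f * g) (i + j) \<in> e" using fg by (simp add: poly_ext_def)
    ultimately have "coeff f i * coeff g j \<in> e"
        using cideal_diff[OF I] by (metis (no_types, lifting) add_diff_cancel_right')
    then show False using i j cprime_mult[OF assms] by blast
  qed
qed

lemma cprime_poly_contr:
  assumes "cprime p" shows "cprime (poly_contr p)"
proof -
  have "[:a * b:] = [:a:] * [:b:]" "[:a + b:] = [:a:] + [:b:]" for a b :: 'a by simp_all
  then show ?thesis using assms
    unfolding cprime_def cideal_def poly_contr_def
    by (auto simp only: mem_Collect_eq Ball_def pCons_0_0 one_pCons)
qed

lemma poly_ext_subset:
  assumes "cideal p"
  shows "poly_ext (poly_contr p) \<subseteq> p"
proof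
  fix f assume f: "f \<in> poly_ext (poly_contr p)"
  have "monom (coeff f i) i \<in> p" for i
  proof -
    have "monom (coeff f i) i = monom 1 i * [:coeff f i:]" by (simp add: smult_monom)
    then show ?thesis using f assms by (simp add: poly_ext_def poly_contr_def cideal_mult del: mult_pCons_right)
  qed
  then have "(\<Sum>i\<le>Polynomial.degree f. monom (coeff f i) i) \<in> p" by (intro cideal_sum[OF assms])
  then show "f \<in> p" by (simp add: poly_as_sum_of_monoms)
qed

text \<open>Leading terms with coefficient in \<open>e\<close> are stripped until one survives. This
  replaces passing to polynomials over the quotient by \<open>e\<close>, so that pseudo-division
  stays in the original ring.\<close>

lemma poly_truncate_mod_ideal:
  fixes f :: "'a::comm_ring_1 poly"
  assumes "cideal e"
  shows "f \<in> poly_ext e \<or> (\<exists>f'. lead_coeff f' \<notin> e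
      \<and> Polynomial.degree f' \<le> Polynomial.degree f \<and> f - f' \<in> poly_ext e)"
proof (induction "Polynomial.degree f" arbitrary: f rule: less_induct)
  case less
  note E = cideal_poly_ext[OF assms]
  show ?case
  proof (cases "lead_coeff f \<in> e")
    case False
    then show ?thesis using cideal_zero[OF E] by (intro disjI2 exI[of _ f]) auto
  next
    case True
    let ?m = "monom (lead_coeff f) (Polynomial.degree f)"
    have m: "?m \<in> poly_ext e" using True cideal_zero[OF assms] by (auto simp: poly_ext_def)
    show ?thesis
    proof (cases "Polynomial.degree f")
      \<comment> \<open>Removing the leading monomial lowers the degree only if the degree is
        positive, so constants are treated apart.\<close>
      case 0
      then have "f = ?m" by (metis degree_0_id monom_0 )
      then show ?thesis using m by simp
    next
      case (Suc d)
      have "Polynomial.degree (f - ?m) < Polynomial.degree f"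
      proof (rule degree_lessI)
        show "f - ?m \<noteq> 0 \<or> Polynomial.degree f > 0" using Suc by simp
        show "\<forall>k\<ge>Polynomial.degree f. coeff (f - ?m) k = 0"
          by (auto simp: coeff_eq_0)
      qed
      from less[OF this] consider "f - ?m \<in> poly_ext e"
        | f' where "lead_coeff f' \<notin> e" "Polynomial.degree f' \<le> Polynomial.degree (f - ?m)"
            "(f - ?m) - f' \<in> poly_ext e" by blast
      then show ?thesis
      proof cases
        case 1 then show ?thesis using cideal_add[OF E 1 m] by simp
      next
        case 2
        then have "f - f' \<in> poly_ext e" using cideal_add[OF E 2(3) m] by (simp add: algebra_simps)
        then show ?thesis using 2 \<open>Polynomial.degree (f - ?m) < _\<close> by auto
      qed
    qed
  qed
qed

text \<open>
  If the smaller prime is not extended, pseudo-division between elements of least degree of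
  \<open>p\<close> and of \<open>q - p\<close>, taken with leading coefficients outside the contraction, leads to a contradiction.
\<close>
theorem no_chain_over_same_contraction:
  fixes p q :: "'a::idom poly set"
  assumes p: "cprime p" and q: "cprime q" and pq: "p \<subset> q" and eq: "poly_contr p = poly_contr q"
  shows "p = poly_ext (poly_contr p)"
proof (rule ccontr)
  define e where "e = poly_contr p"
  define E where "E = poly_ext e"
  note Ip = cprime_cideal[OF p] and Iq = cprime_cideal[OF q]
  have e: "cprime e" unfolding e_def by (rule cprime_poly_contr[OF p])
  note Ie = cprime_cideal[OF e]
  have Ep: "E \<subseteq> p" unfolding E_def e_def by (rule poly_ext_subset[OF Ip])
  assume "p \<noteq> poly_ext (poly_contr p)"
  then obtain f0 where f0: "f0 \<in> p" "f0 \<notin> E" using Ep by (auto simp: E_def e_def)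
  obtain f1 where "lead_coeff f1 \<notin> e" "f0 - f1 \<in> E"
    using poly_truncate_mod_ideal[OF Ie, of f0] f0 unfolding E_def by blast
  then have f1: "f1 \<in> p \<and> lead_coeff f1 \<notin> e"
    using cideal_diff[OF Ip f0(1), of "f0 - f1"] Ep by auto
  define f where "f = arg_min Polynomial.degree (\<lambda>f. f \<in> p \<and> lead_coeff f \<notin> e)"
  have f: "f \<in> p" "lead_coeff f \<notin> e"
    and fmin: "\<And>u. u \<in> p \<Longrightarrow> lead_coeff u \<notin> e
        \<Longrightarrow> Polynomial.degree f \<le> Polynomial.degree u"
    using arg_min_nat_lemma[of "\<lambda>f. f \<in> p \<and> lead_coeff f \<notin> e", OF f1, of Polynomial.degree]
    unfolding f_def by auto
  have fmin': "u \<in> E" if "u \<in> p" "Polynomial.degree u < Polynomial.degree f" for u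
  proof (rule ccontr)
    assume "u \<notin> E"
    then obtain u' where "lead_coeff u' \<notin> e" "Polynomial.degree u' \<le> Polynomial.degree u" "u - u' \<in> E"
      using poly_truncate_mod_ideal[OF Ie, of u] unfolding E_def by blast
    moreover then have "u' \<in> p" using cideal_diff[OF Ip that(1), of "u - u'"] Ep by auto
    ultimately show False using fmin[of u'] that by auto
  qed
  have trq: "\<exists>u'. u' \<in> q \<and> u' \<notin> p \<and> lead_coeff u' \<notin> e
      \<and> Polynomial.degree u' \<le> Polynomial.degree u"
    if "u \<in> q" "u \<notin> p" for u
  proof -
    have "u \<notin> E" using that Ep by auto
    then obtain u' where u': "lead_coeff u' \<notin> e" "Polynomial.degree u' \<le> Polynomial.degree u"
        "u - u' \<in> E"
      using poly_truncate_mod_ideal[OF Ie, of u] unfolding E_def by blast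
    have "u' \<in> q" using cideal_diff[OF Iq that(1), of "u - u'"] Ep pq u'(3) by auto
    moreover have "u' \<notin> p" using cideal_add[OF Ip, of "u - u'" u'] that(2) Ep u'(3) by auto
    ultimately show ?thesis using u' by blast
  qed
  obtain g1 where g1: "g1 \<in> q \<and> g1 \<notin> p \<and> lead_coeff g1 \<notin> e" using trq pq by blast
  define g where "g = arg_min Polynomial.degree (\<lambda>g. g \<in> q \<and> g \<notin> p
      \<and> lead_coeff g \<notin> e)"
  have g: "g \<in> q" "g \<notin> p" "lead_coeff g \<notin> e"
    and gmin: "\<And>u. u \<in> q \<Longrightarrow> u \<notin> p \<Longrightarrow> lead_coeff u \<notin> e
        \<Longrightarrow> Polynomial.degree g \<le> Polynomial.degree u"
    using arg_min_nat_lemma[of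
        "\<lambda>g. g \<in> q \<and> g \<notin> p \<and> lead_coeff g \<notin> e", OF g1, of Polynomial.degree]
    unfolding g_def by auto
  have gmin': "u \<in> p" if "u \<in> q" "Polynomial.degree u < Polynomial.degree g" for u
    using trq[OF that(1)] gmin that by (meson leD le_less_trans)
  \<comment> \<open>Undoes the scaling by powers of a leading coefficient that pseudo-division
    introduces.\<close>
  have sm: "u \<in> p" if "smult (a ^ k) u \<in> p" "a \<notin> e" for a k u
  proof -
    have "[:a ^ k:] * u \<in> p" using that by simp
    then have "a ^ k \<in> e \<or> u \<in> p" using cprime_mult[OF p] by (auto simp: e_def poly_contr_def)
    then show ?thesis using that cprime_power[OF e] by blast
  qed
  have nz: "f \<noteq> 0" "g \<noteq> 0" using f g cideal_zero[OF Ie] by auto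
  \<comment> \<open>A constant in \<open>q\<close> lies in the common contraction, hence already in
    \<open>p\<close>.\<close>
  have dg: "Polynomial.degree g > 0"
  proof (rule ccontr)
    assume "\<not> Polynomial.degree g > 0"
    then obtain b where "g = [:b:]" by (metis degree_eq_zeroE neq0_conv)
    then show False using g eq unfolding poly_contr_def by blast
  qed
  show False
  proof (cases "Polynomial.degree f < Polynomial.degree g")
    \<comment> \<open>Dividing \<open>g\<close> by \<open>f\<close>, the remainder lies in
      \<open>q\<close> and has degree below that of \<open>g\<close>, hence lies in
      \<open>p\<close>; this drags \<open>g\<close> into \<open>p\<close>.\<close>
    case True
    obtain u r where ur: "pseudo_divmod g f = (u, r)" by (metis surj_pair)
    obtain k where k: "smult (lead_coeff f ^ k) g = f * u + r" using pseudo_divmod(1)[OF nz(1) ur] by blast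
    have r: "r = 0 \<or> Polynomial.degree r < Polynomial.degree f" using pseudo_divmod(2)[OF nz(1) ur] .
    have "smult (lead_coeff f ^ k) g \<in> q" using cideal_mult[OF Iq g(1), of "[:lead_coeff f ^ k:]"] by simp
    moreover have fu: "f * u \<in> p" using cideal_mult2[OF Ip f(1)] .
    ultimately have "r \<in> q" using k pq cideal_diff[OF Iq, of "smult (lead_coeff f ^ k) g" "f * u"] by auto
    then have "r \<in> p" using gmin' r True cideal_zero[OF Ip] by auto
    then have "smult (lead_coeff f ^ k) g \<in> p" using k fu cideal_add[OF Ip] by simp
    then show False using sm f g by blast
  next
    \<comment> \<open>Dividing \<open>f\<close> by \<open>g\<close>, the remainder lies in
      \<open>p\<close>, so \<open>u\<close> does too; its degree is below that of \<open>f\<close>,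
      which puts it in \<open>E\<close>. The coefficient of \<open>g * u\<close> at the degree of
      \<open>f\<close> is a power of one leading coefficient times the other, and now lies in
      \<open>e\<close>.\<close>
    case False
    obtain u r where ur: "pseudo_divmod f g = (u, r)" by (metis surj_pair)
    obtain k where k: "smult (lead_coeff g ^ k) f = g * u + r" using pseudo_divmod(1)[OF nz(2) ur] by blast
    have r: "r = 0 \<or> Polynomial.degree r < Polynomial.degree g" using pseudo_divmod(2)[OF nz(2) ur] .
    have *: "smult (lead_coeff g ^ k) f \<in> p" using cideal_mult[OF Ip f(1), of "[:lead_coeff g ^ k:]"] by simp
    moreover have "g * u \<in> q" using cideal_mult2[OF Iq g(1)] .
    ultimately have "r \<in> q" using k pq cideal_diff[OF Iq, of "smult (lead_coeff g ^ k) f" "g * u"] by auto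
    then have "r \<in> p" using gmin' r cideal_zero[OF Ip] by auto
    then have "g * u \<in> p" using k * cideal_diff[OF Ip *, of r] by simp
    then have "u \<in> p" using g cprime_mult[OF p] by blast
    have "u \<in> E"
    proof (cases "u = 0")
      case True then show ?thesis using cideal_zero[OF cideal_poly_ext[OF Ie]] by (simp add: E_def)
    next
      case nzu: False
      have "Polynomial.degree (g * u) \<le> max (Polynomial.degree f) (Polynomial.degree r)"
        using degree_diff_le_max[of "smult (lead_coeff g ^ k) f" r] degree_smult_le[of "lead_coeff g ^ k" f] k
            by (simp add: max_def split: if_splits)
      then have "Polynomial.degree (g * u) \<le> Polynomial.degree f" using r False dg by auto
      then have "Polynomial.degree u < Polynomial.degree f" using degree_mult_eq[OF nz(2) nzu] dg by simp
      then show ?thesis using fmin' \<open>u \<in> p\<close> by blast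
    qed
    then have "g * u \<in> E" unfolding E_def using cideal_mult cideal_poly_ext[OF Ie] by blast
    then have "coeff (g * u) (Polynomial.degree f) \<in> e" by (simp add: E_def poly_ext_def)
    moreover have "coeff r (Polynomial.degree f) = 0" using r False by (auto simp: coeff_eq_0)
    moreover have "lead_coeff g ^ k * lead_coeff f = coeff (g * u + r) (Polynomial.degree f)"
        using k by (metis coeff_smult)
    ultimately have "lead_coeff g ^ k * lead_coeff f \<in> e" by simp
    then show False using cprime_mult[OF e] cprime_power[OF e] f g by blast
  qed
qed

lemma poly_contr_mono: "p \<subseteq> q \<Longrightarrow> poly_contr p \<subseteq> poly_contr q"
  by (auto simp: poly_contr_def)

section \<open>Primes of $K[s][t]$\<close>

text \<open>Descent: each element of \<open>p\<close> is \<open>g\<close> times another element of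
  \<open>p\<close>, and each division lowers the degree of the leading coefficient.\<close>

lemma prime_in_poly_ext_eq_zero:
  fixes g :: "'k::field poly"
  assumes p: "cprime p" and g: "\<not> g dvd 1" "[:g:] \<notin> p" and sub:
      "\<And>f i. f \<in> p \<Longrightarrow> g dvd coeff f i"
  shows "p \<subseteq> {0}"
proof -
  have "f \<in> p \<Longrightarrow> f = 0" for f
  proof (induction "Polynomial.degree (lead_coeff f)" arbitrary: f rule: less_induct)
    case less
    have "[:g:] dvd f" using sub[OF less(2)] by (simp add: const_poly_dvd_iff)
    then obtain f' where f': "f = [:g:] * f'" by auto
    then have "f' \<in> p" using cprime_mult[OF p] less(2) g by blast
    show ?case
    proof (rule ccontr)
      assume "f \<noteq> 0"
      then have nz: "g \<noteq> 0" "f' \<noteq> 0" using f' by auto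
      have "lead_coeff f = g * lead_coeff f'" using f' by (simp add: lead_coeff_smult)
      then have "Polynomial.degree (lead_coeff f) = Polynomial.degree g + Polynomial.degree (lead_coeff f')"
        using nz by (simp add: degree_mult_eq)
      moreover have "Polynomial.degree g > 0" using g(1) nz is_unit_iff_degree by blast
      ultimately show False using less(1)[of f'] \<open>f' \<in> p\<close> nz by simp
    qed
  qed
  then show ?thesis by auto
qed

text \<open>The contractions live in a ring of dimension one, so neighbours coincide. If
  \<open>p2\<close> contracts to zero, both zero and \<open>p1\<close> are extended from zero.
  Otherwise \<open>p2\<close> and \<open>p3\<close> contract alike and \<open>p2\<close> is
  extended; then \<open>p1\<close> is either extended from the same prime or contracts to zero,
  where descent applies.\<close>

lemma no_long_chain_poly_poly:
  fixes p1 :: "'k::field poly poly set"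
  assumes p: "cprime p1" "cprime p2" "cprime p3" "p1 \<noteq> {0}" "p1 \<subset> p2" "p2 \<subset> p3"
  shows False
proof -
  have p0: "cprime {0::'k poly poly}" by (rule cprime_zero)
  have s0: "{0} \<subset> p1" using p cideal_zero[OF cprime_cideal[OF p(1)]] by auto
  define e where "e p = poly_contr p" for p :: "'k poly poly set"
  have e: "cprime (e p)" if "cprime p" for p unfolding e_def by (rule cprime_poly_contr[OF that])
  have e0: "e {0} = {0}" by (auto simp: e_def poly_contr_def)
  have sub: "e p1 \<subseteq> e p2" "e p2 \<subseteq> e p3" "e {0} \<subseteq> e p1"
    unfolding e_def by (rule poly_contr_mono; use p s0 in blast)+
  have A: "p = poly_ext (e p)" if "cprime p" "cprime q" "p \<subset> q" "e p = e q" for p q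
    using no_chain_over_same_contraction[of p q] that unfolding e_def by blast
  show False
  proof (cases "e p2 = {0}")
    case True
    then have "e p1 = {0}" using sub e0 by auto
    then have "{0} = poly_ext {0::'k poly}" "p1 = poly_ext {0::'k poly}"
      using A[OF p0 p(1) s0] A[OF p(1,2,5)] True e0 by auto
    then show False using p by auto
  next
    case False
    have e23: "e p2 = e p3" using cprime_poly_inclusion[OF e[OF p(2)] False sub(2) e[OF p(3)]] .
    have p2: "p2 = poly_ext (e p2)" using A[OF p(2,3,6) e23] .
    show False
    proof (cases "e p1 = {0}")
      case False
      have e12: "e p1 = e p2" using cprime_poly_inclusion[OF e[OF p(1)] False sub(1) e[OF p(2)]] .
      then have "p1 = poly_ext (e p1)" using A[OF p(1,2,5)] by blast
      then show False using p2 e12 p by auto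
    next
      case True
      obtain g where g: "e p2 = {f. g dvd f}" using cideal_poly_principal[OF cprime_cideal[OF e[OF p(2)]]] .
      have "g \<noteq> 0" using g False by auto
      have "\<not> g dvd 1" using g cprime_one[OF e[OF p(2)]] by auto
      moreover have "[:g:] \<notin> p1" using True \<open>g \<noteq> 0\<close> by (auto simp: e_def poly_contr_def)
      moreover have "g dvd coeff f i" if "f \<in> p1" for f i
        using that p(5) p2 g by (auto simp: poly_ext_def)
      ultimately have "p1 \<subseteq> {0}" using prime_in_poly_ext_eq_zero[OF p(1)] by blast
      then show False using s0 by auto
    qed
  qed
qed

section \<open>Primes of $K[s][t^{\pm 1}]$\<close>

lemma poly_mapping_sum_single:
  "f = (\<Sum>k\<in>Poly_Mapping.keys f. Poly_Mapping.single k (Poly_Mapping.lookup f k))"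
  by (rule poly_mapping_eqI) (auto simp: lookup_sum lookup_single when_def in_keys_iff sum.delta)

lemma poly_mapping_single_induct [case_names zero single add]:
  fixes f :: "'a \<Rightarrow>\<^sub>0 'b::comm_monoid_add"
  assumes "P 0" "\<And>k a. P (Poly_Mapping.single k a)"
      "\<And>f g. P f \<Longrightarrow> P g \<Longrightarrow> P (f + g)"
  shows "P f"
proof -
  have "P (\<Sum>k\<in>A. Poly_Mapping.single k (Poly_Mapping.lookup f k))" if "finite A" for A
    using that by (induction A) (auto intro: assms)
  then show ?thesis using poly_mapping_sum_single[of f] finite_keys by metis
qed

lemma lookup_single_mult:
  fixes p :: "int \<Rightarrow>\<^sub>0 'a::comm_ring_1"
  shows "Poly_Mapping.lookup (Poly_Mapping.single k a * p) j = a * Poly_Mapping.lookup p (j - k)"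
proof (induction p rule: poly_mapping_single_induct)
  case (single l b)
  then show ?case by (auto simp: mult_single lookup_single when_def)
qed (auto simp: lookup_add algebra_simps)

definition laurent :: "'a::comm_ring_1 poly \<Rightarrow> (int \<Rightarrow>\<^sub>0 'a)" where
  "laurent f = (\<Sum>i\<le>Polynomial.degree f. Poly_Mapping.single (int i) (coeff f i))"

lemma lookup_laurent: "Poly_Mapping.lookup (laurent f) j = (if 0 \<le> j then coeff f (nat j) else 0)"
proof -
  have "Poly_Mapping.lookup (laurent f) j = (\<Sum>i\<le>Polynomial.degree f. if i = nat j
      \<and> 0 \<le> j then coeff f i else 0)"
    unfolding laurent_def lookup_sum by (intro sum.cong) (auto simp: lookup_single when_def)
  also have "\<dots> = (if 0 \<le> j then coeff f (nat j) else 0)"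
    by (auto simp: sum.delta coeff_eq_0)
  finally show ?thesis .
qed

lemma laurent_add: "laurent (f + g) = laurent f + laurent g"
  by (rule poly_mapping_eqI) (simp add: lookup_laurent lookup_add)

lemma laurent_const: "laurent [:a:] = Poly_Mapping.single 0 a"
  by (simp add: laurent_def)

lemma laurent_monom: "laurent (monom a n) = Poly_Mapping.single (int n) a"
  by (rule poly_mapping_eqI) (auto simp: lookup_laurent lookup_single when_def)

lemma laurent_0 [simp]: "laurent 0 = 0"
  by (simp add: laurent_def)

lemma laurent_1 [simp]: "laurent 1 = 1"
  by (simp add: laurent_def)

lemma laurent_pCons: "laurent (pCons a f) = Poly_Mapping.single 0 a + Poly_Mapping.single 1 1 * laurent f"
  by (rule poly_mapping_eqI)
     (auto simp: lookup_laurent lookup_add lookup_single_mult lookup_single when_def coeff_pCons nat_diff_distrib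
       split: nat.splits)

lemma laurent_smult: "laurent (smult a f) = Poly_Mapping.single 0 a * laurent f"
  by (rule poly_mapping_eqI) (auto simp: lookup_laurent lookup_single_mult)

lemma laurent_mult: "laurent (f * g) = laurent f * laurent g"
proof (induction f)
  case (pCons a f)
  have "laurent (pCons a f * g) = laurent (smult a g + pCons 0 (f * g))" by simp
  also have "\<dots> = laurent (pCons a f) * laurent g"
    by (simp add: laurent_add laurent_smult laurent_pCons pCons algebra_simps del: mult_pCons_left)
  finally show ?case .
qed simp

lemma laurent_uminus: "laurent (- f) = - laurent f"
  by (rule poly_mapping_eqI) (simp add: lookup_laurent)

lemma laurent_diff: "laurent (f - g) = laurent f - laurent g"
  using laurent_add[of f "- g"] by (simp add: laurent_uminus)

lemma laurent_eq_0_iff [simp]: "laurent f = 0 \<longleftrightarrow> f = 0"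
proof
  assume "laurent f = 0"
  then have "coeff f i = 0" for i using lookup_laurent[of f "int i"] by simp
  then show "f = 0" by (simp add: poly_eq_iff)
qed simp

text \<open>Claimed for all large exponents, so that one power of the variable can clear several
  elements at once.\<close>

lemma clear_denominators:
  fixes f :: "int \<Rightarrow>\<^sub>0 'a::comm_ring_1"
  shows "\<exists>N. \<forall>M\<ge>N. \<exists>g. Poly_Mapping.single (int M) 1 * f = laurent g"
proof (induction f rule: poly_mapping_single_induct)
  case zero
  then show ?case by (intro exI[of _ 0] allI impI exI[of _ "0 :: 'a poly"]) simp
next
  case (single k a)
  have "Poly_Mapping.single (int M) 1 * Poly_Mapping.single k a = laurent (monom a (nat (int M + k)))"
    if "M \<ge> nat (- k)" for M
    using that by (simp add: mult_single laurent_monom nat_le_iff)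
  then show ?case by blast
next
  case (add f g)
  then obtain N1 N2 where N:
      "\<And>M. M \<ge> N1 \<Longrightarrow> \<exists>h. Poly_Mapping.single (int M) 1 * f = laurent h"
    "\<And>M. M \<ge> N2 \<Longrightarrow> \<exists>h. Poly_Mapping.single (int M) 1 * g = laurent h" by blast
  show ?case
  proof (intro exI[of _ "max N1 N2"] allI impI)
    fix M assume "M \<ge> max N1 N2"
    then obtain h1 h2 where "Poly_Mapping.single (int M) 1 * f = laurent h1"
        "Poly_Mapping.single (int M) 1 * g = laurent h2"
      using N[of M] by auto
    then show "\<exists>h. Poly_Mapping.single (int M) 1 * (f + g) = laurent h"
      by (intro exI[of _ "h1 + h2"]) (simp add: laurent_add algebra_simps)
  qed
qed

lemma mem_cideal_single_mult:
  fixes I :: "(int \<Rightarrow>\<^sub>0 'a::comm_ring_1) set"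
  assumes "cideal I"
  shows "Poly_Mapping.single k 1 * f \<in> I \<longleftrightarrow> f \<in> I"
proof
  assume "Poly_Mapping.single k 1 * f \<in> I"
  then have "Poly_Mapping.single (-k) 1 * (Poly_Mapping.single k 1 * f) \<in> I"
      using assms by (simp add: cideal_mult)
  then show "f \<in> I" by (simp add: mult.assoc[symmetric] mult_single)
qed (use assms cideal_mult in blast)

lemma cideal_vimage_laurent: "cideal I \<Longrightarrow> cideal (laurent -` I)"
  by (simp add: cideal_def laurent_add laurent_mult)

lemma cprime_vimage_laurent: "cprime P \<Longrightarrow> cprime (laurent -` P)"
  unfolding cprime_def using cideal_vimage_laurent by (auto simp: laurent_mult)

text \<open>Up to a unit every element is an ordinary polynomial, so an ideal is determined by its
  polynomials and strict chains of primes do not collapse on contraction.\<close>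

lemma vimage_laurent_subset_imp:
  assumes I: "cideal I" and J: "cideal J" and sub: "laurent -` I \<subseteq> laurent -` J"
  shows "I \<subseteq> J"
proof
  fix f assume "f \<in> I"
  obtain N g where g: "Poly_Mapping.single (int N) 1 * f = laurent g" using clear_denominators[of f] by blast
  have "laurent g \<in> I" using \<open>f \<in> I\<close> mem_cideal_single_mult[OF I] g by metis
  then have "laurent g \<in> J" using sub by auto
  then show "f \<in> J" using mem_cideal_single_mult[OF J] g by metis
qed

lemma vimage_laurent_psubset:
  assumes "cideal I" "cideal J" "I \<subset> J"
  shows "laurent -` I \<subset> laurent -` J"
  using vimage_laurent_subset_imp[OF assms(2,1)] assms(3) by blast

lemma vimage_laurent_zero: "laurent -` {0} = {0}"
  by auto

section \<open>Ideals of the Laurent ring extended from the coefficients\<close>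

definition laurent_ext :: "'a::comm_ring_1 set \<Rightarrow> (int \<Rightarrow>\<^sub>0 'a) set" where
  "laurent_ext e = {f. \<forall>j. Poly_Mapping.lookup f j \<in> e}"

lemma cideal_laurent_ext:
  assumes "cideal e" shows "cideal (laurent_ext e)"
  unfolding cideal_def
proof (intro conjI ballI allI)
  show "0 \<in> laurent_ext e" using assms by (simp add: laurent_ext_def cideal_zero)
next
  fix f g assume "f \<in> laurent_ext e" "g \<in> laurent_ext e"
  then show "f + g \<in> laurent_ext e" using assms by (simp add: laurent_ext_def cideal_add lookup_add)
next
  fix f r assume f: "f \<in> laurent_ext e"
  show "r * f \<in> laurent_ext e"
  proof (induction r rule: poly_mapping_single_induct)
    case zero then show ?case using assms by (simp add: laurent_ext_def cideal_zero)
  next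
    case (single k a) then show ?case using assms f by (simp add: laurent_ext_def lookup_single_mult cideal_mult)
  next
    case (add g h) then show ?case using assms by (simp add: distrib_right laurent_ext_def lookup_add cideal_add)
  qed
qed

lemma vimage_laurent_ext:
  assumes "cideal e" shows "laurent -` laurent_ext e = poly_ext e"
proof -
  have "(\<forall>j. (if 0 \<le> j then coeff f (nat j) else 0) \<in> e)
      \<longleftrightarrow> (\<forall>i. coeff f i \<in> e)" for f :: "'a poly"
    using cideal_zero[OF assms] by (metis nat_int of_nat_0_le_iff)
  then show ?thesis unfolding laurent_ext_def poly_ext_def lookup_laurent[abs_def] vimage_def
      by (auto simp: lookup_laurent)
qed

lemma cprime_laurent_ext:
  assumes "cprime e" shows "cprime (laurent_ext e)"
  unfolding cprime_def
proof (intro conjI allI impI)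
  show I: "cideal (laurent_ext e)" using assms by (simp add: cprime_cideal cideal_laurent_ext)
  show "1 \<notin> laurent_ext e" using cprime_one[OF assms] by (auto simp: laurent_ext_def intro!: exI[of _ 0])
  fix f g assume fg: "f * g \<in> laurent_ext e"
  obtain N f' where f': "Poly_Mapping.single (int N) 1 * f = laurent f'" using clear_denominators[of f] by blast
  obtain M g' where g': "Poly_Mapping.single (int M) 1 * g = laurent g'" using clear_denominators[of g] by blast
  have "laurent (f' * g') = Poly_Mapping.single (int N) 1 * (Poly_Mapping.single (int M) 1 * (f * g))"
    by (simp add: laurent_mult f'[symmetric] g'[symmetric] algebra_simps)
  also have "\<dots> \<in> laurent_ext e" using fg by (simp add: mem_cideal_single_mult[OF I])
  finally have "f' * g' \<in> poly_ext e" using vimage_laurent_ext[OF cprime_cideal[OF assms]] by blast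
  then have "f' \<in> poly_ext e \<or> g' \<in> poly_ext e" using cprime_mult[OF cprime_poly_ext[OF assms]] by blast
  then have "laurent f' \<in> laurent_ext e \<or> laurent g' \<in> laurent_ext e"
    using vimage_laurent_ext[OF cprime_cideal[OF assms]] by blast
  then show "f \<in> laurent_ext e \<or> g \<in> laurent_ext e"
    by (simp add: f'[symmetric] g'[symmetric] mem_cideal_single_mult[OF I])
qed

lemma laurent_ext_zero: "laurent_ext {0} = {0}"
proof safe
  fix f :: "int \<Rightarrow>\<^sub>0 'a" assume "f \<in> laurent_ext {0}"
  then show "f = 0" by (intro poly_mapping_eqI) (simp add: laurent_ext_def)
qed (simp add: laurent_ext_def)

lemma no_long_chain_laurent:
  fixes p1 :: "(int \<Rightarrow>\<^sub>0 'k::field poly) set"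
  assumes p: "cprime p1" "cprime p2" "cprime p3" "p1 \<noteq> {0}" "p1 \<subset> p2" "p2 \<subset> p3"
  shows False
proof (rule no_long_chain_poly_poly)
  note I = p(1-3)[THEN cprime_cideal]
  show "cprime (laurent -` p1)" "cprime (laurent -` p2)" "cprime (laurent -` p3)"
    using p by (auto intro: cprime_vimage_laurent)
  show "laurent -` p1 \<subset> laurent -` p2" "laurent -` p2 \<subset> laurent -` p3"
    by (intro vimage_laurent_psubset I p(5,6))+
  have "{0} \<subset> p1" using p(4) cideal_zero[OF I(1)] by auto
  then have "laurent -` {0} \<subset> laurent -` p1"
    by (intro vimage_laurent_psubset I(1) cprime_cideal[OF cprime_zero])
  then show "laurent -` p1 \<noteq> {0}" by (auto simp: vimage_laurent_zero)
qed

section \<open>Minimal and maximal primes of K[s][t, t^-1]\<close>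

lemma cmaximal_of_chain:
  fixes p1 :: "(int \<Rightarrow>\<^sub>0 'k::field poly) set"
  assumes p: "cprime p1" "cprime p2" "p1 \<noteq> {0}" "p1 \<subset> p2"
  shows "cmaximal p2"
proof -
  obtain M where M: "cmaximal M" "p2 \<subseteq> M"
    using exists_cmaximal cprime_cideal[OF p(2)] cprime_one[OF p(2)] by blast
  then have "p2 = M" using no_long_chain_laurent[OF p(1,2) cmaximal_cprime[OF M(1)] p(3,4)] by blast
  then show ?thesis using M by simp
qed

text \<open>If \<open>g\<close> were not in \<open>p\<close>, every element of \<open>p\<close>
  could be divided by \<open>g\<close> again and again inside \<open>p\<close>. Applied with
  \<open>g\<close> = s, this takes the place of the principal ideal theorem.\<close>

lemma principal_prime_minimal:
  fixes g :: "'k::field poly"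
  assumes "cprime p" "p \<noteq> {0}" "\<not> g dvd 1" "p \<subseteq> laurent_ext {f. g dvd f}"
  shows "Poly_Mapping.single 0 g \<in> p"
proof (rule ccontr)
  assume "Poly_Mapping.single 0 g \<notin> p"
  then have "[:g:] \<notin> laurent -` p" by (simp add: laurent_const)
  moreover have "g dvd coeff f i" if "f \<in> laurent -` p" for f i
  proof -
    have "g dvd Poly_Mapping.lookup (laurent f) (int i)" using that assms(4) by (auto simp: laurent_ext_def)
    then show ?thesis by (simp add: lookup_laurent)
  qed
  ultimately have "laurent -` p \<subseteq> {0}"
    using prime_in_poly_ext_eq_zero[OF cprime_vimage_laurent[OF assms(1)] assms(3)] by blast
  then have "laurent -` p \<subseteq> laurent -` {0}" by (simp add: vimage_laurent_zero)
  then have "p \<subseteq> {0}"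
    by (rule vimage_laurent_subset_imp[OF cprime_cideal[OF assms(1)] cprime_cideal[OF cprime_zero]])
  then show False using assms(2) cideal_zero[OF cprime_cideal[OF assms(1)]] by auto
qed

text \<open>The element t - 1 is neither in the extended ideal nor invertible modulo it: evaluating
  a relation of comaximality at t = 1 would put 1 into \<open>e\<close>.\<close>

lemma laurent_ext_not_cmaximal:
  fixes e :: "'a::comm_ring_1 set"
  assumes "cprime e" shows "\<not> cmaximal (laurent_ext e)"
proof
  assume max: "cmaximal (laurent_ext e)"
  note Ie = cprime_cideal[OF assms] and I = cideal_laurent_ext[OF cprime_cideal[OF assms]]
  have "[:-1, 1:] \<notin> poly_ext e" using cprime_one[OF assms] by (auto simp: poly_ext_def intro!: exI[of _ 1])
  then have "laurent [:-1, 1:] \<notin> laurent_ext e" using vimage_laurent_ext[OF Ie] by blast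
  then obtain a r where a: "a \<in> laurent_ext e" "1 = a + r * laurent [:-1, 1:]"
    using cmaximal_comaximal[OF max] by metis
  obtain N where N: "\<And>M. M \<ge> N \<Longrightarrow> \<exists>g. Poly_Mapping.single (int M) 1 * a = laurent g"
    using clear_denominators[of a] by blast
  obtain N' where N': "\<And>M. M \<ge> N' \<Longrightarrow> \<exists>g. Poly_Mapping.single (int M) 1 * r
      = laurent g"
    using clear_denominators[of r] by blast
  let ?M = "max N N'"
  obtain a' where a': "Poly_Mapping.single (int ?M) 1 * a = laurent a'" using N[of ?M] by auto
  obtain r' where r': "Poly_Mapping.single (int ?M) 1 * r = laurent r'" using N'[of ?M] by auto
  have "laurent (monom 1 ?M) = Poly_Mapping.single (int ?M) 1 * (a + r * laurent [:-1, 1:])"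
    using a(2) by (simp add: laurent_monom)
  also have "\<dots> = laurent a' + laurent r' * laurent [:-1, 1:]"
    by (simp only: distrib_left a' mult.assoc[symmetric] r')
  finally have "laurent (monom 1 ?M - (a' + r' * [:-1, 1:])) = 0"
    by (simp only: laurent_diff laurent_add laurent_mult) simp
  then have "monom 1 ?M = a' + r' * [:-1, 1:]" by (simp only: laurent_eq_0_iff) simp
  \<comment> \<open>The power of t that cleared the denominators becomes 1 under this
    evaluation.\<close>
  then have "poly (monom 1 ?M) 1 = poly (a' + r' * [:-1, 1:]) 1" by simp
  then have "poly a' 1 = 1" by (simp add: poly_monom)
  moreover have "a' \<in> poly_ext e"
    using a(1) a' mem_cideal_single_mult[OF I, of "int ?M" a] vimage_laurent_ext[OF Ie] by auto
  then have "poly a' 1 \<in> e" unfolding poly_altdef by (intro cideal_sum Ie) (auto simp: poly_ext_def)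
  ultimately show False using cprime_one[OF assms] by simp
qed

text \<open>
  If \<open>m\<close> meets $K[s]$ trivially, a polynomial \<open>f\<close> in \<open>m\<close> of minimal $t$-degree becomes a unit of
  $(K[s]/r)[t^{\pm 1}]$
      for every nonzero \<open>r\<close>; this is absurd when \<open>r\<close> is a nonunit coprime to both
  extreme coefficients of \<open>f\<close>.
\<close>
lemma cmaximal_contr_nonzero:
  fixes m :: "(int \<Rightarrow>\<^sub>0 'k::field poly) set"
  assumes max: "cmaximal m"
  shows "\<exists>b. b \<noteq> 0 \<and> Poly_Mapping.single 0 b \<in> m"
proof (rule ccontr)
  assume "\<not> ?thesis"
  then have contr: "Poly_Mapping.single 0 b \<in> m \<Longrightarrow> b = 0" for b by blast
  have I: "cideal m" using max by (simp add: cmaximal_def)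
  define p where "p = laurent -` m"
  have p: "cprime p" unfolding p_def by (rule cprime_vimage_laurent[OF cmaximal_cprime[OF max]])
  note Ip = cprime_cideal[OF p]
  have "m \<noteq> {0}"
      using laurent_ext_not_cmaximal[of "{0::'k poly}", OF cprime_zero] max by (auto simp: laurent_ext_zero)
  then have "{0} \<subset> m" using cideal_zero[OF I] by auto
  then have "laurent -` {0} \<subset> p"
    unfolding p_def by (intro vimage_laurent_psubset I cprime_cideal[OF cprime_zero])
  then obtain f0 where f0: "f0 \<in> p \<and> f0 \<noteq> 0" by (auto simp: vimage_laurent_zero)
  define f where "f = arg_min Polynomial.degree (\<lambda>f. f \<in> p \<and> f \<noteq> 0)"
  have f: "f \<in> p" "f \<noteq> 0" and min:
      "\<And>u. u \<in> p \<Longrightarrow> u \<noteq> 0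
          \<Longrightarrow> Polynomial.degree f \<le> Polynomial.degree u"
    using arg_min_nat_lemma[of "\<lambda>f. f \<in> p \<and> f \<noteq> 0", OF f0, of Polynomial.degree]
        by (auto simp: f_def)
  define d where "d = Polynomial.degree f"
  have "d > 0"
  proof (rule ccontr)
    assume "\<not> d > 0"
    then obtain b where b: "f = [:b:]" unfolding d_def by (metis degree_eq_zeroE neq0_conv)
    then have "Poly_Mapping.single 0 b \<in> m" using f by (simp add: p_def laurent_const)
    then show False using contr b f by auto
  qed
  define a where "a = lead_coeff f"
  define c where "c = coeff f 0"
  have "a \<noteq> 0" using f by (simp add: a_def)
  \<comment> \<open>Otherwise t divides \<open>f\<close>; it is a unit of the Laurent ring, so the
    quotient would be a member of smaller degree.\<close>
  have "c \<noteq> 0"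
  proof
    assume "c = 0"
    then obtain f' where f': "f = pCons 0 f'" unfolding c_def by (metis coeff_pCons_0 pCons_cases)
    then have "f = monom 1 1 * f'" by (simp add: monom_altdef)
    moreover have "monom 1 1 \<notin> p"
      using cprime_one[OF cmaximal_cprime[OF max]] mem_cideal_single_mult[OF I, of 1 1]
          by (simp add: p_def laurent_monom)
    ultimately have "f' \<in> p" using cprime_mult[OF p] f by blast
    then show False using min[of f'] f' f by auto
  qed
  \<comment> \<open>Congruent to 1 modulo \<open>a\<close> and modulo \<open>c\<close>, hence
    coprime to both; the factor s makes the degree positive, hence \<open>r\<close> a nonunit, over
    any field.\<close>
  define r where "r = 1 + a * c * [:0, 1:]"
  have "Polynomial.degree (a * c * [:0, 1:]) = Polynomial.degree (a * c) + 1"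
    using \<open>a \<noteq> 0\<close> \<open>c \<noteq> 0\<close> by (subst degree_mult_eq) auto
  then have "Polynomial.degree r > 0" unfolding r_def by (subst degree_add_eq_right) auto
  moreover from this have "r \<noteq> 0" by auto
  ultimately have r: "r \<noteq> 0" "\<not> r dvd 1" using is_unit_iff_degree[of r] by auto
  have cop_ac: "r dvd y" if "r dvd a * c * y" for y
  proof -
    have "y = r * y - [:0, 1:] * (a * c * y)" by (simp add: r_def algebra_simps)
    then show ?thesis using that by (metis dvd_diff dvd_mult dvd_triv_left)
  qed
  have cop: "r dvd y" if "r dvd a * y \<or> r dvd c * y" for y
  proof -
    have "a * c * y = c * (a * y)" "a * c * y = a * (c * y)" by (simp_all only: ac_simps)
    then show ?thesis using that cop_ac[of y] dvd_mult by metis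
  qed
  have cop_pow: "r dvd y" if "r dvd a ^ k * y" for y k
    using that
  proof (induction k)
    case (Suc k)
    have "a ^ Suc k * y = a * (a ^ k * y)" by (simp only: power_Suc mult.assoc)
    then have "r dvd a ^ k * y" using cop[of "a ^ k * y"] Suc.prems by metis
    then show ?case by (rule Suc.IH)
  qed simp
  have "Poly_Mapping.single 0 r \<notin> m" using contr r by blast
  then obtain u v where uv: "u \<in> m" "1 = u + v * Poly_Mapping.single 0 r"
    using cmaximal_comaximal[OF max] by metis
  obtain N v' where v': "Poly_Mapping.single (int N) 1 * v = laurent v'" using clear_denominators[of v] by blast
  have "laurent (monom 1 N - smult r v') = Poly_Mapping.single (int N) 1 * (1 - v * Poly_Mapping.single 0 r)"
    by (simp add: laurent_diff laurent_monom laurent_smult v'[symmetric] algebra_simps)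
  also have "1 - v * Poly_Mapping.single 0 r = u" using uv by (metis add_diff_cancel_right')
  finally have mem: "monom 1 N - smult r v' \<in> p" using uv by (simp add: p_def mem_cideal_single_mult[OF I])
  \<comment> \<open>Minimality of \<open>f\<close> forces the remainder to vanish. Modulo
    \<open>r\<close> the product \<open>f * w\<close> then is the single term a^k t^N.\<close>
  obtain w rem where w: "pseudo_divmod (monom 1 N - smult r v') f = (w, rem)" by (metis surj_pair)
  obtain k where k: "smult (a ^ k) (monom 1 N - smult r v') = f * w + rem"
    using pseudo_divmod(1)[OF f(2) w] unfolding a_def by blast
  have "smult (a ^ k) (monom 1 N - smult r v') \<in> p" using cideal_mult[OF Ip mem, of "[:a ^ k:]"] by simp
  then have "rem \<in> p" using k cideal_diff[OF Ip _ cideal_mult2[OF Ip f(1), of w]] by (metis add_diff_cancel_left')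
  then have "rem = 0" using pseudo_divmod(2)[OF f(2) w] min[of rem] by (cases "rem = 0") auto
  then have fw: "coeff (f * w) i = a ^ k * ((if i = N then 1 else 0) - r * coeff v' i)" for i
    using arg_cong[OF k, of "\<lambda>p. coeff p i"] \<open>rem = 0\<close> by (cases "i = N") auto
  have fwN: "r dvd coeff (f * w) i" if "i \<noteq> N" for i using that by (simp add: fw)
  define J where "J = {i. \<not> r dvd coeff w i}"
  have "finite J"
    by (rule finite_subset[of _ "{..Polynomial.degree w}"]) (auto simp: J_def intro: le_degree)
  have "J \<noteq> {}"
  proof
    assume "J = {}"
    then have "r dvd coeff (f * w) N" unfolding coeff_mult J_def by (intro dvd_sum dvd_mult) auto
    then have "r dvd a ^ k * (1 - r * coeff v' N)" by (simp add: fw)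
    then have "r dvd 1 - r * coeff v' N" by (rule cop_pow)
    then have "r dvd (1 - r * coeff v' N) + r * coeff v' N" by (rule dvd_add) simp
    then show False using r by simp
  qed
  \<comment> \<open>The degree and the order of \<open>w\<close> modulo \<open>r\<close>. The
    extreme terms of \<open>f * w\<close> modulo \<open>r\<close> sit at \<open>d + M\<close> and at
    \<open>l\<close>, as \<open>a\<close> and \<open>c\<close> are coprime to \<open>r\<close>; a
    single term leaves no room for \<open>d > 0\<close>.\<close>
  define M where "M = Max J"
  define l where "l = Min J"
  have M: "\<not> r dvd coeff w M" and "\<And>i. \<not> r dvd coeff w i \<Longrightarrow> i \<le> M"
    and l: "\<not> r dvd coeff w l" and "\<And>i. \<not> r dvd coeff w i \<Longrightarrow> l \<le> i"
    using Max_in[OF \<open>finite J\<close> \<open>J \<noteq> {}\<close>] Max_ge[OF \<open>finite J\<close>]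
      Min_in[OF \<open>finite J\<close> \<open>J \<noteq> {}\<close>] Min_le[OF \<open>finite J\<close>]
    unfolding M_def[symmetric] l_def[symmetric] by (auto simp: J_def)
  then have M': "\<And>i. i > M \<Longrightarrow> r dvd coeff w i" and l':
      "\<And>i. i < l \<Longrightarrow> r dvd coeff w i" and "l \<le> M"
    by (meson not_less)+
  have "N = d + M"
  proof (rule ccontr)
    assume "N \<noteq> d + M"
    then have "r dvd coeff (f * w) (d + M)" using fwN by metis
    moreover have "coeff (f * w) (d + M)
        = a * coeff w M + (\<Sum>i\<in>{..d+M} - {d}. coeff f i * coeff w (d + M - i))"
      unfolding coeff_mult by (subst sum.remove[of _ d]) (auto simp: a_def d_def)
    moreover have "r dvd (\<Sum>i\<in>{..d+M} - {d}. coeff f i * coeff w (d + M - i))"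
    proof (rule dvd_sum)
      fix i assume "i \<in> {..d+M} - {d}"
      then consider "i > d" | "d + M - i > M" by force
      then show "r dvd coeff f i * coeff w (d + M - i)"
        by cases (auto simp: coeff_eq_0 d_def M')
    qed
    ultimately have "r dvd a * coeff w M" by (simp add: dvd_add_left_iff)
    then show False using cop M by blast
  qed
  moreover have "N = l"
  proof (rule ccontr)
    assume "N \<noteq> l"
    then have "r dvd coeff (f * w) l" using fwN by metis
    moreover have "coeff (f * w) l = c * coeff w l + (\<Sum>i\<in>{..l} - {0}. coeff f i * coeff w (l - i))"
      unfolding coeff_mult by (subst sum.remove[of _ 0]) (auto simp: c_def)
    moreover have "r dvd (\<Sum>i\<in>{..l} - {0}. coeff f i * coeff w (l - i))"
      by (intro dvd_sum dvd_mult l') auto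
    ultimately have "r dvd c * coeff w l" by (simp add: dvd_add_left_iff)
    then show False using cop l by blast
  qed
  ultimately show False using \<open>l \<le> M\<close> \<open>d > 0\<close> by simp
qed

text \<open>The witness is the extension of the contraction of \<open>m\<close>: nonzero because the
  contraction is, and smaller than \<open>m\<close> because extended primes are never
  maximal.\<close>

lemma cmaximal_not_minimal_prime:
  fixes m :: "(int \<Rightarrow>\<^sub>0 'k::field poly) set"
  assumes max: "cmaximal m"
  obtains p where "cprime p" "p \<noteq> {0}" "p \<subset> m"
proof -
  define e where "e = poly_contr (laurent -` m)"
  have e: "cprime e" unfolding e_def by (intro cprime_poly_contr cprime_vimage_laurent cmaximal_cprime max)
  have mem_e: "b \<in> e \<longleftrightarrow> Poly_Mapping.single 0 b \<in> m" for b
      by (simp add: e_def poly_contr_def laurent_const)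
  have I: "cideal m" using max by (simp add: cmaximal_def)
  have "laurent_ext e \<subseteq> m"
  proof
    fix f assume "f \<in> laurent_ext e"
    then have "Poly_Mapping.single k 1 * Poly_Mapping.single 0 (Poly_Mapping.lookup f k) \<in> m" for k
      by (simp add: laurent_ext_def mem_e mem_cideal_single_mult[OF I])
    then have "Poly_Mapping.single k (Poly_Mapping.lookup f k) \<in> m" for k
      by (simp add: mult_single)
    then have "(\<Sum>k\<in>Poly_Mapping.keys f. Poly_Mapping.single k (Poly_Mapping.lookup f k)) \<in> m"
      by (intro cideal_sum I)
    then show "f \<in> m" using poly_mapping_sum_single[of f] by simp
  qed
  moreover have "laurent_ext e \<noteq> m" using laurent_ext_not_cmaximal[OF e] max by auto
  moreover obtain b where "b \<noteq> 0" "Poly_Mapping.single 0 b \<in> m"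
      using cmaximal_contr_nonzero[OF max] by blast
  then have "Poly_Mapping.single 0 b \<in> laurent_ext e"
      "Poly_Mapping.single 0 b \<noteq> (0 :: int \<Rightarrow>\<^sub>0 'k poly)"
    using cideal_zero[OF cprime_cideal[OF e]]
    by (auto simp: laurent_ext_def mem_e lookup_single when_def dest: arg_cong[of _ _
        "\<lambda>f. Poly_Mapping.lookup f 0"])
  then have "laurent_ext e \<noteq> {0}" by auto
  ultimately show ?thesis using that[OF cprime_laurent_ext[OF e]] by blast
qed

section \<open>Prime and maximal ideals of noncommutative rings\<close>

lemma (in ring) ideal_iff:
  "ideal I R \<longleftrightarrow> I \<subseteq> carrier R \<and> \<zero> \<in> I
      \<and> (\<forall>a\<in>I. \<forall>b\<in>I. a \<oplus> b \<in> I) \<and>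
     (\<forall>a\<in>I. \<forall>x\<in>carrier R. x \<otimes> a \<in> I \<and> a \<otimes> x \<in> I)" (is "_ \<longleftrightarrow> ?rhs")
proof
  assume "ideal I R"
  then interpret ideal I R .
  show ?rhs using a_subset I_l_closed I_r_closed by (auto intro: a_closed zero_closed)
next
  assume r: ?rhs
  show "ideal I R"
  proof (rule idealI)
    show "ring R" by (rule ring_axioms)
    have "\<ominus> a \<in> I" if "a \<in> I" for a
    proof -
      have "(\<ominus> \<one>) \<otimes> a \<in> I" using r that by auto
      then show ?thesis using r that by (metis l_minus l_one one_closed subsetD)
    qed
    then show "subgroup I (add_monoid R)"
      using r by (auto intro!: add.subgroupI simp: a_inv_def[symmetric])
  qed (use r in auto)
qed

text \<open>For the forward direction the ideals tested are annihilators modulo \<open>P\<close>,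
  \<open>I\<close> of \<open>b\<close> and then \<open>J\<close> of \<open>I\<close>; they contain
  \<open>a\<close> and \<open>b\<close> and need no description of generated two-sided
  ideals.\<close>

lemma (in ring) Spec_iff:
  "P \<in> Spec R \<longleftrightarrow> ideal P R \<and> P \<noteq> carrier R \<and>
     (\<forall>a\<in>carrier R. \<forall>b\<in>carrier R. (\<forall>r\<in>carrier R. a \<otimes> r \<otimes> b \<in> P) \<longrightarrow> a \<in> P \<or> b \<in> P)" (is "_ \<longleftrightarrow> ?rhs")
proof
  assume P: "P \<in> Spec R"
  then have id: "ideal P R" and pr:
      "\<And>I J. ideal I R \<Longrightarrow> ideal J R \<Longrightarrow> ideal_prod R I J \<subseteq> P
          \<Longrightarrow> I \<subseteq> P \<or> J \<subseteq> P"
    by (auto simp: Spec_def)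
  note idP = id[unfolded ideal_iff]
  have "a \<in> P \<or> b \<in> P" if ab: "a \<in> carrier R" "b \<in> carrier R" and *:
      "\<forall>r\<in>carrier R. a \<otimes> r \<otimes> b \<in> P" for a b
  proof -
    define I where "I = {r \<in> carrier R. \<forall>c\<in>carrier R. r \<otimes> c \<otimes> b \<in> P}"
    define J where "J = {r \<in> carrier R. \<forall>i\<in>I. i \<otimes> r \<in> P}"
    have I: "ideal I R"
      unfolding ideal_iff
    proof (intro conjI ballI)
      fix x r assume x: "x \<in> I" and r: "r \<in> carrier R"
      have "r \<otimes> x \<otimes> c \<otimes> b = r \<otimes> (x \<otimes> c \<otimes> b)"
          "x \<otimes> r \<otimes> c \<otimes> b = x \<otimes> (r \<otimes> c) \<otimes> b" if
              "c \<in> carrier R" for c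
        using x r that ab by (auto simp: I_def m_assoc)
      then show "r \<otimes> x \<in> I" "x \<otimes> r \<in> I" using x r idP by (auto simp: I_def)
    qed (use idP ab in \<open>auto simp: I_def l_distr\<close>)
    have J: "ideal J R"
      unfolding ideal_iff
    proof (intro conjI ballI)
      fix x r assume x: "x \<in> J" and r: "r \<in> carrier R"
      have I': "I \<subseteq> carrier R" "\<And>i. i \<in> I \<Longrightarrow> i \<otimes> r \<in> I"
          using I r by (auto simp: ideal_iff)
      have "i \<otimes> (r \<otimes> x) = (i \<otimes> r) \<otimes> x"
          "i \<otimes> (x \<otimes> r) = (i \<otimes> x) \<otimes> r" if "i \<in> I" for i
        using x r that I' by (auto simp: J_def m_assoc)
      then show "r \<otimes> x \<in> J" "x \<otimes> r \<in> J" using x r idP I' by (auto simp: J_def)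
    qed (use idP I in \<open>auto simp: J_def ideal_iff r_distr I_def\<close>)
    have "ideal_prod R I J \<subseteq> P"
    proof
      fix z assume "z \<in> ideal_prod R I J"
      then show "z \<in> P" using idP by induction (auto simp: J_def)
    qed
    then have "I \<subseteq> P \<or> J \<subseteq> P" using pr I J by blast
    moreover have "a \<in> I" using ab * by (simp add: I_def)
    moreover have "i \<otimes> b \<in> P" if "i \<in> I" for i
    proof -
      have "i \<otimes> \<one> \<otimes> b \<in> P" "i \<in> carrier R"
          using that one_closed unfolding I_def by blast+
      then show ?thesis by simp
    qed
    then have "b \<in> J" using ab by (simp add: J_def)
    ultimately show ?thesis by blast
  qed
  then show ?rhs using P by (auto simp: Spec_def)
next
  assume r: ?rhs
  show "P \<in> Spec R"
    unfolding Spec_def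
  proof (intro CollectI conjI allI impI)
    fix I J assume *: "ideal I R \<and> ideal J R \<and> ideal_prod R I J \<subseteq> P"
    show "I \<subseteq> P \<or> J \<subseteq> P"
    proof (rule ccontr)
      assume "\<not> (I \<subseteq> P \<or> J \<subseteq> P)"
      then obtain a b where ab: "a \<in> I" "a \<notin> P" "b \<in> J" "b \<notin> P" by auto
      have "a \<otimes> c \<otimes> b \<in> P" if "c \<in> carrier R" for c
      proof -
        have "a \<otimes> c \<in> I" using * ab that by (auto simp: ideal_iff)
        then show ?thesis using * ab ideal_prod.prod by (metis subsetD)
      qed
      moreover have "a \<in> carrier R" "b \<in> carrier R" using ab * by (auto simp: ideal_iff)
      ultimately show False using r ab(2,4) by blast
    qed
  qed (use r in auto)
qed

lemma (in ring) ideal_one_closed: "ideal I R \<Longrightarrow> \<one> \<in> I \<Longrightarrow> I = carrier R"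
  by (rule ideal.one_imp_carrier)

text \<open>The annihilator \<open>N\<close> of \<open>b\<close> modulo \<open>M\<close> is an ideal
  above \<open>M\<close> that omits the unit, so it equals \<open>M\<close>; and \<open>a\<close>
  belongs to it.\<close>

lemma (in ring) maximalideal_in_Spec:
  assumes "maximalideal M R"
  shows "M \<in> Spec R"
proof -
  interpret maximalideal M R by (rule assms)
  note id = is_ideal[unfolded ideal_iff]
  have "a \<in> M \<or> b \<in> M" if ab: "a \<in> carrier R" "b \<in> carrier R" and *:
      "\<forall>r\<in>carrier R. a \<otimes> r \<otimes> b \<in> M" for a b
  proof (rule disjCI)
    assume "b \<notin> M"
    define N where "N = {r \<in> carrier R. \<forall>c\<in>carrier R. r \<otimes> c \<otimes> b \<in> M}"
    have N: "ideal N R"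
      unfolding ideal_iff
    proof (intro conjI ballI)
      fix x r assume x: "x \<in> N" and r: "r \<in> carrier R"
      have "r \<otimes> x \<otimes> c \<otimes> b = r \<otimes> (x \<otimes> c \<otimes> b)"
          "x \<otimes> r \<otimes> c \<otimes> b = x \<otimes> (r \<otimes> c) \<otimes> b" if
              "c \<in> carrier R" for c
        using x r that ab by (auto simp: N_def m_assoc)
      then show "r \<otimes> x \<in> N" "x \<otimes> r \<in> N" using x r id by (auto simp: N_def)
    qed (use id ab in \<open>auto simp: N_def l_distr\<close>)
    have "M \<subseteq> N" using id ab by (auto simp: N_def)
    moreover have "\<one> \<notin> N"
    proof
      assume "\<one> \<in> N"
      then have "\<one> \<otimes> \<one> \<otimes> b \<in> M" using one_closed unfolding N_def by blast
      then show False using \<open>b \<notin> M\<close> ab by simp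
    qed
    ultimately have "N = M" using I_maximal[OF N] N by (auto simp: ideal_iff)
    moreover have "a \<in> N" using ab * by (simp add: N_def)
    ultimately show "a \<in> M" by simp
  qed
  then show ?thesis using is_ideal I_notcarr by (auto simp: Spec_iff)
qed

text \<open>Every longer chain ends in one of length two, so only lengths one and two decide whether
  the supremum is 1.\<close>

lemma ht_eq_1_iff:
  assumes P: "P \<in> Spec R"
  shows "ht R P = 1 \<longleftrightarrow> (\<exists>P0\<in>Spec R. P0 \<subset> P)
      \<and> \<not> (\<exists>P0\<in>Spec R. \<exists>P1\<in>Spec R. P0 \<subset> P1 \<and> P1 \<subset> P)"
proof -
  define S where "S = {enat k | k. \<exists>C :: nat \<Rightarrow> 'a set.
     (\<forall>i\<le>k. C i \<in> Spec R) \<and> (\<forall>i<k. C i \<subset> C (Suc i)) \<and> C k = P}"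
  have ht: "ht R P = Sup S" by (simp add: ht_def S_def)
  have S1: "1 \<in> S" if "P0 \<in> Spec R" "P0 \<subset> P" for P0
    unfolding S_def one_enat_def
    by (intro CollectI exI[of _ 1] conjI exI[of _ "\<lambda>i::nat. if i = 0 then P0 else P"]) (use that P in auto)
  have S2: "2 \<in> S" if "P0 \<in> Spec R" "P1 \<in> Spec R" "P0 \<subset> P1" "P1 \<subset> P" for P0 P1
    unfolding S_def
    by (intro CollectI exI[of _ 2] conjI exI[of _ "\<lambda>i::nat. if i = 0 then P0 else if i = 1 then P1 else P"])
       (use that P in \<open>auto simp: numeral_eq_enat\<close>)
  have le0: "e \<le> 0" if "e \<in> S" "\<not> (\<exists>P0\<in>Spec R. P0 \<subset> P)" for e
  proof -
    obtain k C where k: "e = enat k" "\<forall>i\<le>k. C i \<in> Spec R"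
        "\<forall>i<k. C i \<subset> C (Suc i)" "C k = P"
      using \<open>e \<in> S\<close> unfolding S_def by blast
    have "k = 0"
    proof (cases k)
      case (Suc l)
      then have "C l \<in> Spec R" "C l \<subset> P" using k by auto
      then show ?thesis using that by blast
    qed
    then show ?thesis using k by (simp add: zero_enat_def)
  qed
  have le1: "e \<le> 1" if "e \<in> S"
      "\<not> (\<exists>P0\<in>Spec R. \<exists>P1\<in>Spec R. P0 \<subset> P1 \<and> P1 \<subset> P)" for e
  proof -
    obtain k C where k: "e = enat k" "\<forall>i\<le>k. C i \<in> Spec R"
        "\<forall>i<k. C i \<subset> C (Suc i)" "C k = P"
      using \<open>e \<in> S\<close> unfolding S_def by blast
    have "k \<le> 1"
    proof (rule ccontr)
      assume "\<not> k \<le> 1"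
      then obtain l where "k = Suc (Suc l)"
          by (metis One_nat_def Suc_le_mono le0 not0_implies_Suc old.nat.exhaust zero_le)
      then have "C l \<in> Spec R" "C (Suc l) \<in> Spec R" "C l \<subset> C (Suc l)" "C (Suc l) \<subset> P"
          using k by auto
      then show False using that by blast
    qed
    then show ?thesis using k by (simp add: one_enat_def)
  qed
  show ?thesis
  proof
    assume h: "ht R P = 1"
    have "\<exists>P0\<in>Spec R. P0 \<subset> P"
    proof (rule ccontr)
      assume "\<not> ?thesis"
      then have "Sup S \<le> 0" using le0 by (intro Sup_least) blast
      then show False using h ht by simp
    qed
    moreover have "\<not> (\<exists>P0\<in>Spec R. \<exists>P1\<in>Spec R. P0 \<subset> P1 \<and> P1 \<subset> P)"
    proof
      assume "\<exists>P0\<in>Spec R. \<exists>P1\<in>Spec R. P0 \<subset> P1 \<and> P1 \<subset> P"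
      then have "2 \<in> S" using S2 by blast
      then have "2 \<le> Sup S" by (rule Sup_upper)
      then have "(2::enat) \<le> 1" using h ht by simp
      then show False by (simp add: numeral_eq_enat one_enat_def)
    qed
    ultimately show "(\<exists>P0\<in>Spec R. P0 \<subset> P)
        \<and> \<not> (\<exists>P0\<in>Spec R. \<exists>P1\<in>Spec R. P0 \<subset> P1 \<and> P1 \<subset> P)" by blast
  next
    assume *: "(\<exists>P0\<in>Spec R. P0 \<subset> P)
        \<and> \<not> (\<exists>P0\<in>Spec R. \<exists>P1\<in>Spec R. P0 \<subset> P1 \<and> P1 \<subset> P)"
    have "Sup S \<le> 1" using le1 * by (intro Sup_least) blast
    moreover have "1 \<le> Sup S" using S1 * by (intro Sup_upper) blast
    ultimately show "ht R P = 1" using ht by simp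
  qed
qed

section \<open>Spectra and surjections from a commutative ring\<close>

text \<open>A surjection rather than an isomorphism, to cover both the embedding \<open>phi\<close>
  onto the centre and the projection \<open>const_part\<close> onto K[x, x^-1], whose kernel is
  \<open>h_set\<close>.\<close>

locale comm_image =
  fixes S :: "('b, 'm) ring_scheme" (structure) and \<phi> :: "'a::comm_ring_1 \<Rightarrow> 'b"
  assumes range: "range \<phi> = carrier S"
    and add: "\<phi> (a + b) = \<phi> a \<oplus> \<phi> b"
    and mult: "\<phi> (a * b) = \<phi> a \<otimes> \<phi> b"
    and one: "\<phi> 1 = \<one>"
    and zero: "\<phi> 0 = \<zero>"
begin

lemma carrierE:
  assumes "x \<in> carrier S" obtains a where "x = \<phi> a"
  using assms range by blast

lemma closed [simp]: "\<phi> a \<in> carrier S"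
  using range by blast

sublocale ring S
proof (rule ringI)
  note hom = add[symmetric] mult[symmetric] one[symmetric] zero[symmetric]
  show "abelian_group S"
  proof (rule abelian_groupI)
    fix x assume "x \<in> carrier S"
    then obtain a where "x = \<phi> a" by (rule carrierE)
    then have "\<phi> (- a) \<oplus> x = \<zero>" by (simp add: hom)
    then show "\<exists>y\<in>carrier S. y \<oplus> x = \<zero>" using closed by blast
  qed (auto elim!: carrierE simp: hom ac_simps)
  show "monoid S"
    by (rule monoidI) (auto elim!: carrierE simp: hom mult.assoc)
qed (auto elim!: carrierE simp: add[symmetric] mult[symmetric] distrib_left distrib_right)

lemma ball_carrier: "(\<forall>x\<in>carrier S. Q x) \<longleftrightarrow> (\<forall>a. Q (\<phi> a))"
  unfolding range[symmetric] by auto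

lemma ideal_iff_vimage:
  assumes "Q \<subseteq> carrier S" shows "ideal Q S \<longleftrightarrow> cideal (\<phi> -` Q)"
proof -
  have ballQ: "(\<forall>x\<in>Q. P x) \<longleftrightarrow> (\<forall>a. \<phi> a \<in> Q
      \<longrightarrow> P (\<phi> a))" for P
  proof -
    have "Q = \<phi> ` (\<phi> -` Q)" using assms unfolding range[symmetric] by blast
    then have "(\<forall>x\<in>Q. P x) \<longleftrightarrow> (\<forall>x\<in>\<phi> ` (\<phi> -` Q). P x)" by simp
    also have "\<dots> \<longleftrightarrow> (\<forall>a. \<phi> a \<in> Q \<longrightarrow> P (\<phi> a))" by blast
    finally show ?thesis .
  qed
  have comm: "\<phi> a \<otimes> \<phi> b = \<phi> (a * b)" "\<phi> b \<otimes> \<phi> a = \<phi> (a * b)" for a b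
    by (simp_all add: mult[symmetric] mult.commute)
  show ?thesis
    unfolding ideal_iff cideal_def ballQ ball_carrier using assms
    by (auto simp: zero add comm mult.commute)
qed

lemma Spec_iff_vimage:
  assumes Q: "Q \<subseteq> carrier S" shows "Q \<in> Spec S \<longleftrightarrow> cprime (\<phi> -` Q)"
proof (cases "ideal Q S")
  case True
  then have "cideal (\<phi> -` Q)" using ideal_iff_vimage[OF Q] by simp
  then have "(\<forall>r. \<phi> a \<otimes> \<phi> r \<otimes> \<phi> b \<in> Q) \<longleftrightarrow> a * b
      \<in> \<phi> -` Q" for a b
  proof -
    assume I: "cideal (\<phi> -` Q)"
    have "\<phi> a \<otimes> \<phi> r \<otimes> \<phi> b \<in> Q \<longleftrightarrow> r * (a * b)
        \<in> \<phi> -` Q" for r by (simp add: mult[symmetric] ac_simps)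
    then show ?thesis using cideal_mult[OF I, of "a * b"] by (metis mult_1)
  qed
  moreover have "Q \<noteq> carrier S \<longleftrightarrow> 1 \<notin> \<phi> -` Q"
    using ideal_one_closed[OF True] one closed[of 1] by auto
  ultimately show ?thesis
    using True ideal_iff_vimage[OF Q] unfolding Spec_iff ball_carrier cprime_def by auto
next
  case False
  then show ?thesis using ideal_iff_vimage[OF Q] unfolding Spec_iff cprime_def by auto
qed

lemma vimage_psubset_iff:
    "P \<subseteq> carrier S \<Longrightarrow> Q \<subseteq> carrier S
        \<Longrightarrow> \<phi> -` P \<subset> \<phi> -` Q \<longleftrightarrow> P \<subset> Q"
  unfolding range[symmetric] by blast

lemma image_vimage: "Q \<subseteq> carrier S \<Longrightarrow> \<phi> ` (\<phi> -` Q) = Q"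
  unfolding range[symmetric] by blast

lemma Max_Spec_iff_vimage:
  assumes Q: "Q \<subseteq> carrier S" shows "Q \<in> Max_Spec S \<longleftrightarrow> cmaximal (\<phi> -` Q)"
proof
  assume "Q \<in> Max_Spec S"
  then interpret m: maximalideal Q S by (simp add: Max_Spec_def)
  have idQ: "cideal (\<phi> -` Q)" using m.is_ideal ideal_iff_vimage[OF Q] by simp
  have "1 \<notin> \<phi> -` Q" using ideal_one_closed[OF m.is_ideal] m.I_notcarr one by auto
  moreover have "1 \<in> J" if J: "cideal J" "\<phi> -` Q \<subset> J" for J
  proof -
    \<comment> \<open>\<open>J\<close> contains the kernel, since the preimage of \<open>Q\<close>
      does; hence it is a union of fibres.\<close>
    have z: "x \<in> J" if "\<phi> x = \<phi> y" "y \<in> J" for x y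
    proof -
      have "\<phi> (x - y) \<oplus> \<phi> y = \<phi> y" using that by (simp add: add[symmetric])
      then have "\<phi> (x - y) = \<zero>" using add.r_cancel_one[of "\<phi> y" "\<phi> (x - y)"] by simp
      moreover have "\<zero> \<in> Q" using cideal_zero[OF idQ] zero by simp
      ultimately have "x - y \<in> \<phi> -` Q" by simp
      then show ?thesis using J that cideal_add[OF J(1), of "x - y" y] by auto
    qed
    then have vi: "\<phi> -` (\<phi> ` J) = J" by auto
    then have "ideal (\<phi> ` J) S" using J by (subst ideal_iff_vimage) auto
    moreover have "Q \<subseteq> \<phi> ` J" using J image_vimage[OF Q] by blast
    ultimately have "\<phi> ` J = Q \<or> \<phi> ` J = carrier S" by (intro m.I_maximal) auto
    then have "\<phi> ` J = carrier S" using J vi by auto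
    then show ?thesis using vi by (metis closed vimageI2)
  qed
  ultimately show "cmaximal (\<phi> -` Q)" using idQ by (simp add: cmaximal_def)
next
  assume max: "cmaximal (\<phi> -` Q)"
  show "Q \<in> Max_Spec S"
    unfolding Max_Spec_def
  proof (intro CollectI maximalidealI)
    show "ideal Q S" using max ideal_iff_vimage[OF Q] by (simp add: cmaximal_def)
    show "carrier S \<noteq> Q" using max by (auto simp: cmaximal_def)
    fix J assume J: "ideal J S" "Q \<subseteq> J" "J \<subseteq> carrier S"
    show "J = Q \<or> J = carrier S"
    proof (rule disjCI)
      assume "J \<noteq> carrier S"
      then have "1 \<notin> \<phi> -` J" using ideal_one_closed[OF J(1)] one by auto
      then have "\<not> \<phi> -` Q \<subset> \<phi> -` J"
          using max J ideal_iff_vimage[OF J(3)] by (auto simp: cmaximal_def)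
      then show "J = Q" using vimage_psubset_iff[OF Q J(3)] J(2) by blast
    qed
  qed
qed

lemma ht_eq_1_iff_vimage:
  assumes inj: "inj \<phi>" and dom: "cprime {0::'a}" and P: "P \<in> Spec S"
  shows "ht S P = 1 \<longleftrightarrow> \<phi> -` P \<noteq> {0} \<and> \<not> (\<exists>p. cprime p
      \<and> p \<noteq> {0} \<and> p \<subset> \<phi> -` P)"
proof -
  have sub: "Q \<subseteq> carrier S" if "Q \<in> Spec S" for Q using that by (auto simp: Spec_iff ideal_iff)
  have vi: "\<phi> -` (\<phi> ` p) = p" for p using inj by (simp add: inj_vimage_image_eq)
  have Spec_image: "\<phi> ` p \<in> Spec S \<longleftrightarrow> cprime p" for p
    using Spec_iff_vimage[of "\<phi> ` p"] vi[of p] by (simp add: image_subset_iff)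
  have ex: "(\<exists>Q\<in>Spec S. R Q) \<longleftrightarrow> (\<exists>p. cprime p \<and> R (\<phi> ` p))" for R
    using Spec_image Spec_iff_vimage image_vimage sub by metis
  have ps: "\<phi> ` p \<subset> \<phi> ` p' \<longleftrightarrow> p \<subset> p'" for p p'
      using inj by (metis inj_image_subset_iff less_le_not_le)
  obtain p where p: "P = \<phi> ` p" "cprime p" using P sub image_vimage Spec_iff_vimage by metis
  have z: "0 \<in> p'" if "cprime p'" for p' :: "'a set" using that by (simp add: cideal_zero cprime_cideal)
  have one: "(\<exists>p'. cprime p' \<and> p' \<subset> p) \<longleftrightarrow> p \<noteq> {0}"
  proof
    show "p \<noteq> {0}" if "\<exists>p'. cprime p' \<and> p' \<subset> p" using that z by blast
    show "\<exists>p'. cprime p' \<and> p' \<subset> p" if "p \<noteq> {0}" using that dom z[OF p(2)] by blast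
  qed
  have two: "(\<exists>p0. cprime p0 \<and> (\<exists>p1. cprime p1 \<and> p0 \<subset> p1
      \<and> p1 \<subset> p)) \<longleftrightarrow>
      (\<exists>p'. cprime p' \<and> p' \<noteq> {0} \<and> p' \<subset> p)" (is "?l = ?r")
  proof
    show ?r if ?l using that z by blast
    show ?l if ?r
    proof -
      obtain p' where p': "cprime p'" "p' \<noteq> {0}" "p' \<subset> p" using \<open>?r\<close> by blast
      then have "{0} \<subset> p'" using z by auto
      then show ?thesis using dom p' by blast
    qed
  qed
  show ?thesis
    unfolding ht_eq_1_iff[OF P] unfolding ex unfolding p(1) ps vi one two ..
qed

end

section \<open>Coefficients in $K[h][x^{\pm 1};\sigma]$\<close>

definition cf :: "(int \<Rightarrow>\<^sub>0 'k::field poly) \<Rightarrow> int \<Rightarrow> nat \<Rightarrow> 'k" where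
  "cf f j a = coeff (Poly_Mapping.lookup f j) a"

text \<open>Read as c h^a x^j in the skew algebra and as c s^a t^j in the commutative ring. In
  particular \<open>mon 1 1 0\<close> is h or s, depending on the ring in which it is used.\<close>

definition mon :: "'k::field \<Rightarrow> nat \<Rightarrow> int \<Rightarrow> (int \<Rightarrow>\<^sub>0 'k poly)" where
  "mon c a j = Poly_Mapping.single j (monom c a)"

lemma cf_eqI: "(\<And>j a. cf f j a = cf g j a) \<Longrightarrow> f = g"
  unfolding cf_def by (intro poly_mapping_eqI poly_eqI)

lemma cf_0 [simp]: "cf 0 j a = 0"
  and cf_add [simp]: "cf (f + g) j a = cf f j a + cf g j a"
  and cf_diff [simp]: "cf (f - g) j a = cf f j a - cf g j a"
  by (simp_all add: cf_def lookup_add lookup_minus)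

lemma cf_mon: "cf (mon c a j) i b = (if i = j \<and> b = a then c else 0)"
  by (auto simp: cf_def mon_def lookup_single when_def)

lemma mon_0 [simp]: "mon 0 a j = 0"
  by (simp add: mon_def)

lemma one_eq_mon: "1 = mon 1 0 0"
  by (simp add: mon_def monom_0 flip: one_pCons)

lemma gen_y_eq_mon: "gen_y = mon 1 1 0" and gen_z_eq_mon: "gen_z = mon 1 0 1"
  and scalar_eq_mon: "scalar c = mon c 0 0"
  by (simp_all add: gen_y_def gen_z_def scalar_def mon_def monom_altdef flip: one_pCons)

lemma mon_mult: "mon c a i * mon d b j = mon (c * d) (a + b) (i + j)"
  by (simp add: mon_def mult_single mult_monom)

lemma mon_power: "mon 1 a i ^ k = mon 1 (k * a) (int k * i)"
  by (induction k) (simp_all add: one_eq_mon mon_mult algebra_simps)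

lemma mon_induct [case_names zero mon add]:
  assumes "P 0" "\<And>c a j. P (mon c a j)" "\<And>f g. P f \<Longrightarrow> P g \<Longrightarrow> P (f + g)"
  shows "P f"
proof (induction f rule: poly_mapping_single_induct)
  case (single j p)
  have "P (Poly_Mapping.single j (\<Sum>i\<in>A. monom (coeff p i) i))" if "finite A" for A
    using that by (induction A) (auto simp: single_add assms mon_def[symmetric])
  from this[of "{..Polynomial.degree p}"] show ?case by (simp add: poly_as_sum_of_monoms)
qed (use assms in auto)

section \<open>Multiplication of $K[h][x^{\pm 1};\sigma]$\<close>

lemma sigma_funpow: "(sigma q ^^ m) p = pcompose p [:0, q ^ m:]"
  by (induction m) (auto simp: poly_eq_iff sigma_def coeff_pcompose_linear power_mult_distrib power_commutes)

lemma int_iterate_sigma: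
  assumes "q \<noteq> 0" shows "int_iterate (sigma q) i p = pcompose p [:0, q powi i:]"
proof (cases "0 \<le> i")
  case True then show ?thesis by (simp add: int_iterate_def sigma_funpow power_int_def)
next
  case False
  have "inv_into UNIV (sigma q) = sigma (inverse q)"
    using assms by (intro inv_unique_comp ext)
      (auto simp: poly_eq_iff sigma_def coeff_pcompose_linear simp flip: power_mult_distrib mult.assoc)
  then show ?thesis using False by (simp add: int_iterate_def sigma_funpow power_int_def)
qed

lemma sigma_1: "sigma 1 = id"
  by (auto simp: sigma_def)

text \<open>General enough to include q = 1, where the algebra is the commutative
  \<open>laurent_alg\<close>.\<close>

locale skew_alg =
  fixes q :: "'k::field"
  assumes q_nonzero: "q \<noteq> 0"
begin

definition mul :: "(int \<Rightarrow>\<^sub>0 'k poly) \<Rightarrow> (int \<Rightarrow>\<^sub>0 'k poly) \<Rightarrow> (int \<Rightarrow>\<^sub>0 'k poly)" (infixl \<open>\<star>\<close> 70) where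
  "f \<star> g = skew_mult (sigma q) f g"

text \<open>Larger index sets allow \<open>f\<close>, \<open>g\<close> and \<open>f + g\<close> to
  be expanded over a common set, although their supports differ; biadditivity becomes
  termwise.\<close>

lemma mul_eq_sum:
  assumes "finite A" "finite B" "Poly_Mapping.keys f \<subseteq> A" "Poly_Mapping.keys g \<subseteq> B"
  shows "f \<star> g = (\<Sum>i\<in>A. \<Sum>j\<in>B. Poly_Mapping.single (i + j)
    (Poly_Mapping.lookup f i * pcompose (Poly_Mapping.lookup g j) [:0, q powi i:]))"
  unfolding mul_def skew_mult_def int_iterate_sigma[OF q_nonzero]
  using assms by (intro sum.mono_neutral_cong_left ballI refl sum.mono_neutral_left)
     (auto simp: in_keys_iff intro!: sum.neutral)

lemma mul_add_left: "(f + g) \<star> h = f \<star> h + g \<star> h"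
proof -
  let ?A = "Poly_Mapping.keys f \<union> Poly_Mapping.keys g" and ?B = "Poly_Mapping.keys h"
  have "Poly_Mapping.keys (f + g) \<subseteq> ?A" by (rule keys_add)
  then show ?thesis
    by (simp add: mul_eq_sum[of ?A ?B] lookup_add distrib_right single_add sum.distrib)
qed

lemma mul_add_right: "h \<star> (f + g) = h \<star> f + h \<star> g"
proof -
  let ?A = "Poly_Mapping.keys f \<union> Poly_Mapping.keys g" and ?B = "Poly_Mapping.keys h"
  have "Poly_Mapping.keys (f + g) \<subseteq> ?A" by (rule keys_add)
  then show ?thesis
    by (simp add: mul_eq_sum[of ?B ?A] lookup_add distrib_left single_add sum.distrib pcompose_add)
qed

lemma mul_0_left [simp]: "0 \<star> f = 0" and mul_0_right [simp]: "f \<star> 0 = 0"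
  by (simp_all add: mul_def skew_mult_def)

lemma mul_mon: "mon c a i \<star> mon d b j = mon (c * d * (q powi i) ^ b) (a + b) (i + j)"
proof -
  have "monom c a * pcompose (monom d b) [:0, r:] = monom (c * d * r ^ b) (a + b)" for r
  proof -
    have "pcompose (monom d b) [:0, r:] = monom (r ^ b * d) b"
      by (auto simp: poly_eq_iff coeff_pcompose_linear)
    then show ?thesis by (simp add: mult_monom ac_simps)
  qed
  then show ?thesis
    by (subst mul_eq_sum[of "{i}" "{j}"]) (auto simp: mon_def)
qed

lemma mul_sum_left: "sum f A \<star> g = (\<Sum>x\<in>A. f x \<star> g)"
  by (induction A rule: infinite_finite_induct) (auto simp: mul_add_left)

lemma mul_sum_right: "g \<star> sum f A = (\<Sum>x\<in>A. g \<star> f x)"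
  by (induction A rule: infinite_finite_induct) (auto simp: mul_add_right)

lemma mul_assoc: "f \<star> g \<star> h = f \<star> (g \<star> h)"
proof (induction f rule: mon_induct)
  case (mon c a i)
  show ?case
  proof (induction g rule: mon_induct)
    case (mon d b j)
    show ?case
    proof (induction h rule: mon_induct)
      case (mon e k l)
      show ?case
        using q_nonzero by (simp add: mul_mon power_int_add power_add power_mult_distrib ac_simps)
    qed (simp_all add: mul_add_right)
  qed (simp_all add: mul_add_left mul_add_right)
qed (simp_all add: mul_add_left)

lemma mul_1_left [simp]: "1 \<star> f = f"
  by (induction f rule: mon_induct) (simp_all add: one_eq_mon mul_mon mul_add_right)

lemma mul_1_right [simp]: "f \<star> 1 = f"
  by (induction f rule: mon_induct) (simp_all add: one_eq_mon mul_mon mul_add_left)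

lemma scalar_mul: "mon c 0 0 \<star> f = mon c 0 0 * f"
  by (induction f rule: mon_induct) (simp_all add: mul_mon mon_mult mul_add_right distrib_left)

lemma mul_scalar: "f \<star> mon c 0 0 = mon c 0 0 * f"
  by (induction f rule: mon_induct) (simp_all add: mul_mon mon_mult mul_add_left distrib_left distrib_right mult.commute)

lemma Alg_simps [simp]: "carrier (Alg q) = UNIV" "f \<otimes>\<^bsub>Alg q\<^esub> g = f \<star> g"
    "f \<oplus>\<^bsub>Alg q\<^esub> g = f + g"
   "\<zero>\<^bsub>Alg q\<^esub> = 0" "\<one>\<^bsub>Alg q\<^esub> = 1"
  by (simp_all add: Alg_def skew_laurent_def mul_def one_eq_mon mon_def monom_0 one_pCons)

sublocale ring "Alg q"
proof (rule ringI)
  show "abelian_group (Alg q)"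
  proof (rule abelian_groupI)
    fix f show "\<exists>g\<in>carrier (Alg q). g \<oplus>\<^bsub>Alg q\<^esub> f = \<zero>\<^bsub>Alg q\<^esub>"
      by (intro bexI[of _ "- f"]) auto
  qed (auto simp: algebra_simps)
  show "monoid (Alg q)" by (rule monoidI) (auto simp: mul_assoc)
qed (auto simp: mul_add_left mul_add_right)

lemma ideal_Alg_iff: "ideal I (Alg q) \<longleftrightarrow> 0 \<in> I
    \<and> (\<forall>f\<in>I. \<forall>g\<in>I. f + g \<in> I) \<and> (\<forall>f\<in>I. \<forall>g. g \<star> f \<in> I \<and> f \<star> g \<in> I)"
  by (simp add: ideal_iff)

lemma Spec_Alg_iff: "P \<in> Spec (Alg q) \<longleftrightarrow> ideal P (Alg q) \<and> 1 \<notin> P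
    \<and> (\<forall>f g. (\<forall>r. f \<star> r \<star> g \<in> P) \<longrightarrow> f \<in> P \<or> g \<in> P)"
proof -
  have "P = UNIV \<longleftrightarrow> 1 \<in> P" if "ideal P (Alg q)"
    using ideal_one_closed[OF that] by auto
  then show ?thesis by (auto simp: Spec_iff)
qed

lemma mon_pow_h: "mon 1 a 0 [^]\<^bsub>Alg q\<^esub> (k::nat) = mon 1 (k * a) 0"
  by (induction k) (simp_all add: one_eq_mon mul_mon algebra_simps)

lemma mon_pow_x: "mon 1 0 j [^]\<^bsub>Alg q\<^esub> (k::nat) = mon 1 0 (int k * j)"
  by (induction k) (simp_all add: one_eq_mon mul_mon algebra_simps)

lemma s_elem_eq: "s_elem n q = mon 1 n 0" and t_elem_eq: "t_elem n q = mon 1 0 (int n)"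
  by (simp_all add: s_elem_def t_elem_def gen_y_eq_mon gen_z_eq_mon mon_pow_h mon_pow_x)

end

lemma laurent_alg_simps [simp]:
  fixes f g :: "int \<Rightarrow>\<^sub>0 'a::field poly"
  shows "carrier laurent_alg = (UNIV :: (int \<Rightarrow>\<^sub>0 'a poly) set)"
      "f \<otimes>\<^bsub>laurent_alg\<^esub> g = f * g"
  "f \<oplus>\<^bsub>laurent_alg\<^esub> g = f + g"
      "\<zero>\<^bsub>laurent_alg\<^esub> = (0 :: int \<Rightarrow>\<^sub>0 'a poly)"
          "\<one>\<^bsub>laurent_alg\<^esub> = (1 :: int \<Rightarrow>\<^sub>0 'a poly)"
proof -
  interpret A: skew_alg "1 :: 'a" by unfold_locales simp
  have Alg: "laurent_alg = Alg (1 :: 'a)" by (simp add: laurent_alg_def Alg_def sigma_1)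
  have mult: "A.mul f g = f * g" for f g
  proof (induction f rule: mon_induct)
    case (mon c a i)
    show ?case
      by (induction g rule: mon_induct) (simp_all add: A.mul_mon mon_mult A.mul_add_right distrib_left)
  qed (simp_all add: A.mul_add_left distrib_right)
  from mult show "carrier laurent_alg = (UNIV :: (int \<Rightarrow>\<^sub>0 'a poly) set)"
      "f \<otimes>\<^bsub>laurent_alg\<^esub> g = f * g"
    "f \<oplus>\<^bsub>laurent_alg\<^esub> g = f + g"
        "\<zero>\<^bsub>laurent_alg\<^esub> = (0 :: int \<Rightarrow>\<^sub>0 'a poly)"
            "\<one>\<^bsub>laurent_alg\<^esub> = (1 :: int \<Rightarrow>\<^sub>0 'a poly)"
    by (simp_all add: Alg)
qed

section \<open>The centre\<close>

locale root_alg =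
  fixes q :: "'k::field" and n :: nat
  assumes n_ge_2: "n \<ge> 2" and primitive: "primitive_root_of_unity n q"
begin

sublocale skew_alg q
proof
  have "q ^ n = 1" "n > 0" using primitive by (auto simp: primitive_root_of_unity_def)
  then show "q \<noteq> 0" by (auto simp: zero_power)
qed

lemma n_pos [simp]: "0 < n" "n \<noteq> 0" using n_ge_2 by auto

lemma q_powi_eq_1_iff: "q powi j = 1 \<longleftrightarrow> int n dvd j"
proof -
  have qn: "q ^ n = 1" and min: "\<And>m. 0 < m \<Longrightarrow> m < n \<Longrightarrow> q ^ m \<noteq> 1"
    using primitive by (auto simp: primitive_root_of_unity_def)
  define m where "m = nat (j mod int n)"
  have m: "m < n" "int m = j mod int n" by (simp_all add: m_def nat_less_iff)
  have "q powi j = q powi (int n * (j div int n) + int m)" by (simp add: m)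
  also have "\<dots> = (q powi int n) powi (j div int n) * q ^ m"
    using q_nonzero by (simp only: power_int_add power_int_mult power_int_of_nat simp_thms)
  also have "\<dots> = q ^ m" by (simp add: qn)
  finally have "q powi j = q ^ m" .
  then show ?thesis using min[of m] m by (cases "m = 0") (auto simp: dvd_eq_mod_eq_0)
qed

lemma q_powi_power: "(q powi j) ^ a = q powi (j * int a)"
  by (simp add: power_int_mult)

lemma q_powi_power_eq_1: "int n dvd j \<or> n dvd a \<Longrightarrow> (q powi j) ^ a = 1"
  unfolding q_powi_power q_powi_eq_1_iff by (auto simp: dvd_mult dvd_mult2)

lemma q_power_eq_1_iff: "q ^ a = 1 \<longleftrightarrow> n dvd a"
  using q_powi_eq_1_iff[of "int a"] by simp

lemma inj_on_q_power: "inj_on (\<lambda>i. q ^ i) {..<n}"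
proof (rule linorder_inj_onI')
  fix i j assume ij: "i \<in> {..<n}" "j \<in> {..<n}" "i < j"
  have "q ^ j = q ^ i * q ^ (j - i)" using ij by (simp flip: power_add)
  moreover have "q ^ (j - i) \<noteq> 1" using ij by (auto simp: q_power_eq_1_iff dest: dvd_imp_le)
  ultimately show "q ^ i \<noteq> q ^ j" using q_nonzero by auto
qed

text \<open>
  The additive maps \<open>phi\<close>, \<open>component\<close>
      and, further below, \<open>const_part\<close> are pinned down by their
  coefficients. \<open>phi\<close> is the embedding $s \mapsto h^n$, $t \mapsto x^n$ of $K[s,t^{\pm 1}]$, and
  \<open>component i j f\<close> is the coordinate of \<open>f\<close> at $h^i x^j$.
\<close>
definition phi :: "(int \<Rightarrow>\<^sub>0 'k poly) \<Rightarrow> (int \<Rightarrow>\<^sub>0 'k poly)" where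
  "phi l = (SOME g. \<forall>j a. cf g j a = (if int n dvd j
      \<and> n dvd a then cf l (j div int n) (a div n) else 0))"

lemma cf_phi: "cf (phi l) j a = (if int n dvd j \<and> n dvd a then cf l (j div int n) (a div n) else 0)"
proof -
  have "\<exists>g. \<forall>j a. cf g j a = (if int n dvd j \<and> n dvd a then cf l (j div int n) (a div n) else 0)"
  proof (induction l rule: mon_induct)
    case zero
    then show ?case by (intro exI[of _ 0]) simp
  next
    case (mon c a j)
    then show ?case by (intro exI[of _ "mon c (n * a) (int n * j)"]) (auto simp: cf_mon)
  next
    case (add f g)
    then obtain f' g' where
        "\<forall>j a. cf f' j a = (if int n dvd j \<and> n dvd a then cf f (j div int n) (a div n) else 0)"
      "\<forall>j a. cf g' j a = (if int n dvd j \<and> n dvd a then cf g (j div int n) (a div n) else 0)" by blast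
    then show ?case by (intro exI[of _ "f' + g'"]) simp
  qed
  then show ?thesis unfolding phi_def by (rule someI2_ex) blast
qed

lemma phi_add: "phi (f + g) = phi f + phi g"
  by (rule cf_eqI) (simp add: cf_phi)

lemma phi_0 [simp]: "phi 0 = 0"
  by (rule cf_eqI) (simp add: cf_phi)

lemma phi_mon: "phi (mon c a j) = mon c (n * a) (int n * j)"
  by (rule cf_eqI) (auto simp: cf_phi cf_mon)

lemma phi_1 [simp]: "phi 1 = 1"
  by (simp add: one_eq_mon phi_mon)

lemma phi_mult: "phi (f * g) = phi f \<star> phi g"
proof (induction f rule: mon_induct)
  case (mon c a j)
  show ?case
  proof (induction g rule: mon_induct)
    case (mon d b k)
    show ?case by (simp add: phi_mon mon_mult mul_mon q_powi_power_eq_1 algebra_simps)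
  qed (simp_all add: phi_add distrib_left mul_add_right)
qed (simp_all add: phi_add distrib_right mul_add_left)

lemma phi_commute: "phi f \<star> g = g \<star> phi f"
proof (induction f rule: mon_induct)
  case (mon c a j)
  show ?case
  proof (induction g rule: mon_induct)
    case (mon d b k)
    show ?case by (simp add: phi_mon mul_mon q_powi_power_eq_1 ac_simps)
  qed (simp_all add: phi_add mul_add_left mul_add_right)
qed (simp_all add: phi_add mul_add_left mul_add_right)

lemma phi_left_commute: "g \<star> (phi l \<star> f) = phi l \<star> (g \<star> f)"
  by (metis mul_assoc phi_commute)

section \<open>Coordinates over the centre\<close>

definition component ::
    "nat \<Rightarrow> nat \<Rightarrow> (int \<Rightarrow>\<^sub>0 'k poly) \<Rightarrow> (int \<Rightarrow>\<^sub>0 'k poly)" where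
  "component i j f = (SOME g. \<forall>b a. cf g b a = cf f (int n * b + int j) (n * a + i))"

lemma div_mod_index:
  assumes "i < n" "j < n"
  shows "int n * b' + int j = b \<and> n * a' + i = a \<longleftrightarrow>
    a mod n = i \<and> b mod int n = int j \<and> b' = b div int n \<and> a' = a div n"
    (is "?l \<longleftrightarrow> ?r")
proof
  show ?r if ?l using that assms by auto
  show ?l if r: ?r
  proof
    have "int n * b' + int j = int n * (b div int n) + b mod int n" using r by simp
    then show "int n * b' + int j = b" by (simp only: mult_div_mod_eq)
    have "n * a' + i = n * (a div n) + a mod n" using r by simp
    then show "n * a' + i = a" by (simp only: mult_div_mod_eq)
  qed
qed

lemma cf_component:
  assumes "i < n" "j < n"
  shows "cf (component i j f) b a = cf f (int n * b + int j) (n * a + i)"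
proof -
  have "\<exists>g. \<forall>b a. cf g b a = cf f (int n * b + int j) (n * a + i)"
  proof (induction f rule: mon_induct)
    case zero
    then show ?case by (intro exI[of _ 0]) simp
  next
    case (mon c a b)
    then show ?case
      by (intro exI[of _ "if a mod n = i \<and> b mod int n = int j then mon c (a div n) (b div int n) else 0"])
         (auto simp: cf_mon div_mod_index[OF assms])
  next
    case (add f g)
    then obtain f' g' where "\<forall>b a. cf f' b a = cf f (int n * b + int j) (n * a + i)"
      "\<forall>b a. cf g' b a = cf g (int n * b + int j) (n * a + i)" by blast
    then show ?case by (intro exI[of _ "f' + g'"]) simp
  qed
  then show ?thesis unfolding component_def by (rule someI2_ex) blast
qed

lemma component_add: "i < n \<Longrightarrow> j < n \<Longrightarrow> component i j (f + g)
    = component i j f + component i j g"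
  by (rule cf_eqI) (simp add: cf_component)

lemma component_0: "i < n \<Longrightarrow> j < n \<Longrightarrow> component i j 0 = 0"
  by (rule cf_eqI) (simp add: cf_component)

lemma component_mon: "i < n \<Longrightarrow> j < n \<Longrightarrow> component i j (mon c a b) =
    (if a mod n = i \<and> b mod int n = int j then mon c (a div n) (b div int n) else 0)"
  by (rule cf_eqI) (auto simp: cf_component cf_mon div_mod_index)

lemma component_sum: "i < n \<Longrightarrow> j < n \<Longrightarrow> component i j (sum f A)
    = (\<Sum>x\<in>A. component i j (f x))"
  by (induction A rule: infinite_finite_induct) (auto simp: component_add component_0)

lemma component_phi_mul:
  assumes "i < n" "j < n"
  shows "component i j (phi l \<star> f) = l * component i j f"
proof (induction l rule: mon_induct)
  case (mon c a b)
  show ?case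
  proof (induction f rule: mon_induct)
    case (mon d e g)
    show ?case using assms
      by (simp add: phi_mon mul_mon q_powi_power_eq_1 component_mon mon_mult)
  qed (simp_all add: mul_add_right component_add component_0 assms distrib_left)
qed (simp_all add: phi_add mul_add_left component_add component_0 assms distrib_right)

lemma component_phi: "i < n \<Longrightarrow> j < n \<Longrightarrow> component i j (phi l) = (if i = 0 \<and> j
    = 0 then l else 0)"
  using component_phi_mul[of i j l 1] component_mon[of i j 1 0 0] by (auto simp flip: one_eq_mon)

lemma inj_phi: "inj phi"
  by (rule injI) (metis component_phi n_pos(1))

lemma decomposition: "f = (\<Sum>i<n. \<Sum>j<n. phi (component i j f) \<star> mon 1 i (int j))"
proof (induction f rule: mon_induct)
  case zero
  then show ?case by (simp add: component_0)
next
  case (mon c a b)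
  \<comment> \<open>The exponent of x may be negative; its residue is taken in the integers and only
    then made a natural index.\<close>
  define j0 where "j0 = nat (b mod int n)"
  have j0: "j0 < n" "int j0 = b mod int n" by (simp_all add: j0_def nat_less_iff)
  have "(\<Sum>i<n. \<Sum>j<n. phi (component i j (mon c a b)) \<star> mon 1 i (int j)) =
     (\<Sum>i<n. \<Sum>j<n. if i = a mod n then if j = j0 then mon c a b else 0 else 0)"
  proof (intro sum.cong refl)
    fix i j assume "i \<in> {..<n}" "j \<in> {..<n}"
    then show "phi (component i j (mon c a b)) \<star> mon 1 i (int j) = (if i = a mod n then if j
        = j0 then mon c a b else 0 else 0)"
      using j0 by (auto simp: component_mon phi_mon mul_mon q_powi_power_eq_1)
  qed
  also have "\<dots> = mon c a b"
    using j0 by (subst sum.swap) (simp add: sum.delta)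
  finally show ?case by simp
next
  case (add f g)
  have "f + g = (\<Sum>i<n. \<Sum>j<n. phi (component i j f) \<star> mon 1 i (int j)) + (\<Sum>i<n. \<Sum>j<n. phi (component i j g) \<star> mon 1 i (int j))"
    using add by simp
  also have "\<dots> = (\<Sum>i<n. \<Sum>j<n. phi (component i j (f + g)) \<star> mon 1 i (int j))"
    by (simp add: component_add phi_add mul_add_left sum.distrib)
  finally show ?case .
qed

lemma cf_x_mul: "cf (mon 1 0 1 \<star> f) (j + 1) a = q ^ a * cf f j a"
  by (induction f rule: mon_induct) (auto simp: mul_add_right mul_mon cf_mon algebra_simps)

lemma cf_mul_x: "cf (f \<star> mon 1 0 1) (j + 1) a = cf f j a"
  by (induction f rule: mon_induct) (auto simp: mul_add_left mul_mon cf_mon)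

lemma cf_h_mul: "cf (mon 1 1 0 \<star> f) j (a + 1) = cf f j a"
  by (induction f rule: mon_induct) (auto simp: mul_add_right mul_mon cf_mon)

lemma cf_mul_h: "cf (f \<star> mon 1 1 0) j (a + 1) = q powi j * cf f j a"
  by (induction f rule: mon_induct) (auto simp: mul_add_left mul_mon cf_mon algebra_simps)

lemma centre_eq: "centre (Alg q) = range phi"
proof
  show "range phi \<subseteq> centre (Alg q)" using phi_commute by (auto simp: centre_def)
  show "centre (Alg q) \<subseteq> range phi"
  proof
    fix f assume "f \<in> centre (Alg q)"
    then have c: "f \<star> g = g \<star> f" for g by (simp add: centre_def)
    \<comment> \<open>Comparing x f with f x at h^a x^(j+1) gives q^a = 1, and h f with f h at
      h^(a+1) x^j gives q^j = 1.\<close>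
    have "n dvd a \<and> int n dvd j" if "cf f j a \<noteq> 0" for j a
      using that cf_x_mul[of f j a] cf_mul_x[of f j a] cf_h_mul[of f j a] cf_mul_h[of f j a] c
      by (auto simp flip: q_power_eq_1_iff q_powi_eq_1_iff)
    then have "f = phi (component 0 0 f)"
      by (intro cf_eqI) (auto simp: cf_phi cf_component)
    then show "f \<in> range phi" by blast
  qed
qed

lemma Z_simps [simp]: "carrier (Z_Alg q) = range phi" "f \<otimes>\<^bsub>Z_Alg q\<^esub> g = f \<star> g"
    "f \<oplus>\<^bsub>Z_Alg q\<^esub> g = f + g"
   "\<zero>\<^bsub>Z_Alg q\<^esub> = 0" "\<one>\<^bsub>Z_Alg q\<^esub> = 1"
  using Alg_simps by (simp_all add: centre_eq)

sublocale Z: comm_image "Z_Alg q" phi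
  by unfold_locales (simp_all add: phi_add phi_mult)

lemma phi_ring_iso: "phi \<in> ring_iso laurent_alg (Z_Alg q)"
  by (auto simp: ring_iso_def ring_hom_def phi_add phi_mult bij_betw_def inj_phi)

lemma phi_generators: "phi (scalar c) = scalar c" "phi gen_y = s_elem n q" "phi gen_z = t_elem n q"
  by (simp_all add: scalar_eq_mon gen_y_eq_mon gen_z_eq_mon phi_mon s_elem_eq t_elem_eq)

end

section \<open>Homogeneous components of ideals\<close>

lemma mon_diff: "mon (c - d) a j = mon c a j - mon d a j"
  by (simp add: mon_def single_diff flip: diff_monom)

text \<open>The usual elimination: subtracting \<open>lam j\<close> times the sum from its twist
  removes the \<open>j\<close>-th term and rescales the others by nonzero factors. The twist is a
  closure property of \<open>V\<close> and not an operator, because for commutation with h it is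
  only available after cancelling h.\<close>

lemma eigenvector_split:
  fixes V :: "(int \<Rightarrow>\<^sub>0 'k::field poly) set"
  assumes add: "\<And>u v. u \<in> V \<Longrightarrow> v \<in> V \<Longrightarrow> u + v \<in> V"
    and scale: "\<And>c v. v \<in> V \<Longrightarrow> mon c 0 0 * v \<in> V"
    and E_scale: "\<And>i c v. E i v \<Longrightarrow> E i (mon c 0 0 * v)"
    and inj: "inj_on lam S"
    and twist: "\<And>A v. finite A \<Longrightarrow> (\<And>i. i \<in> A \<Longrightarrow> E i (v i))
        \<Longrightarrow> sum v A \<in> V \<Longrightarrow>
      (\<Sum>i\<in>A. mon (lam i) 0 0 * v i) \<in> V"
    and "finite S" "\<And>i. i \<in> S \<Longrightarrow> E i (v i)" "sum v S \<in> V" "i \<in> S"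
  shows "v i \<in> V"
  using assms(6,7,8,9) inj
proof (induction S arbitrary: v i rule: finite_induct)
  case (insert j A)
  have diff: "u - w \<in> V" if "u \<in> V" "w \<in> V" for u w
  proof -
    have "mon (- 1) 0 0 = (- 1 :: int \<Rightarrow>\<^sub>0 'k poly)"
      using mon_diff[of 0 "1 :: 'k" 0 0] by (simp flip: one_eq_mon)
    then show ?thesis using add[OF that(1) scale[OF that(2), of "- 1"]] by simp
  qed
  have "(\<Sum>i\<in>insert j A. mon (lam i) 0 0 * v i) - mon (lam j) 0 0 * sum v (insert j A) \<in> V"
    by (intro diff twist scale) (use insert in auto)
  also have "(\<Sum>i\<in>insert j A. mon (lam i) 0 0 * v i) - mon (lam j) 0 0 * sum v (insert j A) =
      (\<Sum>i\<in>A. mon (lam i - lam j) 0 0 * v i)"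
    using insert.hyps by (simp add: mon_diff algebra_simps sum_distrib_left sum_distrib_right sum_subtractf)
  finally have *: "(\<Sum>i\<in>A. mon (lam i - lam j) 0 0 * v i) \<in> V" .
  have A: "v k \<in> V" if k: "k \<in> A" for k
  proof -
    have "mon (lam k - lam j) 0 0 * v k \<in> V"
      using insert.prems k by (intro insert.IH[of "\<lambda>i. mon (lam i - lam j) 0 0 * v i"] * E_scale) auto
    then have "mon (inverse (lam k - lam j)) 0 0 * (mon (lam k - lam j) 0 0 * v k) \<in> V" by (rule scale)
    moreover have "lam k - lam j \<noteq> 0" using insert k by (auto simp: inj_on_def)
    ultimately show ?thesis by (simp add: mult.assoc[symmetric] mon_mult flip: one_eq_mon)
  qed
  have "sum v A \<in> V \<or> A = {}"
  proof -
    have "sum v B \<in> V" if "finite B" "B \<noteq> {}" "B \<subseteq> A" for B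
      using that by (induction B rule: finite_ne_induct) (auto intro: A add)
    then show ?thesis using insert.hyps by blast
  qed
  then have "v j \<in> V"
  proof
    assume "sum v A \<in> V"
    then show ?thesis using diff[OF insert.prems(2)] insert.hyps by fastforce
  qed (use insert in simp)
  then show ?case using A insert.prems by auto
qed simp

context root_alg
begin

lemma ideal_zero: "ideal I (Alg q) \<Longrightarrow> 0 \<in> I"
  and ideal_add: "ideal I (Alg q) \<Longrightarrow> f \<in> I \<Longrightarrow> g \<in> I
      \<Longrightarrow> f + g \<in> I"
  and ideal_left: "ideal I (Alg q) \<Longrightarrow> f \<in> I \<Longrightarrow> g \<star> f \<in> I"
  and ideal_right: "ideal I (Alg q) \<Longrightarrow> f \<in> I \<Longrightarrow> f \<star> g \<in> I"
  by (auto simp: ideal_Alg_iff)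

lemma ideal_scale: "ideal I (Alg q) \<Longrightarrow> f \<in> I \<Longrightarrow> mon c 0 0 * f \<in> I"
  using ideal_left[of I f "mon c 0 0"] by (simp add: scalar_mul)

lemma scalar_times_mul: "(mon c 0 0 * f) \<star> g = mon c 0 0 * (f \<star> g)"
  by (simp add: mul_assoc flip: scalar_mul)

lemma mul_scalar_times: "f \<star> (mon c 0 0 * g) = mon c 0 0 * (f \<star> g)"
proof -
  have "f \<star> (mon c 0 0 \<star> g) = (mon c 0 0 * f) \<star> g" by (simp add: mul_scalar flip: mul_assoc)
  then show ?thesis by (simp add: scalar_mul scalar_times_mul)
qed

lemma ideal_sum: "ideal I (Alg q) \<Longrightarrow> (\<And>x. x \<in> A \<Longrightarrow> f x \<in> I)
    \<Longrightarrow> sum f A \<in> I"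
  by (induction A rule: infinite_finite_induct) (auto intro: ideal_zero ideal_add)

lemma saturated_power:
  assumes "\<And>v. mon 1 1 0 \<star> v \<in> V \<Longrightarrow> v \<in> V" "mon 1 k 0 \<star> v \<in> V"
  shows "v \<in> V"
  using assms(2)
proof (induction k)
  case 0 then show ?case by (simp flip: one_eq_mon)
next
  case (Suc k)
  have "mon 1 (Suc k) 0 \<star> v = mon 1 1 0 \<star> (mon 1 k 0 \<star> v)" by (simp add: mul_mon flip: mul_assoc)
  then show ?case using Suc assms(1) by metis
qed

text \<open>
  Conjugation by \<open>x\<close> and
      by \<open>h\<close> act on the components of an element with distinct eigenvalues; the
  assumption on \<open>V\<close> makes up for \<open>h\<close> not being invertible.
\<close>
lemma component_mem_saturated:
  assumes V: "ideal V (Alg q)" and sat: "\<And>v. mon 1 1 0 \<star> v \<in> V \<Longrightarrow> v \<in> V"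
    and f: "f \<in> V" and i: "i < n" and j: "j < n"
  shows "phi (component i j f) \<in> V"
proof -
  \<comment> \<open>\<open>m i j\<close> has eigenvalue q^i for x and q^j for h; \<open>v i\<close>
    collects the terms that x cannot tell apart.\<close>
  define m where "m i j = phi (component i j f) \<star> mon 1 i (int j)" for i j
  define v where "v i = (\<Sum>j<n. m i j)" for i
  let ?x = "mon 1 0 1" and ?h = "mon 1 1 0"
  have xm: "?x \<star> m i j = mon (q ^ i) 0 0 * (m i j \<star> ?x)" for i j
  proof -
    have "?x \<star> m i j = phi (component i j f) \<star> (?x \<star> mon 1 i (int j))"
      by (simp add: m_def phi_left_commute)
    also have "?x \<star> mon 1 i (int j) = mon (q ^ i) 0 0 \<star> (mon 1 i (int j) \<star> ?x)"
      by (simp add: mul_mon add.commute)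
    also have "phi (component i j f) \<star> (mon (q ^ i) 0 0 \<star> (mon 1 i (int j) \<star> ?x))
        = mon (q ^ i) 0 0 \<star> (m i j \<star> ?x)"
      by (simp add: m_def phi_left_commute mul_assoc)
    finally show ?thesis by (simp add: scalar_mul)
  qed
  have mh: "m i j \<star> ?h = mon (q ^ j) 0 0 * (?h \<star> m i j)" for i j
  proof -
    have "mon 1 i (int j) \<star> ?h = mon (q ^ j) 0 0 \<star> (?h \<star> mon 1 i (int j))" by (simp add: mul_mon)
    then have "m i j \<star> ?h
        = phi (component i j f) \<star> (mon (q ^ j) 0 0 \<star> (?h \<star> mon 1 i (int j)))"
      by (simp add: m_def mul_assoc)
    also have "\<dots> = mon (q ^ j) 0 0 \<star> (?h \<star> m i j)"
      by (simp add: m_def phi_left_commute)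
    finally show ?thesis by (simp add: scalar_mul)
  qed
  \<comment> \<open>Conjugation by the unit x maps \<open>V\<close> to itself and is the
    twist.\<close>
  have vi: "v i \<in> V"
  proof (rule eigenvector_split[where V = V and S = "{..<n}" and lam = "\<lambda>i. q ^ i"
        and E = "\<lambda>i v. ?x \<star> v = mon (q ^ i) 0 0 * (v \<star> ?x)"])
    fix i c v assume "?x \<star> v = mon (q ^ i) 0 0 * (v \<star> ?x)"
    then show "?x \<star> (mon c 0 0 * v) = mon (q ^ i) 0 0 * ((mon c 0 0 * v) \<star> ?x)"
      by (simp add: scalar_times_mul mul_scalar_times mult.left_commute)
  next
    fix A and v :: "nat \<Rightarrow> _" assume A:
        "\<And>i. i \<in> A \<Longrightarrow> ?x \<star> v i = mon (q ^ i) 0 0 * (v i \<star> ?x)" "sum v A \<in> V"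
    have "?x \<star> sum v A \<star> mon 1 0 (-1) = (\<Sum>i\<in>A. mon (q ^ i) 0 0 * v i)"
      unfolding mul_sum_left mul_sum_right
    proof (intro sum.cong refl)
      fix i assume "i \<in> A"
      then have "?x \<star> v i \<star> mon 1 0 (-1) = mon (q ^ i) 0 0 * (v i \<star> (?x \<star> mon 1 0 (-1)))"
        using A(1)[of i] by (simp only: scalar_times_mul mul_assoc)
      then show "?x \<star> v i \<star> mon 1 0 (-1) = mon (q ^ i) 0 0 * v i"
        by (simp add: mul_mon flip: one_eq_mon)
    qed
    then show "(\<Sum>i\<in>A. mon (q ^ i) 0 0 * v i) \<in> V"
      using ideal_right[OF V ideal_left[OF V A(2), of ?x], of "mon 1 0 (- 1)"] by (simp only:)
  next
    show "sum v {..<n} \<in> V" using f decomposition[of f] by (simp add: v_def m_def)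
  next
    fix i show "?x \<star> v i = mon (q ^ i) 0 0 * (v i \<star> ?x)"
      by (simp add: v_def mul_sum_left mul_sum_right xm sum_distrib_left)
  qed (use V i inj_on_q_power in \<open>auto intro: ideal_add ideal_scale\<close>)
  \<comment> \<open>Right multiplication by h produces h times the twisted sum, and saturation
    cancels h.\<close>
  have "m i j \<in> V"
  proof (rule eigenvector_split[where V = V and S = "{..<n}" and lam = "\<lambda>j. q ^ j"
        and E = "\<lambda>j v. v \<star> ?h = mon (q ^ j) 0 0 * (?h \<star> v)"])
    fix j c v assume "v \<star> ?h = mon (q ^ j) 0 0 * (?h \<star> v)"
    then show "(mon c 0 0 * v) \<star> ?h = mon (q ^ j) 0 0 * (?h \<star> (mon c 0 0 * v))"
      by (simp add: scalar_times_mul mul_scalar_times mult.left_commute)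
  next
    fix A and v :: "nat \<Rightarrow> _" assume A:
        "\<And>j. j \<in> A \<Longrightarrow> v j \<star> ?h = mon (q ^ j) 0 0 * (?h \<star> v j)" "sum v A \<in> V"
    have "sum v A \<star> ?h = ?h \<star> (\<Sum>j\<in>A. mon (q ^ j) 0 0 * v j)"
      unfolding mul_sum_left mul_sum_right
    proof (intro sum.cong refl)
      fix j assume "j \<in> A"
      then show "v j \<star> ?h = ?h \<star> (mon (q ^ j) 0 0 * v j)"
        using A by (simp add: mul_scalar_times)
    qed
    then have "?h \<star> (\<Sum>j\<in>A. mon (q ^ j) 0 0 * v j) \<in> V"
        using ideal_right[OF V A(2), of ?h] by (simp only:)
    then show "(\<Sum>j\<in>A. mon (q ^ j) 0 0 * v j) \<in> V" by (rule sat)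
  next
    show "sum (m i) {..<n} \<in> V" using vi by (simp add: v_def)
  qed (use V j inj_on_q_power mh in \<open>auto intro: ideal_add ideal_scale\<close>)
  \<comment> \<open>The factor completes h^i x^j to h^n; its scalar undoes the one from moving x^j
    past h^(n-i).\<close>
  then have "m i j \<star> mon (inverse ((q powi int j) ^ (n - i))) (n - i) (- int j) \<in> V"
    by (rule ideal_right[OF V])
  also have "m i j \<star> mon (inverse ((q powi int j) ^ (n - i))) (n - i) (- int j)
      = mon 1 n 0 \<star> phi (component i j f)"
    using i q_nonzero by (simp add: m_def mul_assoc mul_mon) (simp add: phi_commute)
  finally show ?thesis using saturated_power[of V] sat by blast
qed

section \<open>Saturation of an ideal by powers of h\<close>

definition saturation ::
    "(int \<Rightarrow>\<^sub>0 'k poly) set \<Rightarrow> (int \<Rightarrow>\<^sub>0 'k poly) set" where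
  "saturation I = {v. \<exists>k. mon 1 k 0 \<star> v \<in> I}"

lemma h_power_mul: "mon 1 k 0 \<star> (mon 1 l 0 \<star> v) = mon 1 (k + l) 0 \<star> v"
  by (simp add: mul_mon flip: mul_assoc)

lemma saturation_mono:
    "ideal I (Alg q) \<Longrightarrow> mon 1 k 0 \<star> v \<in> I \<Longrightarrow> k \<le> l
        \<Longrightarrow> mon 1 l 0 \<star> v \<in> I"
  using ideal_left[of I "mon 1 k 0 \<star> v" "mon 1 (l - k) 0"] by (simp add: h_power_mul)

lemma ideal_saturation:
  assumes I: "ideal I (Alg q)"
  shows "ideal (saturation I) (Alg q)"
proof -
  have add: "u + v \<in> saturation I" if uv: "u \<in> saturation I" "v \<in> saturation I" for u v
  proof -
    obtain k l where "mon 1 k 0 \<star> u \<in> I" "mon 1 l 0 \<star> v \<in> I"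
        using uv by (auto simp: saturation_def)
    then have "mon 1 (max k l) 0 \<star> u \<in> I" "mon 1 (max k l) 0 \<star> v \<in> I"
      using saturation_mono[OF I] by auto
    then have "mon 1 (max k l) 0 \<star> (u + v) \<in> I" using I by (simp add: mul_add_right ideal_add)
    then show ?thesis by (auto simp: saturation_def)
  qed
  have zero: "0 \<in> saturation I" using ideal_zero[OF I] by (auto simp: saturation_def)
  have "g \<star> v \<in> saturation I" if v: "v \<in> saturation I" for g v
  proof (induction g rule: mon_induct)
    case (mon c a j)
    obtain k where k: "mon 1 k 0 \<star> v \<in> I" using v by (auto simp: saturation_def)
    \<comment> \<open>Normality of h: a power of h passes a monomial at the cost of a
      scalar.\<close>
    have "mon (c / (q powi j) ^ k) a j \<star> (mon 1 k 0 \<star> v) = mon 1 k 0 \<star> (mon c a j \<star> v)"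
      using q_nonzero by (simp add: mul_mon add.commute flip: mul_assoc)
    then have "mon 1 k 0 \<star> (mon c a j \<star> v) \<in> I" using ideal_left[OF I k] by metis
    then show ?case by (auto simp: saturation_def)
  qed (simp_all add: zero mul_add_left add)
  moreover have "v \<star> g \<in> saturation I" if "v \<in> saturation I" for g v
    using that ideal_right[OF I] by (auto simp: saturation_def simp flip: mul_assoc)
  ultimately show ?thesis using add zero by (simp add: ideal_Alg_iff)
qed

lemma component_mem_ideal:
  assumes I: "ideal I (Alg q)" and f: "f \<in> I" and ij: "i < n" "j < n"
  obtains k where "phi (mon 1 1 0 ^ k * component i j f) \<in> I"
proof -
  have "mon 1 0 0 \<star> f \<in> I" using f by (simp flip: one_eq_mon)
  then have "f \<in> saturation I" unfolding saturation_def by blast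
  moreover have "v \<in> saturation I" if "mon 1 1 0 \<star> v \<in> saturation I" for v
    using that by (auto simp: saturation_def h_power_mul)
  ultimately have "phi (component i j f) \<in> saturation I"
    by (intro component_mem_saturated ideal_saturation I ij) auto
  then obtain k where "mon 1 k 0 \<star> phi (component i j f) \<in> I" by (auto simp: saturation_def)
  \<comment> \<open>Raising the exponent to a multiple of \<open>n\<close> makes the power of h
    central, namely the image of s^k.\<close>
  then have "mon 1 (n * k) 0 \<star> phi (component i j f) \<in> I"
    by (rule saturation_mono[OF I]) (simp add: Suc_le_eq)
  then have "phi (mon 1 1 0 ^ k * component i j f) \<in> I"
    by (simp add: phi_mult mon_power phi_mon)
  then show ?thesis by (rule that)
qed

section \<open>Extension of central ideals\<close>

text \<open>The extended ideal in coordinates over the centre: contraction back to \<open>p\<close>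
  is immediate, and \<open>A_times_image_phi\<close> identifies it with the ideal spanned by
  \<open>p\<close>.\<close>

definition ext :: "(int \<Rightarrow>\<^sub>0 'k poly) set \<Rightarrow> (int \<Rightarrow>\<^sub>0 'k poly) set" where
  "ext p = {f. \<forall>i<n. \<forall>j<n. component i j f \<in> p}"

lemma cideal_vimage_phi: "ideal I (Alg q) \<Longrightarrow> cideal (phi -` I)"
  by (simp add: ideal_Alg_iff cideal_def phi_add phi_mult)

lemma ideal_ext:
  assumes p: "cideal p"
  shows "ideal (ext p) (Alg q)"
proof -
  have "component i j (g \<star> f) \<in> p \<and> component i j (f \<star> g) \<in> p" if f: "f \<in> ext p"
      and ij: "i < n" "j < n" for f g i j
  proof -
    have "component i j (g \<star> f)
        = component i j (\<Sum>k<n. \<Sum>l<n. phi (component k l f) \<star> (g \<star> mon 1 k (int l)))"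
      by (subst decomposition[of f]) (simp add: mul_sum_right phi_left_commute)
    also have "\<dots> = (\<Sum>k<n. \<Sum>l<n. component k l f * component i j (g \<star> mon 1 k (int l)))"
      by (simp add: component_sum component_phi_mul ij)
    also have "\<dots> \<in> p" using f by (intro cideal_sum cideal_mult2 p) (auto simp: ext_def)
    finally have 1: "component i j (g \<star> f) \<in> p" .
    have "component i j (f \<star> g)
        = component i j (\<Sum>k<n. \<Sum>l<n. phi (component k l f) \<star> (mon 1 k (int l) \<star> g))"
      by (subst decomposition[of f]) (simp add: mul_sum_left mul_assoc)
    also have "\<dots> = (\<Sum>k<n. \<Sum>l<n. component k l f * component i j (mon 1 k (int l) \<star> g))"
      by (simp add: component_sum component_phi_mul ij)
    also have "\<dots> \<in> p" using f by (intro cideal_sum cideal_mult2 p) (auto simp: ext_def)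
    finally show ?thesis using 1 by blast
  qed
  then show ?thesis unfolding ideal_Alg_iff
    using p by (auto simp: ext_def component_0 component_add cideal_zero cideal_add)
qed

lemma vimage_phi_ext: "cideal p \<Longrightarrow> phi -` ext p = p"
  using n_pos by (auto simp: ext_def component_phi cideal_zero)

lemma ext_subset_ideal:
  assumes "ideal I (Alg q)" "p \<subseteq> phi -` I" shows "ext p \<subseteq> I"
proof
  fix f assume "f \<in> ext p"
  then have "(\<Sum>i<n. \<Sum>j<n. phi (component i j f) \<star> mon 1 i (int j)) \<in> I"
    using assms by (intro ideal_sum ideal_right) (auto simp: ext_def)
  then show "f \<in> I" using decomposition[of f] by simp
qed

lemma A_times_image_phi:
  assumes p: "cideal p" shows "A_times q (phi ` p) = ext p"
proof
  show "A_times q (phi ` p) \<subseteq> ext p"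
  proof
    fix f assume "f \<in> A_times q (phi ` p)"
    then show "f \<in> ext p"
    proof induction
      case (prod g z)
      then have "z \<in> ext p" using vimage_phi_ext[OF p] by auto
      then show ?case using ideal_left[OF ideal_ext[OF p]] by simp
    next
      case (sum f g)
      then show ?case using ideal_add[OF ideal_ext[OF p]] by simp
    qed
  qed
  let ?A = "ideal_prod (Alg q) UNIV (phi ` p)"
  have "ext p \<subseteq> ?A"
  proof
    fix f assume f: "f \<in> ext p"
    have prod: "g \<star> phi l \<in> ?A" if "l \<in> p" for g l
      using ideal_prod.prod[of g UNIV "phi l" "phi ` p" "Alg q"] that by simp
    have add: "u + v \<in> ?A" if "u \<in> ?A" "v \<in> ?A" for u v
      using ideal_prod.sum[OF that] by simp
    have zero: "0 \<in> ?A" using prod[OF cideal_zero[OF p], of 0] by simp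
    have sum: "sum g A \<in> ?A" if "\<And>x. x \<in> A \<Longrightarrow> g x \<in> ?A" for g and A :: "nat set"
      using that by (induction A rule: infinite_finite_induct) (auto intro: add zero)
    have "(\<Sum>i<n. \<Sum>j<n. phi (component i j f) \<star> mon 1 i (int j)) \<in> ?A"
      unfolding phi_commute using f by (intro sum prod) (auto simp: ext_def)
    then show "f \<in> ?A" using decomposition[of f] by simp
  qed
  then show "ext p \<subseteq> A_times q (phi ` p)" by simp
qed

text \<open>An ideal not inside \<open>ext p\<close> has a member with a coordinate outside
  \<open>p\<close>, hence contains a central element outside \<open>p\<close>; the power of s it
  acquires is harmless as s is not in \<open>p\<close>. Two such elements refute an inclusion of the
  product.\<close>

lemma ext_mem_Spec:
  assumes p: "cprime p" and s: "mon 1 1 0 \<notin> p"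
  shows "ext p \<in> Spec (Alg q)"
  unfolding Spec_def
proof (intro CollectI conjI allI impI)
  note Ip = cprime_cideal[OF p]
  show "ideal (ext p) (Alg q)" by (rule ideal_ext[OF Ip])
  have "phi 1 \<notin> ext p" using vimage_phi_ext[OF Ip] cprime_one[OF p] by blast
  then show "ext p \<noteq> carrier (Alg q)" by auto
  have ex: "\<exists>a. phi a \<in> I \<and> a \<notin> p" if I: "ideal I (Alg q)" and sub:
      "\<not> I \<subseteq> ext p" for I
  proof -
    obtain f i j where f: "f \<in> I" "i < n" "j < n" "component i j f \<notin> p" using sub by (auto simp: ext_def)
    obtain k where "phi (mon 1 1 0 ^ k * component i j f) \<in> I" using component_mem_ideal[OF I f(1-3)] .
    moreover have "mon 1 1 0 ^ k * component i j f \<notin> p" using f s cprime_mult[OF p] cprime_power[OF p] by blast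
    ultimately show ?thesis by blast
  qed
  fix I J assume IJ: "ideal I (Alg q) \<and> ideal J (Alg q) \<and> ideal_prod (Alg q) I J \<subseteq> ext p"
  show "I \<subseteq> ext p \<or> J \<subseteq> ext p"
  proof (rule ccontr)
    assume "\<not> ?thesis"
    then obtain a b where ab: "phi a \<in> I" "a \<notin> p" "phi b \<in> J" "b \<notin> p" using ex IJ by meson
    then have "phi (a * b) \<in> ideal_prod (Alg q) I J"
        using ideal_prod.prod[of "phi a" I "phi b" J "Alg q"] by (simp add: phi_mult)
    then have "a * b \<in> phi -` ext p" using IJ by auto
    then show False using ab cprime_mult[OF p] vimage_phi_ext[OF Ip] by blast
  qed
qed

text \<open>A proper \<open>J\<close> above contracts to \<open>p\<close> by maximality; its
  coordinates, times powers of s, then lie in \<open>p\<close>, and s can be cancelled.\<close>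

lemma ext_mem_Max:
  assumes max: "cmaximal p" and s: "mon 1 1 0 \<notin> p"
  shows "ext p \<in> Max_Spec (Alg q)"
  unfolding Max_Spec_def
proof (intro CollectI maximalidealI)
  note p = cmaximal_cprime[OF max]
  note Ip = cprime_cideal[OF p]
  show "ideal (ext p) (Alg q)" by (rule ideal_ext[OF Ip])
  have "phi 1 \<notin> ext p" using vimage_phi_ext[OF Ip] cprime_one[OF p] by blast
  then show "carrier (Alg q) \<noteq> ext p" by auto
  fix J assume J: "ideal J (Alg q)" "ext p \<subseteq> J"
  then have sub: "p \<subseteq> phi -` J" using vimage_phi_ext[OF Ip] by blast
  show "J = ext p \<or> J = carrier (Alg q)"
  proof (cases "1 \<in> phi -` J")
    case True
    then show ?thesis using ideal_one_closed[OF J(1)] by simp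
  next
    case False
    then have eq: "phi -` J = p" using max sub cideal_vimage_phi[OF J(1)] by (auto simp: cmaximal_def)
    have "J \<subseteq> ext p"
    proof
      fix f assume f: "f \<in> J"
      have "component i j f \<in> p" if ij: "i < n" "j < n" for i j
      proof -
        obtain k where "phi (mon 1 1 0 ^ k * component i j f) \<in> J" using component_mem_ideal[OF J(1) f ij] .
        then have "mon 1 1 0 ^ k * component i j f \<in> p" using eq by blast
        then show ?thesis using s cprime_mult[OF p] cprime_power[OF p] by blast
      qed
      then show "f \<in> ext p" by (simp add: ext_def)
    qed
    then show ?thesis using J by blast
  qed
qed

text \<open>As h is normal, a prime omitting h is saturated, so it contains the central coordinates
  of its members without loss of a power of h.\<close>

lemma Spec_not_containing_h:
  assumes P: "P \<in> Spec (Alg q)" and h: "mon 1 1 0 \<notin> P"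
  shows "cprime (phi -` P)" "P = ext (phi -` P)" "mon 1 1 0 \<notin> phi -` P"
proof -
  have I: "ideal P (Alg q)" and one: "1 \<notin> P" and pr:
      "\<And>f g. (\<And>r. f \<star> r \<star> g \<in> P) \<Longrightarrow> f \<in> P \<or> g \<in> P"
    using P by (auto simp: Spec_Alg_iff)
  have sat: "v \<in> P" if v: "mon 1 1 0 \<star> v \<in> P" for v
  proof -
    have "mon 1 1 0 \<star> r \<star> v \<in> P" for r
    proof (induction r rule: mon_induct)
      case (mon c a j)
      have "mon 1 1 0 \<star> mon c a j \<star> v = mon (c / q powi j) a j \<star> (mon 1 1 0 \<star> v)"
        using q_nonzero by (simp add: mul_mon flip: mul_assoc)
      then show ?case using ideal_left[OF I v] by simp
    qed (simp_all add: mul_add_left mul_add_right ideal_zero[OF I] ideal_add[OF I])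
    then show ?thesis using pr h by blast
  qed
  show "cprime (phi -` P)"
    unfolding cprime_def
  proof (intro conjI allI impI)
    show "cideal (phi -` P)" by (rule cideal_vimage_phi[OF I])
    show "1 \<notin> phi -` P" using one by simp
    fix a b assume ab: "a * b \<in> phi -` P"
    have "phi a \<star> r \<star> phi b = r \<star> phi (a * b)" for r
        by (simp add: phi_mult phi_commute[of a] mul_assoc)
    then have "phi a \<star> r \<star> phi b \<in> P" for r using ab ideal_left[OF I] by simp
    then show "a \<in> phi -` P \<or> b \<in> phi -` P" using pr by auto
  qed
  show "P = ext (phi -` P)"
  proof
    show "P \<subseteq> ext (phi -` P)" using component_mem_saturated[OF I sat] by (auto simp: ext_def)
    show "ext (phi -` P) \<subseteq> P" by (rule ext_subset_ideal[OF I]) simp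
  qed
  show "mon 1 1 0 \<notin> phi -` P"
  proof
    assume "mon 1 1 0 \<in> phi -` P"
    then have "mon 1 n 0 \<star> 1 \<in> P" by (simp add: phi_mon)
    then show False using saturated_power[of P n 1] sat one by blast
  qed
qed

end

section \<open>Primes containing $h$\<close>

text \<open>As sets, the ideals of \<open>Alg q\<close>
    and of \<open>laurent_alg\<close> containing \<open>h_set\<close> are the same.\<close>
definition h_set :: "(int \<Rightarrow>\<^sub>0 'k::field poly) set" where
  "h_set = {f. \<forall>j. cf f j 0 = 0}"

lemma cprime_coeff_0: "cprime {p :: 'k::field poly. coeff p 0 = 0}"
  by (auto simp: cprime_def cideal_def coeff_mult_0)

lemma h_set_eq: "h_set = laurent_ext {p. coeff p 0 = 0}"
  by (simp add: h_set_def laurent_ext_def cf_def)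

lemma cprime_h_set: "cprime (h_set :: (int \<Rightarrow>\<^sub>0 'k::field poly) set)"
  unfolding h_set_eq by (rule cprime_laurent_ext[OF cprime_coeff_0])

lemma h_mem_h_set: "mon 1 1 0 \<in> h_set"
  by (simp add: h_set_def cf_mon)

lemma mon_nonzero:
  assumes "c \<noteq> 0" shows "mon c a j \<noteq> 0"
proof
  assume "mon c a j = 0"
  then have "cf (mon c a j) j a = 0" by simp
  then show False using assms by (simp add: cf_mon)
qed

lemma h_set_nonzero: "h_set \<noteq> {0 :: int \<Rightarrow>\<^sub>0 'k::field poly}"
  using h_mem_h_set mon_nonzero by (metis singletonD one_neq_zero)

definition const_part ::
    "(int \<Rightarrow>\<^sub>0 'k::field poly) \<Rightarrow> (int \<Rightarrow>\<^sub>0 'k poly)" where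
  "const_part f = (SOME g. \<forall>j a. cf g j a = (if a = 0 then cf f j 0 else 0))"

lemma cf_const_part: "cf (const_part f) j a = (if a = 0 then cf f j 0 else 0)"
proof -
  have "\<exists>g. \<forall>j a. cf g j a = (if a = 0 then cf f j 0 else 0)"
  proof (induction f rule: mon_induct)
    case zero
    then show ?case by (intro exI[of _ 0]) simp
  next
    case (mon c a j)
    then show ?case by (intro exI[of _ "if a = 0 then mon c a j else 0"]) (auto simp: cf_mon)
  next
    case (add f g)
    then obtain f' g' where "\<forall>j a. cf f' j a = (if a = 0 then cf f j 0 else 0)"
      "\<forall>j a. cf g' j a = (if a = 0 then cf g j 0 else 0)" by blast
    then show ?case by (intro exI[of _ "f' + g'"]) simp
  qed
  then show ?thesis unfolding const_part_def by (rule someI2_ex) blast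
qed

lemma const_part_add: "const_part (f + g) = const_part f + const_part g"
  and const_part_diff: "const_part (f - g) = const_part f - const_part g"
  and const_part_0 [simp]: "const_part 0 = 0"
  and const_part_idem: "const_part (const_part f) = const_part f"
  by (rule cf_eqI; simp add: cf_const_part)+

lemma const_part_mon: "const_part (mon c a j) = (if a = 0 then mon c a j else 0)"
  by (rule cf_eqI) (auto simp: cf_const_part cf_mon)

lemma const_part_1 [simp]: "const_part 1 = 1"
  by (simp add: one_eq_mon const_part_mon)

lemma const_part_eq_0_iff: "const_part f = 0 \<longleftrightarrow> f \<in> h_set"
proof
  assume "const_part f = 0"
  then show "f \<in> h_set" unfolding h_set_def using cf_const_part[of f _ 0] by simp
qed (auto simp: h_set_def cf_const_part intro!: cf_eqI)

lemma vimage_const_part: "const_part -` {0} = h_set"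
  using const_part_eq_0_iff by auto

lemma minus_const_part: "f - const_part f \<in> h_set"
  by (simp add: h_set_def cf_const_part)

context skew_alg
begin

text \<open>The twist multiplies a term by a power of q with exponent \<open>b\<close>, the h-degree
  of the right factor: trivial for \<open>b\<close> = 0, and for \<open>b\<close> > 0 the term lies
  in \<open>h_set\<close> anyway.\<close>

lemma mul_minus_times_h_set: "f \<star> g - f * g \<in> h_set"
proof -
  have "cf (f \<star> g) j 0 = cf (f * g) j 0" for j
  proof (induction f rule: mon_induct)
    case (mon c a i)
    show ?case
      by (induction g rule: mon_induct) (auto simp: mul_mon mon_mult cf_mon mul_add_right distrib_left)
  qed (simp_all add: mul_add_left distrib_right)
  then show ?thesis by (simp add: h_set_def)
qed

text \<open>A homomorphism from the commutative product to the skew one, since x commutes with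
  coefficients free of h.\<close>

lemma const_part_mult: "const_part (f * g) = const_part f \<star> const_part g"
proof (induction f rule: mon_induct)
  case (mon c a i)
  show ?case
    by (induction g rule: mon_induct)
      (auto simp: mul_mon mon_mult const_part_mon const_part_add mul_add_right distrib_left)
qed (simp_all add: mul_add_left distrib_right const_part_add)

lemma h_divides: "\<exists>g g'. f - const_part f = g \<star> mon 1 1 0 \<and> f - const_part f = g' * mon 1 1 0"
proof (induction f rule: mon_induct)
  case zero
  show ?case by (intro exI[of _ 0]) simp
next
  case (mon c a j)
  show ?case
  proof (cases a)
    case 0
    then show ?thesis by (intro exI[of _ 0]) (simp add: const_part_mon)
  next
    case (Suc b)
    have "mon (c / q powi j) b j \<star> mon 1 1 0 = mon c a j" using q_nonzero Suc by (simp add: mul_mon)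
    moreover have "mon c b j * mon 1 1 0 = mon c a j" using Suc by (simp add: mon_mult)
    moreover have "const_part (mon c a j) = 0" using Suc by (simp add: const_part_mon)
    ultimately show ?thesis by (metis diff_zero)
  qed
next
  case (add f1 f2)
  then obtain g1 g1' g2 g2' where "f1 - const_part f1 = g1 \<star> mon 1 1 0" "f1 - const_part f1 = g1' * mon 1 1 0"
    "f2 - const_part f2 = g2 \<star> mon 1 1 0" "f2 - const_part f2 = g2' * mon 1 1 0" by blast
  moreover have "(f1 + f2) - const_part (f1 + f2) = (f1 - const_part f1) + (f2 - const_part f2)"
    by (simp add: const_part_add)
  ultimately have "(f1 + f2) - const_part (f1 + f2) = (g1 + g2) \<star> mon 1 1 0"
    "(f1 + f2) - const_part (f1 + f2) = (g1' + g2') * mon 1 1 0"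
    by (simp_all only: mul_add_left distrib_right)
  then show ?case by blast
qed

lemma h_set_subset_cideal:
  fixes p :: "(int \<Rightarrow>\<^sub>0 'k poly) set"
  assumes "cideal p" "mon 1 1 0 \<in> p" shows "h_set \<subseteq> p"
proof
  fix f :: "int \<Rightarrow>\<^sub>0 'k poly" assume "f \<in> h_set"
  then have "const_part f = 0" by (simp add: const_part_eq_0_iff)
  then obtain g where "f = g * mon 1 1 0" using h_divides[of f] by (metis diff_zero)
  then show "f \<in> p" using cideal_mult[OF assms] by simp
qed

lemma h_set_subset_ideal:
  assumes "ideal P (Alg q)" "mon 1 1 0 \<in> P" shows "h_set \<subseteq> P"
proof
  fix f :: "int \<Rightarrow>\<^sub>0 'k poly" assume "f \<in> h_set"
  then have "const_part f = 0" by (simp add: const_part_eq_0_iff)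
  then obtain g where "f = g \<star> mon 1 1 0" using h_divides[of f] by (metis diff_zero)
  then show "f \<in> P" using assms by (simp add: ideal_Alg_iff)
qed

lemma mul_mem_iff_times_mem:
  assumes "\<And>u v. u \<in> J \<Longrightarrow> v \<in> J \<Longrightarrow> u + v \<in> J" "h_set \<subseteq> J"
  shows "f \<star> g \<in> J \<longleftrightarrow> f * g \<in> J"
proof -
  have "f \<star> g - f * g \<in> h_set" by (rule mul_minus_times_h_set)
  moreover from this have "f * g - f \<star> g \<in> h_set" by (simp add: h_set_def)
  ultimately have "f \<star> g - f * g \<in> J" "f * g - f \<star> g \<in> J" using assms(2) by auto
  then show ?thesis
    using assms(1)[of "f \<star> g - f * g" "f * g"] assms(1)[of "f * g - f \<star> g" "f \<star> g"] by auto
qed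

lemma ideal_iff_cideal:
  assumes "h_set \<subseteq> J" shows "ideal J (Alg q) \<longleftrightarrow> cideal J"
proof (cases "\<forall>u\<in>J. \<forall>v\<in>J. u + v \<in> J")
  case True
  then have *: "f \<star> g \<in> J \<longleftrightarrow> f * g \<in> J" for f g
      using mul_mem_iff_times_mem[OF _ assms] by blast
  show ?thesis unfolding ideal_Alg_iff cideal_def * by (auto simp: mult.commute)
next
  case False
  then show ?thesis unfolding ideal_Alg_iff cideal_def by blast
qed

lemma Spec_iff_cprime:
  assumes "h_set \<subseteq> J" shows "J \<in> Spec (Alg q) \<longleftrightarrow> cprime J"
proof (cases "cideal J")
  case True
  then have *: "f \<star> g \<in> J \<longleftrightarrow> f * g \<in> J" for f g
    using mul_mem_iff_times_mem[OF cideal_add assms] by blast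
  have "(\<forall>r. f \<star> r \<star> g \<in> J) \<longleftrightarrow> f * g \<in> J" for f g
  proof
    assume "\<forall>r. f \<star> r \<star> g \<in> J"
    then have "f \<star> 1 \<star> g \<in> J" by blast
    then show "f * g \<in> J" by (simp add: *)
  next
    assume fg: "f * g \<in> J"
    show "\<forall>r. f \<star> r \<star> g \<in> J"
    proof
      fix r
      have "(g * r) * f \<in> J" using cideal_mult[OF True fg, of r] by (simp add: ac_simps)
      \<comment> \<open>Exchanging the two products of \<open>r\<close> and \<open>g\<close> changes
        the element by a multiple of a member of \<open>h_set\<close>.\<close>
      then have "f * (r \<star> g) \<in> J"
        using mul_minus_times_h_set[of r g] cideal_mult[OF True, of "r \<star> g - r * g" f] assms
          cideal_add[OF True, of "f * (r \<star> g - r * g)" "f * (r * g)"]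
        by (auto simp: algebra_simps)
      then show "f \<star> r \<star> g \<in> J" by (simp add: mul_assoc *)
    qed
  qed
  then show ?thesis using True ideal_iff_cideal[OF assms] by (auto simp: Spec_Alg_iff cprime_def)
qed (simp add: Spec_Alg_iff cprime_def ideal_iff_cideal[OF assms])

lemma Max_of_cmaximal:
  assumes "h_set \<subseteq> J" "cmaximal J" shows "J \<in> Max_Spec (Alg q)"
  unfolding Max_Spec_def
proof (intro CollectI maximalidealI)
  show "ideal J (Alg q)" "carrier (Alg q) \<noteq> J"
    using assms ideal_iff_cideal[OF assms(1)] by (auto simp: cmaximal_def)
  fix I assume I: "ideal I (Alg q)" "J \<subseteq> I"
  then have "cideal I" using assms(1) ideal_iff_cideal[of I] by auto
  then show "I = J \<or> I = carrier (Alg q)" using assms(2) I cideal_UNIV[of I] unfolding cmaximal_def by auto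
qed

lemma h_ideal_eq: "h_ideal q = h_set"
proof
  have "ideal h_set (Alg q)" using ideal_iff_cideal[of h_set] cprime_cideal[OF cprime_h_set] by simp
  then show "h_ideal q \<subseteq> h_set"
    using h_mem_h_set unfolding h_ideal_def genideal_def gen_y_eq_mon by blast
  show "h_set \<subseteq> h_ideal q"
    using h_set_subset_ideal unfolding h_ideal_def genideal_def gen_y_eq_mon by blast
qed

lemma K_x_simps [simp]: "carrier (K_x q) = range const_part" "f \<otimes>\<^bsub>K_x q\<^esub> g = f \<star> g"
    "f \<oplus>\<^bsub>K_x q\<^esub> g = f + g"
   "\<zero>\<^bsub>K_x q\<^esub> = 0" "\<one>\<^bsub>K_x q\<^esub> = 1"
proof -
  have "(\<forall>i. \<exists>c. Poly_Mapping.lookup f i = [:c:]) \<longleftrightarrow> f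
      \<in> range const_part" for f :: "int \<Rightarrow>\<^sub>0 'k poly"
  proof
    assume *: "\<forall>i. \<exists>c. Poly_Mapping.lookup f i = [:c:]"
    have "cf f j a = cf (const_part f) j a" for j a
    proof -
      obtain c where "Poly_Mapping.lookup f j = [:c:]" using * by blast
      then show ?thesis unfolding cf_const_part by (cases a) (simp_all add: cf_def)
    qed
    then have "f = const_part f" by (rule cf_eqI)
    then show "f \<in> range const_part" by blast
  next
    assume "f \<in> range const_part"
    then obtain g where f: "f = const_part g" by blast
    show "\<forall>i. \<exists>c. Poly_Mapping.lookup f i = [:c:]"
    proof
      fix i
      have "coeff (Poly_Mapping.lookup f i) a = coeff [:cf g i 0:] a" for a
        using cf_const_part[of g i a] by (cases a) (simp_all add: f cf_def)
      then have "Poly_Mapping.lookup f i = [:cf g i 0:]" by (intro poly_eqI)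
      then show "\<exists>c. Poly_Mapping.lookup f i = [:c:]" by blast
    qed
  qed
  then show "carrier (K_x q) = range const_part" by (auto simp: K_x_def)
qed (use Alg_simps in \<open>simp_all add: K_x_def\<close>)

sublocale K_x: comm_image "K_x q" const_part
  by unfold_locales (simp_all add: const_part_add const_part_mult)

lemma genideal_h_K_x:
  assumes Q: "ideal Q (K_x q)"
  shows "genideal (Alg q) ({gen_y} \<union> Q) = const_part -` Q"
proof
  have sub: "Q \<subseteq> range const_part" using Q by (auto simp: K_x.ideal_iff)
  then have ci: "cideal (const_part -` Q)" using Q K_x.ideal_iff_vimage[of Q] by simp
  have "0 \<in> Q" using Q by (auto simp: K_x.ideal_iff)
  then have h: "h_set \<subseteq> const_part -` Q" by (auto simp: const_part_eq_0_iff[symmetric])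
  have "Q \<subseteq> const_part -` Q" using sub by (auto simp: const_part_idem)
  then show "genideal (Alg q) ({gen_y} \<union> Q) \<subseteq> const_part -` Q"
    using ci h ideal_iff_cideal[OF h] h_mem_h_set unfolding genideal_def gen_y_eq_mon by blast
  show "const_part -` Q \<subseteq> genideal (Alg q) ({gen_y} \<union> Q)"
    unfolding genideal_def gen_y_eq_mon
  proof (intro subsetI InterI)
    fix f :: "int \<Rightarrow>\<^sub>0 'k poly" and I
    assume "f \<in> const_part -` Q" "I \<in> {I. ideal I (Alg q) \<and> {mon 1 1 0} \<union> Q \<subseteq> I}"
    then have f: "const_part f \<in> Q" and I: "ideal I (Alg q)" "mon 1 1 0 \<in> I" "Q \<subseteq> I" by auto
    have "f - const_part f \<in> I" using h_set_subset_ideal[OF I(1,2)] minus_const_part by blast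
    then have "(f - const_part f) + const_part f \<in> I" using f I unfolding ideal_Alg_iff by blast
    then show "f \<in> I" by simp
  qed
qed

text \<open>Preimages under \<open>const_part\<close> match primes of K[x, x^-1] with commutative
  primes above \<open>h_set\<close>; zero corresponds to \<open>h_set\<close> itself, hence the
  strict inclusion.\<close>

lemma HH_eq: "HH q = {p. cprime p \<and> h_set \<subset> p}"
proof (intro equalityI subsetI)
  fix P assume "P \<in> HH q"
  then obtain Q where Q: "P = genideal (Alg q) ({gen_y} \<union> Q)" "Q \<in> Spec (K_x q)" "Q \<noteq> {0}"
      by (auto simp: HH_def)
  then have id: "ideal Q (K_x q)" by (simp add: K_x.Spec_iff)
  then have sub: "Q \<subseteq> carrier (K_x q)" "{0} \<subset> Q" using Q(3) by (auto simp: K_x.ideal_iff)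
  have P: "P = const_part -` Q" using Q(1) genideal_h_K_x[OF id] by simp
  have "{0} \<subseteq> carrier (K_x q)" using const_part_0 by (metis K_x.closed empty_subsetI insert_subset)
  then have "h_set \<subset> P"
    using K_x.vimage_psubset_iff[of "{0}" Q] sub unfolding P vimage_const_part by blast
  then show "P \<in> {p. cprime p \<and> h_set \<subset> p}" using K_x.Spec_iff_vimage[OF sub(1)] Q P by simp
next
  fix p :: "(int \<Rightarrow>\<^sub>0 'k poly) set" assume "p \<in> {p. cprime p \<and> h_set \<subset> p}"
  then have p: "cprime p" "h_set \<subset> p" by auto
  define Q where "Q = const_part ` p"
  have sub: "Q \<subseteq> carrier (K_x q)" by (auto simp: Q_def)
  have vi: "const_part -` Q = p"
  proof safe
    fix f assume "const_part f \<in> Q"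
    then obtain g where g: "const_part f = const_part g" "g \<in> p" by (auto simp: Q_def)
    then have "f - g \<in> h_set" by (simp add: const_part_eq_0_iff[symmetric] const_part_diff)
    then show "f \<in> p" using p g cideal_add[OF cprime_cideal[OF p(1)], of "f - g" g] by auto
  qed (simp add: Q_def)
  then have Spec: "Q \<in> Spec (K_x q)" using K_x.Spec_iff_vimage[OF sub] p by simp
  moreover have "Q \<noteq> {0}" using vi p(2) vimage_const_part by auto
  moreover have "p = genideal (Alg q) ({gen_y} \<union> Q)"
    using genideal_h_K_x[of Q] Spec vi by (simp add: K_x.Spec_iff)
  ultimately show "p \<in> HH q" by (auto simp: HH_def)
qed

end

section \<open>The prime spectrum\<close>

text \<open>In a domain, where zero is the least prime, this is height one.\<close>

definition minimal_prime :: "'a::comm_ring_1 set \<Rightarrow> bool" where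
  "minimal_prime p \<longleftrightarrow> cprime p \<and> p \<noteq> {0} \<and> \<not> (\<exists>p'. cprime p'
      \<and> p' \<noteq> {0} \<and> p' \<subset> p)"

lemma minimal_prime_cprime: "minimal_prime p \<Longrightarrow> cprime p"
  by (simp add: minimal_prime_def)

text \<open>Dimension two: a nonzero prime that is not minimal lies above another nonzero prime and
  is therefore maximal. That the last two cases exclude each other is
  \<open>minimal_prime_not_cmaximal\<close>.\<close>

lemma cprime_cases:
  fixes p :: "(int \<Rightarrow>\<^sub>0 'k::field poly) set"
  assumes "cprime p"
  obtains "p = {0}" | "minimal_prime p" | "cmaximal p"
  using assms cmaximal_of_chain unfolding minimal_prime_def by blast

lemma minimal_prime_not_cmaximal:
  fixes p :: "(int \<Rightarrow>\<^sub>0 'k::field poly) set"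
  shows "minimal_prime p \<Longrightarrow> \<not> cmaximal p"
  using cmaximal_not_minimal_prime[of p] unfolding minimal_prime_def by metis

lemma zero_not_cmaximal: "\<not> cmaximal {0 :: int \<Rightarrow>\<^sub>0 'k::field poly}"
  using laurent_ext_not_cmaximal[of "{0 :: 'k poly}", OF cprime_zero] by (simp add: laurent_ext_zero)

lemma h_set_not_cmaximal: "\<not> cmaximal (h_set :: (int \<Rightarrow>\<^sub>0 'k::field poly) set)"
  unfolding h_set_eq by (rule laurent_ext_not_cmaximal[OF cprime_coeff_0])

text \<open>Keeps the members of \<open>NN n q\<close> out of (h): their central primes omit
  s.\<close>

lemma cprime_subset_h_set:
  fixes p :: "(int \<Rightarrow>\<^sub>0 'k::field poly) set"
  assumes "cprime p" "p \<noteq> {0}" "p \<subseteq> h_set"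
  shows "mon 1 1 0 \<in> p"
proof -
  have "{f :: 'k poly. [:0, 1:] dvd f} = {f. coeff f 0 = 0}"
    using poly_eq_0_iff_dvd[of _ "0 :: 'k"] by (auto simp: poly_0_coeff_0)
  then have "p \<subseteq> laurent_ext {f. [:0, 1:] dvd f}" using assms by (simp add: h_set_eq)
  then have "Poly_Mapping.single 0 [:0, 1:] \<in> p"
    using principal_prime_minimal[OF assms(1,2)] by (simp add: is_unit_iff_degree)
  then show ?thesis unfolding gen_y_eq_mon[symmetric] gen_y_def .
qed

lemma not_cmaximal_obtains:
  assumes "cprime p" "\<not> cmaximal p"
  obtains J where "cideal J" "p \<subset> J" "1 \<notin> J"
  using assms by (auto simp: cmaximal_def cprime_def)

context root_alg
begin

lemma vimage_phi_image: "phi -` (phi ` p) = p"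
  using inj_phi by (simp add: inj_vimage_image_eq)

lemma phi_image_vimage: "N \<subseteq> range phi \<Longrightarrow> phi ` (phi -` N) = N"
  by auto

lemma s_elem_mem_iff: "s_elem n q \<in> phi ` p \<longleftrightarrow> mon 1 1 0 \<in> p"
  using inj_phi phi_generators(2) by (metis gen_y_eq_mon inj_image_mem_iff)

lemma Spec_Z_subset: "N \<in> Spec (Z_Alg q) \<Longrightarrow> N \<subseteq> range phi"
  by (auto simp: Z.Spec_iff Z.ideal_iff)

lemma MM_eq: "MM n q = {ext m | m. cmaximal m \<and> mon 1 1 0 \<notin> m}"
proof (intro equalityI subsetI)
  fix P assume "P \<in> MM n q"
  then obtain N where N: "P = A_times q N" "N \<in> Max_Spec (Z_Alg q)" "s_elem n q \<notin> N" by (auto simp: MM_def)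
  then have sub: "N \<subseteq> range phi" using Z.maximalideal_in_Spec Spec_Z_subset by (auto simp: Max_Spec_def)
  define m where "m = phi -` N"
  have m: "N = phi ` m" using phi_image_vimage[OF sub] by (simp add: m_def)
  have "cmaximal m" using Z.Max_Spec_iff_vimage[of N] N sub by (simp add: m_def)
  moreover from this have "P = ext m" using A_times_image_phi N(1) m by (simp add: cmaximal_def)
  moreover have "mon 1 1 0 \<notin> m" using N(3) s_elem_mem_iff m by simp
  ultimately show "P \<in> {ext m | m. cmaximal m \<and> mon 1 1 0 \<notin> m}" by blast
next
  fix P assume "P \<in> {ext m | m. cmaximal m \<and> mon 1 1 0 \<notin> m}"
  then obtain m where m: "P = ext m" "cmaximal m" "mon 1 1 0 \<notin> m" by blast
  have "phi ` m \<in> Max_Spec (Z_Alg q)"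
      using Z.Max_Spec_iff_vimage[of "phi ` m"] m by (simp add: vimage_phi_image image_subset_iff)
  moreover have "P = A_times q (phi ` m)" using A_times_image_phi m by (simp add: cmaximal_def)
  moreover have "s_elem n q \<notin> phi ` m" using s_elem_mem_iff m by simp
  ultimately show "P \<in> MM n q" unfolding MM_def by blast
qed

text \<open>One set, two roles: \<open>h_set\<close> is (h) in the skew algebra and (s) in the
  commutative ring.\<close>

lemma genideal_s_elem: "genideal (Z_Alg q) {s_elem n q} = phi ` h_set"
proof
  have "ideal (phi ` h_set) (Z_Alg q)"
    using Z.ideal_iff_vimage[of "phi ` h_set"] cprime_cideal[OF cprime_h_set]
    by (simp add: vimage_phi_image image_subset_iff)
  moreover have "s_elem n q \<in> phi ` h_set" using s_elem_mem_iff h_mem_h_set by simp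
  ultimately show "genideal (Z_Alg q) {s_elem n q} \<subseteq> phi ` h_set" unfolding genideal_def by blast
  have "phi ` h_set \<subseteq> I" if I: "ideal I (Z_Alg q)" "s_elem n q \<in> I" for I
  proof -
    have sub: "I \<subseteq> range phi" using I by (auto simp: Z.ideal_iff)
    then have "cideal (phi -` I)" using Z.ideal_iff_vimage[of I] I by simp
    moreover have "mon 1 1 0 \<in> phi -` I" using I phi_generators(2) by (simp add: gen_y_eq_mon)
    ultimately have "h_set \<subseteq> phi -` I" by (rule h_set_subset_cideal)
    then show ?thesis by blast
  qed
  then show "phi ` h_set \<subseteq> genideal (Z_Alg q) {s_elem n q}" unfolding genideal_def by blast
qed

lemma ht_eq_1_iff_minimal_prime:
    "cprime p \<Longrightarrow> ht (Z_Alg q) (phi ` p) = 1 \<longleftrightarrow> minimal_prime p"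
  using Z.ht_eq_1_iff_vimage[OF inj_phi cprime_zero, of "phi ` p"] Z.Spec_iff_vimage[of "phi ` p"]
  by (simp add: vimage_phi_image minimal_prime_def image_subset_iff)

text \<open>A minimal prime containing s contains the nonzero prime (s), hence equals it. This turns
  the exclusion of (s) into the condition that \<open>ext_mem_Spec\<close> asks for.\<close>

lemma minimal_prime_containing_s:
  fixes p :: "(int \<Rightarrow>\<^sub>0 'k poly) set"
  shows "minimal_prime p \<Longrightarrow> p \<noteq> h_set \<longleftrightarrow> mon 1 1 0 \<notin> p"
  using h_set_subset_cideal[of p] h_mem_h_set cprime_h_set h_set_nonzero
  unfolding minimal_prime_def by (metis cprime_cideal psubsetI)

lemma NN_eq: "NN n q = {ext p | p. minimal_prime p \<and> mon 1 1 0 \<notin> p}"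
proof (intro equalityI subsetI)
  fix P assume "P \<in> NN n q"
  then obtain N where N: "P = A_times q N" "N \<in> Spec (Z_Alg q)" "ht (Z_Alg q) N = 1" "N \<noteq> phi ` h_set"
    by (auto simp: NN_def genideal_s_elem)
  have sub: "N \<subseteq> range phi" using N Spec_Z_subset by blast
  define p where "p = phi -` N"
  have p: "N = phi ` p" using phi_image_vimage[OF sub] by (simp add: p_def)
  have "cprime p" using Z.Spec_iff_vimage[of N] N sub by (simp add: p_def)
  then have "minimal_prime p" "P = ext p"
    using ht_eq_1_iff_minimal_prime A_times_image_phi N p by (auto simp: cprime_cideal)
  moreover have "p \<noteq> h_set" using N p by auto
  ultimately show "P \<in> {ext p | p. minimal_prime p \<and> mon 1 1 0 \<notin> p}"
      using minimal_prime_containing_s by blast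
next
  fix P assume "P \<in> {ext p | p. minimal_prime p \<and> mon 1 1 0 \<notin> p}"
  then obtain p where p: "P = ext p" "minimal_prime p" "mon 1 1 0 \<notin> p" by blast
  have c: "cprime p" using p by (simp add: minimal_prime_def)
  have "phi ` p \<in> Spec (Z_Alg q)"
      using Z.Spec_iff_vimage[of "phi ` p"] c by (simp add: vimage_phi_image image_subset_iff)
  moreover have "P = A_times q (phi ` p)" using A_times_image_phi c p by (simp add: cprime_cideal)
  moreover have "ht (Z_Alg q) (phi ` p) = 1" using ht_eq_1_iff_minimal_prime c p by simp
  moreover have "phi ` p \<noteq> phi ` h_set"
    using minimal_prime_containing_s[OF p(2)] p(3) vimage_phi_image by metis
  ultimately show "P \<in> NN n q" unfolding NN_def genideal_s_elem by blast
qed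

lemma ext_zero: "ext {0} = {0}"
proof safe
  fix f assume "f \<in> ext {0}"
  then have "(\<Sum>i<n. \<Sum>j<n. phi (component i j f) \<star> mon 1 i (int j)) = 0" by (auto simp: ext_def)
  then show "f = 0" using decomposition[of f] by simp
qed (simp add: ext_def component_0)

lemma vimage_phi_h_set: "phi -` h_set = h_set"
proof -
  have "(\<forall>j. int n dvd j \<longrightarrow> cf f (j div int n) 0 = 0)
      \<longleftrightarrow> (\<forall>j. cf f j 0 = 0)" for f :: "int \<Rightarrow>\<^sub>0 'k poly"
    using n_pos by (metis dvd_triv_left nonzero_mult_div_cancel_left of_nat_0_eq_iff)
  then show ?thesis by (auto simp: h_set_def cf_phi)
qed

lemma ext_subset_iff:
    "cideal p \<Longrightarrow> cideal p' \<Longrightarrow> ext p \<subseteq> ext p'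
        \<longleftrightarrow> p \<subseteq> p'"
  using vimage_phi_ext[of p] vimage_phi_ext[of p'] vimage_mono[of "ext p" "ext p'" phi]
  by (auto simp: ext_def)

lemma ext_eq_iff: "cideal p \<Longrightarrow> cideal p' \<Longrightarrow> ext p = ext p' \<longleftrightarrow> p = p'"
  using vimage_phi_ext by metis

lemma ext_psubset_iff:
    "cideal p \<Longrightarrow> cideal p' \<Longrightarrow> ext p \<subset> ext p'
        \<longleftrightarrow> p \<subset> p'"
  by (simp add: less_le_not_le ext_subset_iff)

lemma Spec_eq: "Spec (Alg q) = {{0}, h_set} \<union> MM n q \<union> HH q \<union> NN n q"
proof (intro equalityI subsetI)
  fix P assume P: "P \<in> Spec (Alg q)"
  show "P \<in> {{0}, h_set} \<union> MM n q \<union> HH q \<union> NN n q"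
  proof (cases "mon 1 1 0 \<in> P")
    case True
    then have "h_set \<subseteq> P" using h_set_subset_ideal P by (simp add: Spec_Alg_iff)
    then show ?thesis using Spec_iff_cprime P by (auto simp: HH_eq)
  next
    case False
    define p where "p = phi -` P"
    have p: "cprime p" "P = ext p" "mon 1 1 0 \<notin> p"
        using Spec_not_containing_h[OF P False] by (simp_all add: p_def)
    from p(1) show ?thesis
      by (cases rule: cprime_cases) (use p ext_zero in \<open>auto simp: MM_eq NN_eq\<close>)
  qed
next
  fix P assume "P \<in> {{0}, h_set} \<union> MM n q \<union> HH q \<union> NN n q"
  moreover have "{0} \<in> Spec (Alg q)"
    using ext_mem_Spec[OF cprime_zero] mon_nonzero[of "1 :: 'k"] by (simp add: ext_zero)
  moreover have "h_set \<in> Spec (Alg q)" using Spec_iff_cprime[OF subset_refl] cprime_h_set by simp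
  moreover have "P \<in> Spec (Alg q)" if "P \<in> MM n q"
    using that ext_mem_Spec cmaximal_cprime by (auto simp: MM_eq)
  moreover have "P \<in> Spec (Alg q)" if "P \<in> NN n q"
    using that ext_mem_Spec by (auto simp: NN_eq minimal_prime_def)
  moreover have "P \<in> Spec (Alg q)" if "P \<in> HH q"
    using that Spec_iff_cprime[of P] by (auto simp: HH_eq)
  ultimately show "P \<in> Spec (Alg q)" by blast
qed

section \<open>Maximal ideals and inclusions in the skew algebra\<close>

lemma Max_Spec_subset_iff:
  assumes "M \<in> Max_Spec (Alg q)" "ideal J (Alg q)" "1 \<notin> J" "M \<subseteq> J"
  shows "M = J"
  using assms maximalideal.I_maximal[of M "Alg q" J] by (auto simp: Max_Spec_def)

lemma MM_subset_Max: "MM n q \<subseteq> Max_Spec (Alg q)"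
  using ext_mem_Max by (auto simp: MM_eq)

text \<open>Zero, \<open>h_set\<close> and the given prime form a chain of commutative primes, whose
  top is maximal.\<close>

lemma HH_subset_Max: "HH q \<subseteq> Max_Spec (Alg q)"
  using Max_of_cmaximal cmaximal_of_chain[OF cprime_h_set _ h_set_nonzero] by (auto simp: HH_eq)

lemma zero_mem_Spec: "P \<in> Spec (Alg q) \<Longrightarrow> 0 \<in> P"
  by (simp add: Spec_Alg_iff ideal_Alg_iff)

text \<open>The other primes each lie strictly inside a proper ideal; for \<open>NN n q\<close> this
  rests on minimal primes of the centre never being maximal.\<close>

lemma Max_Spec_eq: "Max_Spec (Alg q) = MM n q \<union> HH q"
proof
  show "MM n q \<union> HH q \<subseteq> Max_Spec (Alg q)" using MM_subset_Max HH_subset_Max by blast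
  show "Max_Spec (Alg q) \<subseteq> MM n q \<union> HH q"
  proof
    fix M assume M: "M \<in> Max_Spec (Alg q)"
    have "M \<noteq> {0}"
    proof
      assume "M = {0}"
      moreover have "ideal h_set (Alg q)"
          using ideal_iff_cideal[OF subset_refl] cprime_cideal[OF cprime_h_set] by simp
      ultimately have "M = h_set"
        using Max_Spec_subset_iff[OF M, of h_set] cprime_h_set by (auto simp: cprime_def cideal_def)
      then show False using \<open>M = {0}\<close> h_set_nonzero by metis
    qed
    moreover have "M \<noteq> h_set"
    proof
      assume "M = h_set"
      obtain J :: "(int \<Rightarrow>\<^sub>0 'k poly) set" where "cideal J" "h_set \<subset> J" "1 \<notin> J"
        using not_cmaximal_obtains[OF cprime_h_set h_set_not_cmaximal] .
      then show False using Max_Spec_subset_iff[OF M, of J] ideal_iff_cideal[of J] \<open>M = h_set\<close> by auto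
    qed
    moreover have "M \<notin> NN n q"
    proof
      assume "M \<in> NN n q"
      then obtain p where p: "M = ext p" "minimal_prime p" by (auto simp: NN_eq)
      then obtain J where J: "cideal J" "p \<subset> J" "1 \<notin> J"
        using not_cmaximal_obtains[OF minimal_prime_cprime minimal_prime_not_cmaximal] by metis
      have "phi 1 \<notin> ext J" using vimage_phi_ext[OF J(1)] J(3) by blast
      moreover have Ip: "cideal p" using p by (simp add: minimal_prime_def cprime_cideal)
      moreover have "M \<subseteq> ext J" using ext_subset_iff[OF Ip J(1)] p J by blast
      ultimately have "M = ext J" using Max_Spec_subset_iff[OF M ideal_ext[OF J(1)]] by simp
      then show False using p J ext_eq_iff[OF Ip J(1)] by blast
    qed
    moreover have "M \<in> Spec (Alg q)" using M maximalideal_in_Spec by (simp add: Max_Spec_def)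
    ultimately show "M \<in> MM n q \<union> HH q" unfolding Spec_eq by blast
  qed
qed

text \<open>The central element s separates these families from (h) and \<open>HH q\<close>, all of
  whose members contain it.\<close>

lemma MM_NN_without_s: "P \<in> MM n q \<union> NN n q \<Longrightarrow> phi (mon 1 1 0) \<notin> P"
  using vimage_phi_ext by (fastforce simp: MM_eq NN_eq cmaximal_def minimal_prime_def cprime_def)

lemma phi_s_mem_h_set: "phi (mon 1 1 0) \<in> h_set"
  using vimage_phi_h_set h_mem_h_set by blast

lemma MM_NN_disjoint: "MM n q \<inter> NN n q = {}"
proof -
  have False if "cmaximal m" "minimal_prime p" "ext m = ext p" for m p
    using that ext_eq_iff[of m p] minimal_prime_not_cmaximal[of p]
        by (auto simp: cmaximal_def minimal_prime_def cprime_cideal)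
  then show ?thesis unfolding MM_eq NN_eq by blast
qed

lemma zero_notin: "{0} \<notin> MM n q \<union> HH q \<union> NN n q"
proof -
  have 1: "ext p \<noteq> {0}" if "cideal p" "p \<noteq> {0}" for p
    using ext_eq_iff[of p "{0}"] that ext_zero cprime_cideal[OF cprime_zero] by metis
  have "{0} \<notin> HH q" using h_set_nonzero by (auto simp: HH_eq h_set_def)
  moreover have "{0} \<notin> MM n q"
  proof
    assume "{0} \<in> MM n q"
    then obtain m where "ext m = {0}" "cmaximal m" by (auto simp: MM_eq)
    then show False using 1 zero_not_cmaximal by (metis cmaximal_def)
  qed
  moreover have "{0} \<notin> NN n q"
  proof
    assume "{0} \<in> NN n q"
    then obtain p where "ext p = {0}" "minimal_prime p" by (auto simp: NN_eq)
    then show False using 1 by (metis minimal_prime_def cprime_cideal)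
  qed
  ultimately show ?thesis by blast
qed

text \<open>A maximal ideal cannot be the smaller one. Above a member of \<open>NN n q\<close>, the
  ideal (h) is ruled out by \<open>cprime_subset_h_set\<close> and another member by
  minimality.\<close>

lemma Spec_strict_inclusions:
  assumes P: "P \<in> Spec (Alg q)" and Q: "Q \<in> Spec (Alg q)" and PQ: "P \<subset> Q"
  shows "P = {0} \<or> (P = h_set \<and> Q \<in> HH q) \<or> (P \<in> NN n q \<and> Q \<in> MM n q \<union> HH q)"
proof -
  have "P \<notin> Max_Spec (Alg q)" using Max_Spec_subset_iff[of P Q] Q PQ by (auto simp: Spec_Alg_iff)
  then consider "P = {0}" | "P = h_set" | "P \<in> NN n q"
      using P MM_subset_Max HH_subset_Max unfolding Spec_eq by blast
  then show ?thesis
  proof cases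
    case 2
    then show ?thesis using Spec_iff_cprime[of Q] Q PQ by (auto simp: HH_eq)
  next
    case 3
    then obtain p where p: "P = ext p" "minimal_prime p" "mon 1 1 0 \<notin> p" by (auto simp: NN_eq)
    have Ip: "cideal p" using p by (simp add: minimal_prime_def cprime_cideal)
    have "Q \<noteq> {0}" using PQ zero_mem_Spec[OF P] by auto
    moreover have "Q \<noteq> h_set"
    proof
      assume "Q = h_set"
      then have "p \<subseteq> h_set" using PQ p vimage_phi_ext[OF Ip] vimage_phi_h_set by blast
      then show False using cprime_subset_h_set[of p] p by (auto simp: minimal_prime_def)
    qed
    moreover have "Q \<notin> NN n q"
    proof
      assume "Q \<in> NN n q"
      then obtain p' where p': "Q = ext p'" "minimal_prime p'" by (auto simp: NN_eq)
      then have "p \<subset> p'" using PQ p(1) Ip ext_psubset_iff by (simp add: minimal_prime_def cprime_cideal)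
      then show False using p p' by (auto simp: minimal_prime_def)
    qed
    ultimately show ?thesis using 3 Q unfolding Spec_eq by blast
  qed auto
qed

text \<open>A nonzero coordinate stays nonzero after multiplication by a power of s, the commutative
  ring being a domain.\<close>

lemma ideal_meets_centre:
  assumes I: "ideal I (Alg q)" and "I \<noteq> {0}"
  shows "I \<inter> centre (Alg q) \<noteq> {0}"
proof -
  obtain f where f: "f \<in> I" "f \<noteq> 0" using assms by (auto simp: ideal_Alg_iff)
  then have "f \<notin> ext {0}" by (simp add: ext_zero)
  then obtain i j where ij: "i < n" "j < n" "component i j f \<noteq> 0" by (auto simp: ext_def)
  obtain k where k: "phi (mon 1 1 0 ^ k * component i j f) \<in> I" using component_mem_ideal[OF I f(1) ij(1,2)] .
  have "mon (1 :: 'k) 1 0 \<noteq> 0" by (rule mon_nonzero) simp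
  then have "mon 1 1 0 ^ k * component i j f \<noteq> 0" using ij by simp
  then have "phi (mon 1 1 0 ^ k * component i j f) \<noteq> 0" using inj_phi phi_0 by (metis injD)
  then show ?thesis using k by (auto simp: centre_eq)
qed

end

theorem theorem4p9:
  fixes q :: "'k::field" and n :: nat
  assumes "n \<ge> 2" and "primitive_root_of_unity n q"
  shows
    \<comment> \<open>the centre is the Laurent polynomial algebra in s and t\<close>
    "(\<exists>\<phi> \<in> ring_iso laurent_alg (Z_Alg q).
        (\<forall>c. \<phi> (scalar c) = scalar c) \<and> \<phi> gen_y = s_elem n q \<and> \<phi> gen_z = t_elem n q)
     \<and> \<comment> \<open>1\<close>
     Spec (Alg q) = {{\<zero>\<^bsub>Alg q\<^esub>}, h_ideal q} \<union> MM n q \<union> HH q \<union> NN n q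
     \<and> {\<zero>\<^bsub>Alg q\<^esub>} \<noteq> h_ideal q
     \<and> {{\<zero>\<^bsub>Alg q\<^esub>}, h_ideal q} \<inter> (MM n q \<union> HH q \<union> NN n q) = {}
     \<and> MM n q \<inter> (HH q \<union> NN n q) = {} \<and> HH q \<inter> NN n q = {}
     \<and> (\<forall>P \<in> Spec (Alg q) - {{\<zero>\<^bsub>Alg q\<^esub>}}. {\<zero>\<^bsub>Alg q\<^esub>} \<subset> P)
     \<and> (\<forall>P \<in> HH q. h_ideal q \<subset> P)
     \<and> (\<forall>P \<in> Spec (Alg q). \<forall>Q \<in> Spec (Alg q). P \<subset> Q \<longrightarrow>
          P = {\<zero>\<^bsub>Alg q\<^esub>} \<or> (P = h_ideal q \<and> Q \<in> HH q) \<or>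
          (P \<in> NN n q \<and> Q \<in> MM n q \<union> HH q))
     \<and> \<comment> \<open>2\<close>
     (\<forall>I. ideal I (Alg q) \<and> I \<noteq> {\<zero>\<^bsub>Alg q\<^esub>} \<longrightarrow> I \<inter> centre (Alg q) \<noteq> {\<zero>\<^bsub>Alg q\<^esub>})
     \<and> \<comment> \<open>3\<close>
     Max_Spec (Alg q) = MM n q \<union> HH q \<and> MM n q \<inter> HH q = {}"
proof -
  interpret root_alg q n using assms by unfold_locales
  have HH: "h_set \<subset> P" if "P \<in> HH q" for P using that by (simp add: HH_eq)
  have disj: "HH q \<inter> (MM n q \<union> NN n q) = {}" using HH MM_NN_without_s phi_s_mem_h_set by blast
  have h: "h_set \<notin> MM n q \<union> HH q \<union> NN n q" using HH MM_NN_without_s phi_s_mem_h_set by blast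
  show ?thesis
    unfolding Alg_simps h_ideal_eq
  proof (intro conjI)
    show "\<exists>\<phi>\<in>ring_iso laurent_alg (Z_Alg q).
        (\<forall>c. \<phi> (scalar c) = scalar c) \<and> \<phi> gen_y = s_elem n q \<and> \<phi> gen_z = t_elem n q"
      using phi_ring_iso phi_generators by blast
    show "Spec (Alg q) = {{0}, h_set} \<union> MM n q \<union> HH q \<union> NN n q" by (rule Spec_eq)
    show "{0} \<noteq> (h_set :: (int \<Rightarrow>\<^sub>0 'k poly) set)" using h_set_nonzero by blast
    show "{{0}, h_set} \<inter> (MM n q \<union> HH q \<union> NN n q) = {}" using zero_notin h by blast
    show "MM n q \<inter> (HH q \<union> NN n q) = {}" "HH q \<inter> NN n q = {}" "MM n q \<inter> HH q = {}"
      using disj MM_NN_disjoint by blast+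
    show "\<forall>P\<in>Spec (Alg q) - {{0}}. {0} \<subset> P" using zero_mem_Spec by blast
    show "\<forall>P\<in>HH q. h_set \<subset> P" using HH by blast
    show "\<forall>P\<in>Spec (Alg q). \<forall>Q\<in>Spec (Alg q). P \<subset> Q \<longrightarrow>
        P = {0} \<or> (P = h_set \<and> Q \<in> HH q) \<or> (P \<in> NN n q \<and> Q \<in> MM n q \<union> HH q)"
      using Spec_strict_inclusions by blast
    show "\<forall>I. ideal I (Alg q) \<and> I \<noteq> {0} \<longrightarrow> I \<inter> centre (Alg q) \<noteq> {0}"
      using ideal_meets_centre by blast
    show "Max_Spec (Alg q) = MM n q \<union> HH q" by (rule Max_Spec_eq)
  qed
qed

end
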